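(* Assume (A1) and (A2) below. Then for every $D>0$ and $P>0$, $$R_{\mathrm{nr}}(D,P)=R(D,P).$$ (A1) For each fixed $\mu\in\mathcal P(\mathcal X)$, the map $\nu\mapsto d(\mu,\nu)$ is convex. (A2) This assumption has two parts. - For every $D>0$ and $P>0$, $R(D,P)<\infty$. - For every $D>0$, $P>0$ and $\epsilon>0$ there is a Markov kernel $p_{\tilde X|X}$ such that $\tilde X$ is discrete with support $\tilde{\mathcal X}\subseteq\mathcal X$, $|\tilde{\mathcal X}|<\infty$, and all of the following hold: - $I(X;\tilde X)\le R(D,P)+\epsilon$; - $\mathbb E[\Delta(X,\tilde X)]\le D+\epsilon$; - $\mathbb E[\max_{\tilde x\in\tilde{\mathcal X}}\Delta(X,\tilde x)]<\infty$; - $d(p_X,p_{\tilde X})\le P+\epsilon$; - $d(p_X,\gamma)<\infty$ for every distribution $\gamma$ supported on $\tilde{\mathcal X}$.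
   Context: Let $\mathcal X$ be a Polish metric space with its Borel $\sigma$-algebra, and let $\mathcal P(\mathcal X)$ be the set of Borel probability measures on $\mathcal X$. Let $X\sim p_X\in\mathcal P(\mathcal X)$, and let $\{X_t\}_{t\ge1}$ be i.i.d. with marginal $p_X$. Let $\Delta:\mathcal X\times\mathcal X\to[0,\infty)$ be a measurable distortion function with $\Delta(x,\hat x)=0$ iff $x=\hat x$. Let $d:\mathcal P(\mathcal X)\times\mathcal P(\mathcal X)\to[0,\infty]$ be a divergence with $d(\mu,\nu)=0$ iff $\mu=\nu$. The rate-distortion-perception function is $$R(D,P):=\inf I(X;\hat X),$$ where the infimum is over Markov kernels $p_{\hat X|X}$ from $\mathcal X$ to $\mathcal X$ with $\mathbb E[\Delta(X,\hat X)]\le D$ and $d(p_X,p_{\hat X})\le P$. Logarithms are base 2. Operational definitions. A rate $R$ is achievable with common randomness if, for all sufficiently large $n$, there exist: - a distribution $p_Q$ on a Polish space; - an encoder kernel $p_{Z|X^nQ}$ with $Z$ taking values in a countable set; - a decoder kernel $p_{\hat X^n|ZQ}$ with $\hat X^n\in\mathcal X^n$; such that, under $p_X^{n}p_Qp_{Z|X^nQ}p_{\hat X^n|ZQ}$, the following hold: - $\frac1nH(Z|Q)\le R$; - $\frac1n\sum_{t=1}^n\mathbb E[\Delta(X_t,\hat X_t)]\le D$; - $d(p_X,p_{\hat X_t})\le P$ for all $t\in[1:n]$. $R_{\mathrm{cr}}(D,P)$ is the infimum of such $R$. $R_{\mathrm{pr}}(D,P)$ is defined in the same way with $Q$ constant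 (private randomness only). $R_{\mathrm{nr}}(D,P)$ is defined in the same way with $Q$ constant, $Z$ a deterministic function of $X^n$, and $\hat X^n$ a deterministic function of $Z$ (no randomness). *)

theory Defs
  imports "HOL-Probability.Probability"
begin

definition prob_meas :: "'a::polish_space measure \<Rightarrow> bool" where
  "prob_meas \<mu> \<longleftrightarrow> prob_space \<mu> \<and> sets \<mu> = sets (borel :: 'a measure)"

definition markov_kernel :: "('a::polish_space \<Rightarrow> 'a measure) \<Rightarrow> bool" where
  "markov_kernel K \<longleftrightarrow> K \<in> (borel :: 'a measure) \<rightarrow>\<^sub>M prob_algebra (borel :: 'a measure)"

definition mix :: "real \<Rightarrow> 'a::polish_space measure \<Rightarrow> 'a measure \<Rightarrow> 'a measure" where
  "mix l \<nu>1 \<nu>2 = measure_of (space (borel :: 'a measure)) (sets (borel :: 'a measure))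
     (\<lambda>A. ennreal l * emeasure \<nu>1 A + ennreal (1 - l) * emeasure \<nu>2 A)"

text \<open>Integrand for KL divergence in bits: t log2 t - (t - 1)/ln 2 (nonnegative).\<close>
definition kl_fun :: "real \<Rightarrow> real" where
  "kl_fun t = (if t = 0 then 0 else t * log 2 t) - (t - 1) / ln 2"

text \<open>KL divergence D(P||Q) (base 2), valued in [0,\<infinity>]; \<infinity> unless P << Q.
  For probability measures P, Q with P << Q and f = dP/dQ this equals
  the integral of f log2 f dQ.\<close>
definition KL2 :: "'b measure \<Rightarrow> 'b measure \<Rightarrow> ennreal" where
  "KL2 P Q = (if absolutely_continuous Q P
      then (\<integral>\<^sup>+ z. ennreal (kl_fun (enn2real (RN_deriv Q P z))) \<partial>Q)
      else \<infinity>)"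

definition joint :: "'a::polish_space measure \<Rightarrow> ('a \<Rightarrow> 'a measure) \<Rightarrow> ('a \<times> 'a) measure" where
  "joint M K = M \<bind> (\<lambda>x. distr (K x) (borel \<Otimes>\<^sub>M borel) (\<lambda>y. (x, y)))"

definition outlaw :: "'a::polish_space measure \<Rightarrow> ('a \<Rightarrow> 'a measure) \<Rightarrow> 'a measure" where
  "outlaw M K = M \<bind> K"

definition mutual_info :: "'a::polish_space measure \<Rightarrow> ('a \<Rightarrow> 'a measure) \<Rightarrow> ennreal" where
  "mutual_info M K = KL2 (joint M K) (M \<Otimes>\<^sub>M outlaw M K)"

definition exp_dist :: "'a::polish_space measure \<Rightarrow> ('a \<Rightarrow> 'a \<Rightarrow> real) \<Rightarrow> ('a \<Rightarrow> 'a measure) \<Rightarrow> ennreal" where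
  "exp_dist M \<Delta> K = (\<integral>\<^sup>+ x. (\<integral>\<^sup>+ y. ennreal (\<Delta> x y) \<partial>K x) \<partial>M)"

definition RDP :: "'a::polish_space measure \<Rightarrow> ('a \<Rightarrow> 'a \<Rightarrow> real)
    \<Rightarrow> ('a measure \<Rightarrow> 'a measure \<Rightarrow> ennreal) \<Rightarrow> real \<Rightarrow> real \<Rightarrow> ereal" where
  "RDP M \<Delta> d D P = Inf {enn2ereal (mutual_info M K) | K.
      markov_kernel K \<and> enn2ereal (exp_dist M \<Delta> K) \<le> ereal D
      \<and> enn2ereal (d M (outlaw M K)) \<le> ereal P}"

text \<open>Entropy (bits) of a Z-valued (Z = nat, any countable alphabet) discrete variable f under N.\<close>
definition entropy_disc :: "'b measure \<Rightarrow> ('b \<Rightarrow> nat) \<Rightarrow> ennreal" where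
  "entropy_disc N f = (\<Sum>z. ennreal (- (measure N (f -` {z} \<inter> space N)
                                * log 2 (measure N (f -` {z} \<inter> space N)))))"

text \<open>Achievability without any randomness at block length n: deterministic encoder
  f : X^n -> Z (countable, encoded as nat) and deterministic decoder g : Z -> X^n
  (g z t is the t-th output symbol).  X^n is i.i.d. with law M.\<close>
definition nr_code :: "'a::polish_space measure \<Rightarrow> ('a \<Rightarrow> 'a \<Rightarrow> real)
    \<Rightarrow> ('a measure \<Rightarrow> 'a measure \<Rightarrow> ennreal) \<Rightarrow> real \<Rightarrow> real \<Rightarrow> real \<Rightarrow> nat \<Rightarrow> bool" where
  "nr_code M \<Delta> d D P R n \<longleftrightarrow> (\<exists>(f :: (nat \<Rightarrow> 'a) \<Rightarrow> nat) (g :: nat \<Rightarrow> nat \<Rightarrow> 'a).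
      f \<in> (\<Pi>\<^sub>M i\<in>{..<n}. (borel :: 'a measure)) \<rightarrow>\<^sub>M count_space UNIV
    \<and> enn2ereal (entropy_disc (\<Pi>\<^sub>M i\<in>{..<n}. M) f) \<le> ereal (real n * R)
    \<and> enn2ereal (\<Sum>t<n. \<integral>\<^sup>+ x. ennreal (\<Delta> (x t) (g (f x) t)) \<partial>(\<Pi>\<^sub>M i\<in>{..<n}. M))
         \<le> ereal (real n * D)
    \<and> (\<forall>t<n. enn2ereal (d M (distr (\<Pi>\<^sub>M i\<in>{..<n}. M) borel (\<lambda>x. g (f x) t))) \<le> ereal P))"

definition achievable_nr :: "'a::polish_space measure \<Rightarrow> ('a \<Rightarrow> 'a \<Rightarrow> real)
    \<Rightarrow> ('a measure \<Rightarrow> 'a measure \<Rightarrow> ennreal) \<Rightarrow> real \<Rightarrow> real \<Rightarrow> real \<Rightarrow> bool" where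
  "achievable_nr M \<Delta> d D P R \<longleftrightarrow> (\<exists>N. \<forall>n\<ge>N. n > 0 \<longrightarrow> nr_code M \<Delta> d D P R n)"

definition R_nr :: "'a::polish_space measure \<Rightarrow> ('a \<Rightarrow> 'a \<Rightarrow> real)
    \<Rightarrow> ('a measure \<Rightarrow> 'a measure \<Rightarrow> ennreal) \<Rightarrow> real \<Rightarrow> real \<Rightarrow> ereal" where
  "R_nr M \<Delta> d D P = Inf (ereal ` {R. achievable_nr M \<Delta> d D P R})"

end

theory Submission
  imports Defs
begin

text \<open>
  Converse: for a code $(f, g)$ let $p$ be the law of $Z = f(X^n)$, and let $r$ be the density of the
  channel obtained by feeding a symbol at a uniformly random position of the block. Then
  $Y = p(Z) \prod_t r(X_t, g(Z)_t)$ has mean at most 1, so $E \ln Y \le 0$, which says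
  $n I \le H(Z)$ for that channel.

  Achievability: mixing a near-optimal finite kernel with a little of a better one gives strict slack
  in both constraints. Codewords are drawn from the output law; $x^n$ is mapped to the first one that
  rejection sampling accepts, so for each fixed $x^n$ the output has almost the law prescribed by the
  kernel. Randomness is removed by giving each pattern of events $X_i \in E$, $i < \delta n$, a codebook
  of its own: since every pattern is exponentially unlikely, the marginals of the outputs concentrate,
  and codebooks can be fixed pattern by pattern. This needs a set $E$ of probability strictly between
  0 and 1; otherwise the source is a point mass.
\<close>

section \<open>Kernels and densities\<close>

text \<open>In the converse \<open>Y\<close> has mean at most 1 because a fixed codeword no longer
  depends on the source: each factor \<open>r (X_t) y\<close> has mean at most 1 over
  \<open>X_t\<close>, and the weights \<open>p z\<close> sum to 1. A single block length already
  gives the bound. The obstacle in the other half is the perception constraint. It must hold exactly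
  and at every position, for a divergence about which only convexity and finiteness on finite
  supports are known, so closeness of marginals says nothing by itself. Convexity does give this: if
  a law \<open>\<gamma>\<close> on the finite support satisfies
  \<open>\<gamma> \<ge> (1 - l) q\<close> at every atom, then it is a mixture of \<open>q\<close>
  and of a law of weight \<open>l\<close> on the support, and its divergence is at most that of
  \<open>q\<close> plus \<open>l\<close> times a constant. Hence an error per atom that does not
  shrink with \<open>n\<close> is affordable as soon as there is strict slack. (A2) overshoots both
  constraints by \<open>\<epsilon>\<close>; the slack has to come from a second kernel, built for
  smaller levels. The patterns cost \<open>\<delta>\<close> bits per symbol, and the squares of
  their probabilities sum to at most \<open>p^k\<close>, where \<open>p\<close> is the larger of the
  probabilities of \<open>E\<close> and its complement.\<close>

lemma prob_measD:
  assumes "prob_meas \<mu>"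
  shows "prob_space \<mu>" "sets \<mu> = sets borel" "space \<mu> = UNIV"
  using assms sets_eq_imp_space_eq[of \<mu> borel] by (auto simp: prob_meas_def)

lemma prob_meas_in_prob_algebra:
  "prob_meas \<mu> \<Longrightarrow> \<mu> \<in> space (prob_algebra borel)"
  by (auto simp: prob_meas_def space_prob_algebra)

lemma markov_kernelD:
  assumes "markov_kernel K"
  shows "K \<in> borel \<rightarrow>\<^sub>M subprob_algebra borel" "prob_meas (K x)"
  using assms measurable_space[of K borel "prob_algebra borel" x]
  by (auto simp: markov_kernel_def prob_meas_def space_prob_algebra intro: measurable_prob_algebraD)

lemma prob_meas_outlaw:
  assumes "prob_meas M" "markov_kernel K"
  shows "prob_meas (outlaw M K)"
  using prob_space_bind'[OF prob_meas_in_prob_algebra[OF assms(1)], of K borel]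
    sets_bind'[OF prob_meas_in_prob_algebra[OF assms(1)], of K borel] assms(2)
  by (simp add: prob_meas_def outlaw_def markov_kernel_def)

lemma nn_integral_outlaw:
  assumes "prob_meas M" "markov_kernel K" "h \<in> borel_measurable borel"
  shows "(\<integral>\<^sup>+y. h y \<partial>outlaw M K) = (\<integral>\<^sup>+x. \<integral>\<^sup>+y. h y \<partial>K x \<partial>M)"
  unfolding outlaw_def
  using assms prob_measD(2)[OF assms(1)] markov_kernelD(1)[OF assms(2)]
  by (intro nn_integral_bind) (auto cong: measurable_cong_sets)

lemma emeasure_outlaw:
  assumes "prob_meas M" "markov_kernel K" "A \<in> sets borel"
  shows "emeasure (outlaw M K) A = (\<integral>\<^sup>+x. emeasure (K x) A \<partial>M)"
  using nn_integral_outlaw[OF assms(1,2), of "indicator A"] assms(3)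
    prob_measD(2)[OF prob_meas_outlaw[OF assms(1,2)]] prob_measD(2)[OF markov_kernelD(2)[OF assms(2)]]
  by simp

lemma measurable_joint_kernel:
  assumes "markov_kernel K"
  shows "(\<lambda>x. distr (K x) (borel \<Otimes>\<^sub>M borel) (\<lambda>y. (x, y)))
    \<in> borel \<rightarrow>\<^sub>M subprob_algebra (borel \<Otimes>\<^sub>M borel)"
  using markov_kernelD(1)[OF assms] by (intro measurable_distr2) auto

lemma sets_joint:
  assumes "prob_meas M" "markov_kernel K"
  shows "sets (joint M K) = sets (borel \<Otimes>\<^sub>M borel)"
  unfolding joint_def using prob_measD[OF assms(1)] measurable_joint_kernel[OF assms(2)]
  by (intro sets_bind_measurable) (auto cong: measurable_cong_sets)

lemma nn_integral_joint:
  assumes M: "prob_meas M" and K: "markov_kernel K"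
    and h: "h \<in> borel_measurable (borel \<Otimes>\<^sub>M borel)"
  shows "(\<integral>\<^sup>+z. h z \<partial>joint M K) = (\<integral>\<^sup>+x. \<integral>\<^sup>+y. h (x, y) \<partial>K x \<partial>M)"
proof -
  have "(\<integral>\<^sup>+z. h z \<partial>joint M K) = (\<integral>\<^sup>+x. \<integral>\<^sup>+z. h z \<partial>distr (K x) (borel \<Otimes>\<^sub>M borel) (\<lambda>y. (x, y)) \<partial>M)"
    unfolding joint_def using measurable_joint_kernel[OF K] prob_measD(2)[OF M] h
    by (intro nn_integral_bind) (auto cong: measurable_cong_sets)
  also have "\<dots> = (\<integral>\<^sup>+x. \<integral>\<^sup>+y. h (x, y) \<partial>K x \<partial>M)"
    using h prob_measD(2)[OF markov_kernelD(2)[OF K]]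
    by (intro nn_integral_cong nn_integral_distr) (auto cong: measurable_cong_sets)
  finally show ?thesis .
qed

text \<open>\<open>RN_deriv\<close> is determined only almost everywhere, and the integral in
  \<open>KL2\<close> does not see null sets, so an explicit density may stand in for it.\<close>

lemma KL2_density:
  assumes "sigma_finite_measure Q" and [measurable]: "f \<in> borel_measurable Q"
    and "\<And>z. 0 \<le> f z" and "P = density Q (\<lambda>z. ennreal (f z))"
  shows "KL2 P Q = (\<integral>\<^sup>+z. ennreal (kl_fun (f z)) \<partial>Q)"
proof -
  interpret sigma_finite_measure Q by fact
  have "AE z in Q. ennreal (f z) = RN_deriv Q P z"
    using assms by (intro RN_deriv_unique) auto
  then have "AE z in Q. enn2real (RN_deriv Q P z) = f z"
    by eventually_elim (metis assms(3) enn2real_ennreal)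
  then have "(\<integral>\<^sup>+z. ennreal (kl_fun (enn2real (RN_deriv Q P z))) \<partial>Q) = (\<integral>\<^sup>+z. ennreal (kl_fun (f z)) \<partial>Q)"
    by (intro nn_integral_cong_AE) auto
  moreover have "absolutely_continuous Q P"
    using assms(4) by (auto intro: absolutely_continuousI_density)
  ultimately show ?thesis
    by (simp add: KL2_def)
qed

text \<open>On the support, \<open>h y\<close> is the sum over \<open>c\<close> in \<open>C\<close>
  of \<open>h c\<close> times the indicator of \<open>c\<close>, and for countable \<open>C\<close>
  this sum may be exchanged with the integral. Statements about densities thereby reduce to
  comparing masses of atoms.\<close>

lemma nn_integral_countable_support:
  fixes \<nu> :: "'a::polish_space measure"
  assumes \<nu>[measurable_cong]: "sets \<nu> = sets borel" and C: "countable C" and AEC: "AE y in \<nu>. y \<in> C"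
    and [measurable]: "h \<in> borel_measurable borel"
  shows "(\<integral>\<^sup>+y. h y \<partial>\<nu>) = (\<integral>\<^sup>+c. h c * emeasure \<nu> {c} \<partial>count_space C)"
proof -
  have "(\<integral>\<^sup>+y. h y \<partial>\<nu>) = (\<integral>\<^sup>+y. (\<integral>\<^sup>+c. h c * indicator {c} y \<partial>count_space C) \<partial>\<nu>)"
  proof (rule nn_integral_cong_AE, use AEC in eventually_elim)
    fix y assume y: "y \<in> C"
    have "(\<integral>\<^sup>+c. h c * indicator {c} y \<partial>count_space C) = (\<integral>\<^sup>+c. h y * indicator {y} c \<partial>count_space C)"
      by (intro nn_integral_cong) (auto split: split_indicator)
    also have "\<dots> = h y"
      using y by (subst nn_integral_cmult_indicator) auto
    finally show "h y = (\<integral>\<^sup>+c. h c * indicator {c} y \<partial>count_space C)" by simp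
  qed
  also have "\<dots> = (\<integral>\<^sup>+c. (\<integral>\<^sup>+y. h c * indicator {c} y \<partial>\<nu>) \<partial>count_space C)"
    by (intro nn_integral_count_space_nn_integral C) measurable
  also have "\<dots> = (\<integral>\<^sup>+c. h c * emeasure \<nu> {c} \<partial>count_space C)"
    using \<nu> by (intro nn_integral_cong nn_integral_cmult_indicator) auto
  finally show ?thesis .
qed

text \<open>When the output law sits on a countable set, this ratio of atoms is the density of
  \<open>K x\<close> with respect to it. Off the atoms it is 0 by the convention for division by
  zero, so it is a total real function. It is also jointly measurable, which a Radon-Nikodym
  derivative chosen separately for each \<open>x\<close> need not be.\<close>

definition kdens :: "'a::polish_space measure \<Rightarrow> ('a \<Rightarrow> 'a measure) \<Rightarrow> 'a \<Rightarrow> 'a \<Rightarrow> real" where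
  "kdens M K x y = measure (K x) {y} / measure (outlaw M K) {y}"

lemma kdens_nonneg: "0 \<le> kdens M K x y"
  by (simp add: kdens_def)

text \<open>The singletons are the sections of the diagonal, which is measurable as the zero set of
  \<open>dist\<close>.\<close>

lemma measurable_measure_singleton:
  fixes K :: "'b \<Rightarrow> 'a::polish_space measure"
  assumes "K \<in> N \<rightarrow>\<^sub>M subprob_algebra borel"
  shows "(\<lambda>(x, y). measure (K x) {y}) \<in> borel_measurable (N \<Otimes>\<^sub>M borel)"
proof -
  have "(SIGMA z:space (N \<Otimes>\<^sub>M (borel :: 'a measure)). {snd z}) =
      {w \<in> space ((N \<Otimes>\<^sub>M borel) \<Otimes>\<^sub>M borel). dist (snd (fst w)) (snd w) = (0::real)}"
    by (auto simp: space_pair_measure)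
  also have "\<dots> \<in> sets ((N \<Otimes>\<^sub>M borel) \<Otimes>\<^sub>M borel)"
    by measurable
  finally have "(\<lambda>z. measure (K (fst z)) {snd z}) \<in> borel_measurable (N \<Otimes>\<^sub>M borel)"
    using assms by (intro measure_measurable_subprob_algebra2[of _ _ borel] measurable_compose[OF measurable_fst])
  then show ?thesis by (simp add: case_prod_beta')
qed

lemma measurable_kdens:
  assumes M: "prob_meas M" and K: "markov_kernel K"
  shows "case_prod (kdens M K) \<in> borel_measurable (borel \<Otimes>\<^sub>M borel)"
proof -
  have *: "outlaw M K \<in> space (subprob_algebra borel)"
    using prob_meas_outlaw[OF M K]
    by (auto simp: space_subprob_algebra prob_meas_def prob_space_imp_subprob_space)
  have [measurable]: "(\<lambda>(x::'a, y). measure (outlaw M K) {y}) \<in> borel_measurable (borel \<Otimes>\<^sub>M borel)"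
    using * by (intro measurable_measure_singleton) auto
  have [measurable]: "(\<lambda>(x, y). measure (K x) {y}) \<in> borel_measurable (borel \<Otimes>\<^sub>M borel)"
    by (intro measurable_measure_singleton markov_kernelD K)
  have "case_prod (kdens M K) = (\<lambda>z. (\<lambda>(x, y). measure (K x) {y}) z / (\<lambda>(x::'a, y). measure (outlaw M K) {y}) z)"
    by (auto simp: kdens_def fun_eq_iff)
  also have "\<dots> \<in> borel_measurable (borel \<Otimes>\<^sub>M borel)" by measurable
  finally show ?thesis .
qed

text \<open>The masses of \<open>- C\<close> under \<open>K x\<close> average to its mass under the
  output law, which is 0, and a nonnegative function with integral 0 vanishes almost
  everywhere.\<close>

lemma AE_kernel_support:
  assumes M: "prob_meas M" and K: "markov_kernel K" and C: "C \<in> sets borel"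
    and AEC: "AE y in outlaw M K. y \<in> C"
  shows "AE x in M. AE y in K x. y \<in> C"
proof -
  have "emeasure (outlaw M K) (- C) = 0"
    using AEC C prob_measD(2,3)[OF prob_meas_outlaw[OF M K]]
    by (subst (asm) AE_iff_measurable[of "- C"]) auto
  then have "(\<integral>\<^sup>+x. emeasure (K x) (- C) \<partial>M) = 0"
    using emeasure_outlaw[OF M K, of "- C"] C by auto
  then have "AE x in M. emeasure (K x) (- C) = 0"
    using markov_kernelD(1)[OF K] C prob_measD(2)[OF M]
    by (subst (asm) nn_integral_0_iff_AE) (auto cong: measurable_cong_sets intro: measurable_emeasure_kernel)
  then show ?thesis
  proof eventually_elim
    fix x assume "emeasure (K x) (- C) = 0"
    then show "AE y in K x. y \<in> C"
      using C prob_measD(2,3)[OF markov_kernelD(2)[OF K, of x]]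
      by (subst AE_iff_measurable[of "- C"]) auto
  qed
qed

text \<open>An atom of output mass 0 has mass 0 under almost every \<open>K x\<close>; countability
  of \<open>C\<close> lets one exceptional set serve all atoms, and outside it \<open>kdens\<close>
  is a genuine density. The quantifier over \<open>h\<close> stands inside the almost-everywhere
  statement because later integrands \<open>h (x, y)\<close> change with \<open>x\<close>.\<close>

lemma nn_integral_kernel_kdens:
  assumes M: "prob_meas M" and K: "markov_kernel K" and C: "countable C"
    and AEC: "AE y in outlaw M K. y \<in> C"
  shows "AE x in M. \<forall>h\<in>borel_measurable borel.
    (\<integral>\<^sup>+y. h y \<partial>K x) = (\<integral>\<^sup>+y. ennreal (kdens M K x y) * h y \<partial>outlaw M K)"
proof -
  let ?q = "outlaw M K"
  have Cb: "C \<in> sets borel" using C by (rule sets.countable[rotated]) auto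
  note q = prob_measD[OF prob_meas_outlaw[OF M K]]
  note k = prob_measD[OF markov_kernelD(2)[OF K]]
  have null: "AE x in M. \<forall>c\<in>C. emeasure ?q {c} = 0 \<longrightarrow> emeasure (K x) {c} = 0"
  proof (subst AE_ball_countable[OF C], intro ballI)
    fix c
    show "AE x in M. emeasure ?q {c} = 0 \<longrightarrow> emeasure (K x) {c} = 0"
    proof (cases "emeasure ?q {c} = 0")
      case True
      then have "AE y in ?q. y \<in> - {c}"
        using q by (subst AE_iff_measurable[of "{c}"]) auto
      from AE_kernel_support[OF M K _ this] have "AE x in M. AE y in K x. y \<in> - {c}" by simp
      then show ?thesis
      proof (eventually_elim)
        fix x assume "AE y in K x. y \<in> - {c}"
        then show "emeasure ?q {c} = 0 \<longrightarrow> emeasure (K x) {c} = 0"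
          using k[of x] by (subst (asm) AE_iff_measurable[of "{c}"]) auto
      qed
    qed simp
  qed
  from AE_kernel_support[OF M K Cb AEC] null show ?thesis
  proof eventually_elim
    fix x assume x: "AE y in K x. y \<in> C" "\<forall>c\<in>C. emeasure ?q {c} = 0 \<longrightarrow> emeasure (K x) {c} = 0"
    interpret q: prob_space ?q by (rule q)
    interpret k: prob_space "K x" by (rule k)
    show "\<forall>h\<in>borel_measurable borel.
      (\<integral>\<^sup>+y. h y \<partial>K x) = (\<integral>\<^sup>+y. ennreal (kdens M K x y) * h y \<partial>outlaw M K)"
    proof
      fix h :: "'a \<Rightarrow> ennreal" assume h[measurable]: "h \<in> borel_measurable borel"
      have [measurable]: "(\<lambda>y. kdens M K x y) \<in> borel_measurable borel"
        using measurable_compose[OF measurable_Pair1' measurable_kdens[OF M K], of x] by simp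
      have "(\<integral>\<^sup>+y. h y \<partial>K x) = (\<integral>\<^sup>+c. h c * emeasure (K x) {c} \<partial>count_space C)"
        by (intro nn_integral_countable_support k C x h)
      also have "\<dots> = (\<integral>\<^sup>+c. (ennreal (kdens M K x c) * h c) * emeasure ?q {c} \<partial>count_space C)"
      proof (intro nn_integral_cong)
        fix c assume "c \<in> space (count_space C)"
        then have "measure ?q {c} = 0 \<longrightarrow> measure (K x) {c} = 0"
          using x(2) by (auto simp: q.emeasure_eq_measure k.emeasure_eq_measure)
        then have "ennreal (kdens M K x c) * emeasure ?q {c} = emeasure (K x) {c}"
          by (auto simp: q.emeasure_eq_measure k.emeasure_eq_measure ennreal_mult'[symmetric] kdens_def)
        then show "h c * emeasure (K x) {c} = (ennreal (kdens M K x c) * h c) * emeasure ?q {c}"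
          by (metis mult.assoc mult.commute)
      qed
      also have "\<dots> = (\<integral>\<^sup>+y. ennreal (kdens M K x y) * h y \<partial>?q)"
        by (intro nn_integral_countable_support[symmetric] q C AEC) measurable
      finally show "(\<integral>\<^sup>+y. h y \<partial>K x) = (\<integral>\<^sup>+y. ennreal (kdens M K x y) * h y \<partial>outlaw M K)" .
    qed
  qed
qed

lemma joint_eq_density:
  assumes M: "prob_meas M" and K: "markov_kernel K" and C: "countable C"
    and AEC: "AE y in outlaw M K. y \<in> C"
  shows "joint M K = density (M \<Otimes>\<^sub>M outlaw M K) (\<lambda>z. ennreal (case_prod (kdens M K) z))"
proof (rule measure_eqI)
  let ?q = "outlaw M K"
  note q = prob_measD[OF prob_meas_outlaw[OF M K]]
  interpret q: prob_space ?q by (rule q)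
  have [measurable_cong]: "sets M = sets borel" "sets ?q = sets borel"
    using q prob_measD[OF M] by auto
  show s: "sets (joint M K) = sets (density (M \<Otimes>\<^sub>M ?q) (\<lambda>z. ennreal (case_prod (kdens M K) z)))"
    using q prob_measD[OF M] by (auto simp: sets_joint[OF M K] intro!: sets_pair_measure_cong)
  note measurable_kdens[OF M K, measurable]
  fix A assume "A \<in> sets (joint M K)"
  then have A[measurable]: "A \<in> sets (borel \<Otimes>\<^sub>M borel)" by (simp add: sets_joint[OF M K])
  then have A': "A \<in> sets (M \<Otimes>\<^sub>M ?q)" by measurable
  have "emeasure (joint M K) A = (\<integral>\<^sup>+x. \<integral>\<^sup>+y. indicator A (x, y) \<partial>K x \<partial>M)"
    using nn_integral_joint[OF M K, of "indicator A"] A by (simp add: sets_joint[OF M K])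
  also have "\<dots> = (\<integral>\<^sup>+x. \<integral>\<^sup>+y. ennreal (kdens M K x y) * indicator A (x, y) \<partial>?q \<partial>M)"
    using nn_integral_kernel_kdens[OF M K C AEC]
  proof (intro nn_integral_cong_AE, eventually_elim)
    fix x assume *: "\<forall>h\<in>borel_measurable borel.
      (\<integral>\<^sup>+y. h y \<partial>K x) = (\<integral>\<^sup>+y. ennreal (kdens M K x y) * h y \<partial>?q)"
    show "(\<integral>\<^sup>+y. indicator A (x, y) \<partial>K x) = (\<integral>\<^sup>+y. ennreal (kdens M K x y) * indicator A (x, y) \<partial>?q)"
      by (rule bspec[OF *]) measurable
  qed
  also have "\<dots> = (\<integral>\<^sup>+z. ennreal (case_prod (kdens M K) z) * indicator A z \<partial>(M \<Otimes>\<^sub>M ?q))"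
    by (subst q.nn_integral_fst[symmetric]) auto
  also have "\<dots> = emeasure (density (M \<Otimes>\<^sub>M ?q) (\<lambda>z. ennreal (case_prod (kdens M K) z))) A"
    using A' by (subst emeasure_density) auto
  finally show "emeasure (joint M K) A = emeasure (density (M \<Otimes>\<^sub>M ?q) (\<lambda>z. ennreal (case_prod (kdens M K) z))) A" .
qed

lemma measurable_kl_fun [measurable]: "kl_fun \<in> borel_measurable borel"
  unfolding kl_fun_def by measurable

lemma mutual_info_eq_nn_integral_kl:
  assumes M: "prob_meas M" and K: "markov_kernel K" and C: "countable C"
    and AEC: "AE y in outlaw M K. y \<in> C"
  shows "mutual_info M K = (\<integral>\<^sup>+x. \<integral>\<^sup>+y. ennreal (kl_fun (kdens M K x y)) \<partial>outlaw M K \<partial>M)"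
proof -
  let ?q = "outlaw M K"
  interpret q: prob_space ?q by (rule prob_measD[OF prob_meas_outlaw[OF M K]])
  interpret M: prob_space M by (rule prob_measD[OF M])
  interpret pair_prob_space M ?q ..
  have [measurable_cong]: "sets M = sets borel" "sets ?q = sets borel"
    using prob_measD[OF prob_meas_outlaw[OF M K]] prob_measD[OF M] by auto
  note measurable_kdens[OF M K, measurable]
  have "mutual_info M K = (\<integral>\<^sup>+z. ennreal (kl_fun (case_prod (kdens M K) z)) \<partial>(M \<Otimes>\<^sub>M ?q))"
    unfolding mutual_info_def
  proof (rule KL2_density)
    show "sigma_finite_measure (M \<Otimes>\<^sub>M ?q)" ..
  qed (auto simp: kdens_nonneg joint_eq_density[OF M K C AEC])
  also have "\<dots> = (\<integral>\<^sup>+x. \<integral>\<^sup>+y. ennreal (kl_fun (kdens M K x y)) \<partial>?q \<partial>M)"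
    by (subst q.nn_integral_fst[symmetric]) auto
  finally show ?thesis .
qed

section \<open>Mixtures\<close>

lemma emeasure_mix:
  assumes "prob_meas a" "prob_meas b" "A \<in> sets borel"
  shows "emeasure (mix l a b) A = ennreal l * emeasure a A + ennreal (1 - l) * emeasure b A"
proof -
  note a = prob_measD[OF assms(1)] and b = prob_measD[OF assms(2)]
  let ?f = "\<lambda>A. ennreal l * emeasure a A + ennreal (1 - l) * emeasure b A"
  show ?thesis
    unfolding mix_def
  proof (rule emeasure_measure_of_sigma)
    show "sigma_algebra (space borel) (sets borel)" by (rule sets.sigma_algebra_axioms)
    show "positive (sets borel) ?f" by (simp add: positive_def)
    show "countably_additive (sets borel) ?f"
    proof (rule countably_additiveI)
      fix F :: "nat \<Rightarrow> 'a set" assume F: "range F \<subseteq> sets borel" "disjoint_family F"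
      have "(\<Sum>i. ?f (F i)) = ennreal l * (\<Sum>i. emeasure a (F i)) + ennreal (1 - l) * (\<Sum>i. emeasure b (F i))"
        by (subst suminf_add[symmetric]) auto
      then show "(\<Sum>i. ?f (F i)) = ?f (\<Union>i. F i)"
        using F a b by (simp add: suminf_emeasure)
    qed
  qed (use assms in auto)
qed

lemma sets_mix [simp]: "sets (mix l a b) = sets (borel :: 'a::polish_space measure)"
  unfolding mix_def by (rule sets.sets_measure_of_eq)

lemma prob_meas_mix:
  assumes "prob_meas a" "prob_meas b" "0 \<le> l" "l \<le> 1"
  shows "prob_meas (mix l a b)"
proof -
  have "space (mix l a b) = UNIV" using sets_eq_imp_space_eq[OF sets_mix] by auto
  then have "emeasure (mix l a b) (space (mix l a b)) = 1"
    using assms prob_space.emeasure_space_1[OF prob_measD(1)[OF assms(1)]] prob_measD(3)[OF assms(1)]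
      prob_space.emeasure_space_1[OF prob_measD(1)[OF assms(2)]] prob_measD(3)[OF assms(2)]
    by (simp add: emeasure_mix flip: ennreal_plus)
  then show ?thesis by (auto simp: prob_meas_def intro: prob_spaceI)
qed

lemma measure_mix:
  assumes "prob_meas a" "prob_meas b" "0 \<le> l" "l \<le> 1" "A \<in> sets borel"
  shows "measure (mix l a b) A = l * measure a A + (1 - l) * measure b A"
proof -
  interpret a: prob_space a by (rule prob_measD[OF assms(1)])
  interpret b: prob_space b by (rule prob_measD[OF assms(2)])
  show ?thesis
    using assms unfolding measure_def
    by (simp add: emeasure_mix a.emeasure_eq_measure b.emeasure_eq_measure flip: ennreal_mult ennreal_plus)
qed

lemma prob_meas_eqI:
  assumes "prob_meas a" "prob_meas b" "\<And>A. A \<in> sets borel \<Longrightarrow> emeasure a A = emeasure b A"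
  shows "a = b"
  using assms by (intro measure_eqI) (auto simp: prob_meas_def)

lemma nn_integral_mix:
  assumes a: "prob_meas a" and b: "prob_meas b" and h: "h \<in> borel_measurable borel"
  shows "(\<integral>\<^sup>+y. h y \<partial>mix l a b) = ennreal l * (\<integral>\<^sup>+y. h y \<partial>a) + ennreal (1 - l) * (\<integral>\<^sup>+y. h y \<partial>b)"
  using h
proof (induction rule: borel_measurable_induct)
  case (cong f g)
  then show ?case by (simp add: fun_eq_iff)
next
  case (set A)
  then show ?case
    using prob_measD[OF a] prob_measD[OF b] by (simp add: emeasure_mix[OF a b])
next
  case (mult u c)
  have [measurable]: "u \<in> borel_measurable a" "u \<in> borel_measurable b" "u \<in> borel_measurable (mix l a b)"
    using mult prob_measD(2)[OF a] prob_measD(2)[OF b] by (auto cong: measurable_cong_sets)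
  show ?case using mult.IH by (simp add: nn_integral_cmult distrib_left mult.left_commute)
next
  case (add u v)
  have [measurable]: "u \<in> borel_measurable a" "u \<in> borel_measurable b" "u \<in> borel_measurable (mix l a b)"
    "v \<in> borel_measurable a" "v \<in> borel_measurable b" "v \<in> borel_measurable (mix l a b)"
    using add prob_measD(2)[OF a] prob_measD(2)[OF b] by (auto cong: measurable_cong_sets)
  show ?case using add.IH by (simp add: nn_integral_add distrib_left ac_simps)
next
  case (seq U)
  have [measurable]: "U i \<in> borel_measurable a" "U i \<in> borel_measurable b" "U i \<in> borel_measurable (mix l a b)" for i
    using seq prob_measD(2)[OF a] prob_measD(2)[OF b] by (auto cong: measurable_cong_sets)
  have *: "(\<integral>\<^sup>+y. Sup (range U) y \<partial>\<nu>) = (SUP i. \<integral>\<^sup>+y. U i y \<partial>\<nu>)"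
    if "\<And>i. U i \<in> borel_measurable \<nu>" for \<nu> :: "'a measure"
    unfolding SUP_apply using that \<open>incseq U\<close> by (intro nn_integral_monotone_convergence_SUP)
  have inc: "incseq (\<lambda>i. \<integral>\<^sup>+y. U i y \<partial>\<nu>)" for \<nu> :: "'a measure"
    using \<open>incseq U\<close> by (auto simp: incseq_def le_fun_def intro!: nn_integral_mono)
  show ?case
    unfolding *[OF \<open>\<And>i. U i \<in> borel_measurable a\<close>] *[OF \<open>\<And>i. U i \<in> borel_measurable b\<close>] *[OF \<open>\<And>i. U i \<in> borel_measurable (mix l a b)\<close>] seq.IH
      SUP_mult_left_ennreal
    using inc[of a] inc[of b]
    by (intro ennreal_SUP_add) (auto simp: incseq_def mult_left_mono)
qed

definition mix_convex :: "('a::polish_space measure \<Rightarrow> ennreal) \<Rightarrow> bool" where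
  "mix_convex \<phi> \<longleftrightarrow> (\<forall>\<nu>1 \<nu>2 l. prob_meas \<nu>1 \<longrightarrow> prob_meas \<nu>2 \<longrightarrow> 0 \<le> l \<longrightarrow> l \<le> 1 \<longrightarrow>
     \<phi> (mix l \<nu>1 \<nu>2) \<le> ennreal l * \<phi> \<nu>1 + ennreal (1 - l) * \<phi> \<nu>2)"

lemma mix_convexD:
  "mix_convex \<phi> \<Longrightarrow> prob_meas \<nu>1 \<Longrightarrow> prob_meas \<nu>2 \<Longrightarrow> 0 \<le> l \<Longrightarrow> l \<le> 1 \<Longrightarrow>
     \<phi> (mix l \<nu>1 \<nu>2) \<le> ennreal l * \<phi> \<nu>1 + ennreal (1 - l) * \<phi> \<nu>2"
  by (auto simp: mix_convex_def)

lemma ennreal_convex_comb_le: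
  fixes a b c :: ennreal
  assumes "a \<le> c" "b \<le> c" "0 \<le> l" "l \<le> 1"
  shows "ennreal l * a + ennreal (1 - l) * b \<le> c"
proof -
  have "ennreal l * a + ennreal (1 - l) * b \<le> ennreal l * c + ennreal (1 - l) * c"
    using assms by (intro add_mono mult_left_mono) auto
  also have "\<dots> = (ennreal l + ennreal (1 - l)) * c" by (simp add: distrib_right)
  also have "ennreal l + ennreal (1 - l) = 1" using assms by (simp flip: ennreal_plus)
  finally show ?thesis by simp
qed

text \<open>Jensen's inequality for finitely many measures. \<open>mix\<close> is binary, so the
  mixture is produced along with the bound: one measure is split off and the remaining weights are
  divided by \<open>1 - w i\<close>.\<close>

lemma mix_convex_ex_finite_mixture:
  assumes \<phi>: "mix_convex \<phi>" and I: "finite I"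
    and \<nu>: "\<And>i. i \<in> I \<Longrightarrow> prob_meas (\<nu> i)" "\<And>i. i \<in> I \<Longrightarrow> \<phi> (\<nu> i) \<le> c"
    and w: "\<And>i. i \<in> I \<Longrightarrow> 0 \<le> w i" "(\<Sum>i\<in>I. w i) = (1::real)"
  shows "\<exists>\<gamma>. prob_meas \<gamma> \<and> (\<forall>A\<in>sets borel. emeasure \<gamma> A = (\<Sum>i\<in>I. ennreal (w i) * emeasure (\<nu> i) A)) \<and> \<phi> \<gamma> \<le> c"
  using I \<nu> w
proof (induction I arbitrary: w rule: finite_induct)
  case empty
  then show ?case by simp
next
  case (insert i I)
  have wi: "0 \<le> w i" "w i \<le> 1" "sum w I = 1 - w i"
    using insert.prems(3,4) insert.hyps sum_nonneg[of I w] by auto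
  show ?case
  \<comment> \<open>Renormalizing divides by \<open>1 - w i\<close>; when that is 0, all the weight
    sits on \<open>i\<close>, and \<open>\<nu> i\<close> itself is the mixture.\<close>
  proof (cases "w i = 1")
    case True
    then have "\<forall>j\<in>I. w j = 0"
      using wi insert.prems(3) insert.hyps by (subst sum_nonneg_eq_0_iff[symmetric]) auto
    then show ?thesis
      using True insert by (intro exI[of _ "\<nu> i"]) auto
  next
    case False
    define v where "v j = w j / (1 - w i)" for j
    have "sum v I = 1"
      using False wi by (simp add: v_def flip: sum_divide_distrib)
    moreover have "0 \<le> v j" if "j \<in> I" for j
      using that wi insert.prems(3) by (auto simp: v_def)
    ultimately obtain \<gamma> where \<gamma>: "prob_meas \<gamma>" "\<phi> \<gamma> \<le> c"
      "\<And>A. A \<in> sets borel \<Longrightarrow> emeasure \<gamma> A = (\<Sum>i\<in>I. ennreal (v i) * emeasure (\<nu> i) A)"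
      using insert.IH[of v] insert.prems by auto
    have "\<phi> (mix (w i) (\<nu> i) \<gamma>) \<le> ennreal (w i) * \<phi> (\<nu> i) + ennreal (1 - w i) * \<phi> \<gamma>"
      using insert.prems \<gamma> wi by (intro mix_convexD \<phi>) auto
    also have "\<dots> \<le> c"
      using insert.prems \<gamma> wi by (intro ennreal_convex_comb_le) auto
    finally have "\<phi> (mix (w i) (\<nu> i) \<gamma>) \<le> c" .
    moreover have "emeasure (mix (w i) (\<nu> i) \<gamma>) A = (\<Sum>i\<in>insert i I. ennreal (w i) * emeasure (\<nu> i) A)"
      if A: "A \<in> sets borel" for A
    proof -
      have "ennreal (1 - w i) * (ennreal (v j) * z) = ennreal (w j) * z" if "j \<in> I" for j z
        using that wi False insert.prems(3)
        by (simp add: mult.assoc[symmetric] v_def flip: ennreal_mult')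
      then show ?thesis
        using insert.prems \<gamma>(1) A insert.hyps by (simp add: emeasure_mix \<gamma>(3) sum_distrib_left)
    qed
    ultimately show ?thesis
      using insert.prems \<gamma> wi by (intro exI[of _ "mix (w i) (\<nu> i) \<gamma>"]) (auto intro: prob_meas_mix)
  qed
qed

lemma mix_convex_finite_mixture_le:
  assumes \<phi>: "mix_convex \<phi>" and I: "finite I"
    and \<nu>: "\<And>i. i \<in> I \<Longrightarrow> prob_meas (\<nu> i)" "\<And>i. i \<in> I \<Longrightarrow> \<phi> (\<nu> i) \<le> c"
    and w: "\<And>i. i \<in> I \<Longrightarrow> 0 \<le> w i" "(\<Sum>i\<in>I. w i) = (1::real)"
    and \<gamma>: "prob_meas \<gamma>" "\<And>A. A \<in> sets borel \<Longrightarrow> emeasure \<gamma> A = (\<Sum>i\<in>I. ennreal (w i) * emeasure (\<nu> i) A)"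
  shows "\<phi> \<gamma> \<le> c"
proof -
  from mix_convex_ex_finite_mixture[of \<phi> I \<nu> c w] \<phi> I \<nu> w obtain \<gamma>' where "prob_meas \<gamma>'" "\<phi> \<gamma>' \<le> c"
    "\<And>A. A \<in> sets borel \<Longrightarrow> emeasure \<gamma>' A = (\<Sum>i\<in>I. ennreal (w i) * emeasure (\<nu> i) A)"
    by blast
  with \<gamma> have "\<gamma>' = \<gamma>" by (intro prob_meas_eqI) auto
  then show ?thesis using \<open>\<phi> \<gamma>' \<le> c\<close> by simp
qed

section \<open>Convexity of relative entropy and of mutual information under mixing\<close>

lemma kl_fun_tangent:
  assumes "0 < a" "0 \<le> t"
  shows "kl_fun a + log 2 a * (t - a) \<le> kl_fun t"
proof (cases "t = 0")
  case True
  then show ?thesis using assms by (simp add: kl_fun_def log_def field_simps)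
next
  case False
  then have t: "0 < t" using assms by simp
  \<comment> \<open>The derivative of \<open>kl_fun\<close> at \<open>a\<close> is
    \<open>log 2 a\<close>, the linear term in its definition having removed the constant. The
    tangent inequality is then \<open>ln s \<le> s - 1\<close> at \<open>s = a / t\<close>,
    multiplied by \<open>t\<close>.\<close>
  have "ln (a / t) \<le> a / t - 1" using assms t by (intro ln_le_minus_one) auto
  then have "ln a - ln t \<le> a / t - 1" using assms t by (simp add: ln_div)
  then have "t * (ln a - ln t) \<le> t * (a / t - 1)" using t by (intro mult_left_mono) auto
  also have "\<dots> = a - t" using t by (simp add: field_simps)
  finally have "t * ln a - t * ln t \<le> a - t" by (simp add: algebra_simps)
  then have "(a * ln a - (a - 1) + ln a * (t - a)) / ln 2 \<le> (t * ln t - (t - 1)) / ln 2"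
    by (intro divide_right_mono) (auto simp: algebra_simps)
  then show ?thesis using assms t by (simp add: kl_fun_def log_def diff_divide_distrib add_divide_distrib)
qed

lemma kl_fun_nonneg: "0 \<le> t \<Longrightarrow> 0 \<le> kl_fun t"
  using kl_fun_tangent[of 1 t] by (simp add: kl_fun_def)

text \<open>The tangent of \<open>kl_fun\<close> at the common point \<open>k / q\<close> is used
  for both summands; after weighting, the linear terms add up to a multiple of
  \<open>k - (k / q) * q = 0\<close>. This is joint convexity of the perspective function, and the
  conditions \<open>z\<close> express absolute continuity of the two pieces.\<close>

lemma kl_fun_perspective_convex:
  assumes l: "0 \<le> l" "l \<le> 1" and nn: "0 \<le> q1" "0 \<le> q2" "0 \<le> k1" "0 \<le> k2"
    and z: "q1 = 0 \<Longrightarrow> k1 = 0" "q2 = 0 \<Longrightarrow> k2 = 0"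
    and q: "q = l * q1 + (1 - l) * q2" and k: "k = l * k1 + (1 - l) * k2"
  shows "kl_fun (k / q) * q \<le> l * (kl_fun (k1 / q1) * q1) + (1 - l) * (kl_fun (k2 / q2) * q2)"
proof -
  have q0: "0 \<le> q" "0 \<le> k" using assms by auto
  consider "q = 0" | "q > 0" "k = 0" | "q > 0" "k > 0" using q0 by force
  then show ?thesis
  proof cases
    case 1
    then show ?thesis using assms by (simp add: kl_fun_nonneg)
  next
    \<comment> \<open>At 0 the tangent is vertical, so this case is separate: \<open>l * k1\<close>
      and \<open>(1 - l) * k2\<close> both vanish, and what remains is linear in \<open>q1\<close>
      and \<open>q2\<close>.\<close>
    case 2
    then have "l * k1 = 0" "(1 - l) * k2 = 0" using k l nn
      by (metis add_nonneg_eq_0_iff diff_ge_0_iff_ge mult_nonneg_nonneg)+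
    then have "l * (kl_fun (k1 / q1) * q1) = l * (kl_fun 0 * q1)"
      "(1 - l) * (kl_fun (k2 / q2) * q2) = (1 - l) * (kl_fun 0 * q2)" by auto
    moreover have "kl_fun (k / q) * q = l * (kl_fun 0 * q1) + (1 - l) * (kl_fun 0 * q2)"
      unfolding q using 2 by (simp add: algebra_simps)
    ultimately show ?thesis by linarith
  next
    case 3
    have *: "l * (u * q1 + v * (k1 - a * q1)) + (1 - l) * (u * q2 + v * (k2 - a * q2)) = u * q + v * (k - a * q)" for u v a
      unfolding q k by (simp add: algebra_simps)
    let ?a = "k / q"
    have a: "?a > 0" using 3 by simp
    have "kl_fun ?a * q1 + log 2 ?a * (k1 - ?a * q1) = (kl_fun ?a + log 2 ?a * (k1 / q1 - ?a)) * q1"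
      using z(1) by (cases "q1 = 0") (auto simp: algebra_simps)
    also have "\<dots> \<le> kl_fun (k1 / q1) * q1"
      using nn by (intro mult_right_mono kl_fun_tangent a) auto
    finally have 1: "kl_fun ?a * q1 + log 2 ?a * (k1 - ?a * q1) \<le> kl_fun (k1 / q1) * q1" .
    have "kl_fun ?a * q2 + log 2 ?a * (k2 - ?a * q2) = (kl_fun ?a + log 2 ?a * (k2 / q2 - ?a)) * q2"
      using z(2) by (cases "q2 = 0") (auto simp: algebra_simps)
    also have "\<dots> \<le> kl_fun (k2 / q2) * q2"
      using nn by (intro mult_right_mono kl_fun_tangent a) auto
    finally have 2: "kl_fun ?a * q2 + log 2 ?a * (k2 - ?a * q2) \<le> kl_fun (k2 / q2) * q2" .
    have "l * (kl_fun ?a * q1 + log 2 ?a * (k1 - ?a * q1)) + (1 - l) * (kl_fun ?a * q2 + log 2 ?a * (k2 - ?a * q2))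
      = kl_fun ?a * q + log 2 ?a * (k - ?a * q)"
      by (rule *)
    also have "\<dots> = kl_fun ?a * q" using 3 by simp
    finally show ?thesis
      using mult_left_mono[OF 1, of l] mult_left_mono[OF 2, of "1 - l"] l by linarith
  qed
qed

lemma markov_kernel_mix:
  assumes K1: "markov_kernel K1" and K2: "markov_kernel K2" and l: "0 \<le> l" "l \<le> 1"
  shows "markov_kernel (\<lambda>x. mix l (K1 x) (K2 x))"
  unfolding markov_kernel_def
proof (intro measurable_prob_algebraI measurable_subprob_algebra)
  fix x
  have "prob_meas (mix l (K1 x) (K2 x))"
    by (intro prob_meas_mix markov_kernelD K1 K2 l)
  then show "prob_space (mix l (K1 x) (K2 x))" "subprob_space (mix l (K1 x) (K2 x))"
    by (auto simp: prob_meas_def prob_space_imp_subprob_space)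
next
  fix A :: "'a set" assume A: "A \<in> sets borel"
  have [measurable]: "(\<lambda>x. emeasure (K1 x) A) \<in> borel_measurable borel" "(\<lambda>x. emeasure (K2 x) A) \<in> borel_measurable borel"
    using A by (auto intro!: measurable_emeasure_kernel markov_kernelD K1 K2)
  show "(\<lambda>x. emeasure (mix l (K1 x) (K2 x)) A) \<in> borel_measurable borel"
    by (subst emeasure_mix) (auto intro!: markov_kernelD K1 K2 A)
qed simp

lemma outlaw_mix:
  assumes M: "prob_meas M" and K1: "markov_kernel K1" and K2: "markov_kernel K2" and l: "0 \<le> l" "l \<le> 1"
  shows "outlaw M (\<lambda>x. mix l (K1 x) (K2 x)) = mix l (outlaw M K1) (outlaw M K2)"
proof (rule prob_meas_eqI)
  show "prob_meas (outlaw M (\<lambda>x. mix l (K1 x) (K2 x)))"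
    by (intro prob_meas_outlaw M markov_kernel_mix K1 K2 l)
  show "prob_meas (mix l (outlaw M K1) (outlaw M K2))"
    by (intro prob_meas_outlaw M prob_meas_mix K1 K2 l)
  fix A :: "'a set" assume A: "A \<in> sets borel"
  have "(\<lambda>x. emeasure (K1 x) A) \<in> borel_measurable borel" "(\<lambda>x. emeasure (K2 x) A) \<in> borel_measurable borel"
    using A by (auto intro!: measurable_emeasure_kernel markov_kernelD K1 K2)
  then have [measurable]: "(\<lambda>x. emeasure (K1 x) A) \<in> borel_measurable M" "(\<lambda>x. emeasure (K2 x) A) \<in> borel_measurable M"
    using prob_measD(2)[OF M] by (auto cong: measurable_cong_sets)
  show "emeasure (outlaw M (\<lambda>x. mix l (K1 x) (K2 x))) A = emeasure (mix l (outlaw M K1) (outlaw M K2)) A"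
    using A M K1 K2 l
    by (simp add: emeasure_outlaw emeasure_mix markov_kernel_mix prob_meas_outlaw markov_kernelD nn_integral_add nn_integral_cmult)
qed

lemma exp_dist_mix:
  assumes M: "prob_meas M" and K1: "markov_kernel K1" and K2: "markov_kernel K2" and l: "0 \<le> l" "l \<le> 1"
    and [measurable]: "case_prod \<Delta> \<in> borel_measurable (borel \<Otimes>\<^sub>M borel)"
  shows "exp_dist M \<Delta> (\<lambda>x. mix l (K1 x) (K2 x)) = ennreal l * exp_dist M \<Delta> K1 + ennreal (1 - l) * exp_dist M \<Delta> K2"
proof -
  have "(\<lambda>x. \<integral>\<^sup>+ y. ennreal (\<Delta> x y) \<partial>K1 x) \<in> borel_measurable borel" "(\<lambda>x. \<integral>\<^sup>+ y. ennreal (\<Delta> x y) \<partial>K2 x) \<in> borel_measurable borel"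
    by (intro nn_integral_measurable_subprob_algebra2[of _ _ borel] markov_kernelD K1 K2; measurable)+
  then have [measurable]: "(\<lambda>x. \<integral>\<^sup>+ y. ennreal (\<Delta> x y) \<partial>K1 x) \<in> borel_measurable M" "(\<lambda>x. \<integral>\<^sup>+ y. ennreal (\<Delta> x y) \<partial>K2 x) \<in> borel_measurable M"
    using prob_measD(2)[OF M] by (auto cong: measurable_cong_sets)
  have "exp_dist M \<Delta> (\<lambda>x. mix l (K1 x) (K2 x)) =
    (\<integral>\<^sup>+x. (ennreal l * (\<integral>\<^sup>+ y. ennreal (\<Delta> x y) \<partial>K1 x) + ennreal (1 - l) * (\<integral>\<^sup>+ y. ennreal (\<Delta> x y) \<partial>K2 x)) \<partial>M)"
    unfolding exp_dist_def by (intro nn_integral_cong nn_integral_mix markov_kernelD K1 K2) measurable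
  then show ?thesis
    by (simp add: exp_dist_def nn_integral_add nn_integral_cmult)
qed

text \<open>The output law is mixed together with the kernel, so convexity of \<open>kl_fun\<close>
  alone does not suffice. Over each atom \<open>c\<close> the integrand is a perspective in the pair
  of masses that \<open>K x\<close> and the output law give to \<open>c\<close>, and that is jointly
  convex.\<close>

lemma mutual_info_mix_le:
  assumes M: "prob_meas M" and K1: "markov_kernel K1" and K2: "markov_kernel K2" and l: "0 \<le> l" "l \<le> 1"
    and C: "countable C" and AEC: "AE y in outlaw M K1. y \<in> C" "AE y in outlaw M K2. y \<in> C"
  shows "mutual_info M (\<lambda>x. mix l (K1 x) (K2 x)) \<le> ennreal l * mutual_info M K1 + ennreal (1 - l) * mutual_info M K2"
proof -
  let ?K = "\<lambda>x. mix l (K1 x) (K2 x)"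
  have K: "markov_kernel ?K" by (intro markov_kernel_mix K1 K2 l)
  let ?q1 = "outlaw M K1" and ?q2 = "outlaw M K2" and ?q = "outlaw M ?K"
  note p1 = prob_meas_outlaw[OF M K1] and p2 = prob_meas_outlaw[OF M K2] and p = prob_meas_outlaw[OF M K]
  have Cb: "C \<in> sets borel" using C by (rule sets.countable[rotated]) auto
  have AEC0: "AE y in ?q. y \<in> C"
  proof -
    have *: "emeasure \<nu> (- C) = 0" if "AE y in \<nu>. y \<in> C" "prob_meas \<nu>" for \<nu>
      using that(1) Cb prob_measD(2,3)[OF that(2)] by (subst (asm) AE_iff_measurable[of "- C"]) auto
    have "emeasure ?q1 (- C) = 0" "emeasure ?q2 (- C) = 0"
      using *[OF AEC(1) p1] *[OF AEC(2) p2] .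
    then have "emeasure ?q (- C) = 0" using Cb by (simp add: outlaw_mix M K1 K2 l emeasure_mix p1 p2)
    then show ?thesis using Cb prob_measD(2,3)[OF p] by (subst AE_iff_measurable[of "- C"]) auto
  qed
  define J where "J K x = (\<integral>\<^sup>+y. ennreal (kl_fun (kdens M K x y)) \<partial>outlaw M K)" for K x
  have [measurable]: "J K' \<in> borel_measurable M" if K': "markov_kernel K'" for K'
  proof -
    note [measurable] = measurable_kdens[OF M K']
    interpret q: prob_space "outlaw M K'" by (rule prob_measD(1)[OF prob_meas_outlaw[OF M K']])
    have [measurable_cong]: "sets M = sets borel" "sets (outlaw M K') = sets borel"
      using prob_measD[OF prob_meas_outlaw[OF M K']] prob_measD[OF M] by auto
    show ?thesis unfolding J_def by measurable
  qed
  \<comment> \<open>As sums over atoms, the three integrals against three different output laws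
    become comparable term by term.\<close>
  have sum: "J K' x = (\<integral>\<^sup>+c. ennreal (kl_fun (kdens M K' x c) * measure (outlaw M K') {c}) \<partial>count_space C)"
    if K': "markov_kernel K'" and "AE y in outlaw M K'. y \<in> C" for K' x
  proof -
    interpret q: prob_space "outlaw M K'" by (rule prob_measD(1)[OF prob_meas_outlaw[OF M K']])
    have [measurable]: "(\<lambda>y. kdens M K' x y) \<in> borel_measurable borel"
      using measurable_compose[OF measurable_Pair1' measurable_kdens[OF M K'], of x] by simp
    have "J K' x = (\<integral>\<^sup>+c. ennreal (kl_fun (kdens M K' x c)) * emeasure (outlaw M K') {c} \<partial>count_space C)"
      unfolding J_def
      by (intro nn_integral_countable_support C that prob_measD[OF prob_meas_outlaw[OF M K']]) measurable
    then show ?thesis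
      by (simp add: q.emeasure_eq_measure ennreal_mult'' )
  qed
  have null: "AE x in M. \<forall>c\<in>C. measure (outlaw M K') {c} = 0 \<longrightarrow> measure (K' x) {c} = 0"
    if K': "markov_kernel K'" for K'
  proof (subst AE_ball_countable[OF C], intro ballI)
    fix c
    interpret q: prob_space "outlaw M K'" by (rule prob_measD(1)[OF prob_meas_outlaw[OF M K']])
    show "AE x in M. measure (outlaw M K') {c} = 0 \<longrightarrow> measure (K' x) {c} = 0"
    proof (cases "measure (outlaw M K') {c} = 0")
      case True
      then have "AE y in outlaw M K'. y \<in> - {c}"
        using prob_measD[OF prob_meas_outlaw[OF M K']]
        by (subst AE_iff_measurable[of "{c}"]) (auto simp: q.emeasure_eq_measure)
      from AE_kernel_support[OF M K' _ this] have "AE x in M. AE y in K' x. y \<in> - {c}" by simp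
      then show ?thesis
      proof eventually_elim
        fix x assume "AE y in K' x. y \<in> - {c}"
        then have "emeasure (K' x) {c} = 0"
          using prob_measD[OF markov_kernelD(2)[OF K', of x]] by (subst (asm) AE_iff_measurable[of "{c}"]) auto
        then show "measure (outlaw M K') {c} = 0 \<longrightarrow> measure (K' x) {c} = 0" by (simp add: measure_def)
      qed
    qed simp
  qed
  have "AE x in M. J ?K x \<le> ennreal l * J K1 x + ennreal (1 - l) * J K2 x"
    using null[OF K1] null[OF K2]
  proof eventually_elim
    fix x assume n: "\<forall>c\<in>C. measure ?q1 {c} = 0 \<longrightarrow> measure (K1 x) {c} = 0"
      "\<forall>c\<in>C. measure ?q2 {c} = 0 \<longrightarrow> measure (K2 x) {c} = 0"
    let ?t = "\<lambda>K' c. kl_fun (kdens M K' x c) * measure (outlaw M K') {c}"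
    have "J ?K x = (\<integral>\<^sup>+c. ennreal (?t ?K c) \<partial>count_space C)"
      by (intro sum K AEC0)
    also have "\<dots> \<le> (\<integral>\<^sup>+c. (ennreal l * ennreal (?t K1 c) + ennreal (1 - l) * ennreal (?t K2 c)) \<partial>count_space C)"
    proof (intro nn_integral_mono)
      fix c assume "c \<in> space (count_space C)"
      then have "?t ?K c \<le> l * ?t K1 c + (1 - l) * ?t K2 c"
        unfolding kdens_def using n l
        by (intro kl_fun_perspective_convex l)
           (auto simp: outlaw_mix M K1 K2 l measure_mix p1 p2 markov_kernelD)
      then have "ennreal (?t ?K c) \<le> ennreal (l * ?t K1 c + (1 - l) * ?t K2 c)" by (rule ennreal_leI)
      also have "\<dots> = ennreal l * ennreal (?t K1 c) + ennreal (1 - l) * ennreal (?t K2 c)"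
        using l by (subst ennreal_plus) (auto simp: ennreal_mult' kdens_nonneg kl_fun_nonneg)
      finally show "ennreal (?t ?K c) \<le> ennreal l * ennreal (?t K1 c) + ennreal (1 - l) * ennreal (?t K2 c)" .
    qed
    also have "\<dots> = ennreal l * J K1 x + ennreal (1 - l) * J K2 x"
      by (simp add: nn_integral_add nn_integral_cmult sum[OF K1 AEC(1)] sum[OF K2 AEC(2)])
    finally show "J ?K x \<le> ennreal l * J K1 x + ennreal (1 - l) * J K2 x" .
  qed
  then have "(\<integral>\<^sup>+x. J ?K x \<partial>M) \<le> (\<integral>\<^sup>+x. (ennreal l * J K1 x + ennreal (1 - l) * J K2 x) \<partial>M)"
    by (rule nn_integral_mono_AE)
  also have "\<dots> = ennreal l * (\<integral>\<^sup>+x. J K1 x \<partial>M) + ennreal (1 - l) * (\<integral>\<^sup>+x. J K2 x \<partial>M)"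
    using K1 K2 by (simp add: nn_integral_add nn_integral_cmult)
  finally show ?thesis
    unfolding J_def
    by (simp add: mutual_info_eq_nn_integral_kl[OF M K C AEC0] mutual_info_eq_nn_integral_kl[OF M K1 C AEC(1)]
        mutual_info_eq_nn_integral_kl[OF M K2 C AEC(2)])
qed

section \<open>The converse\<close>

text \<open>The conjunct \<open>0 \<le> P\<close> is what \<open>ennreal P\<close> forgets, since it
  sends every negative number to 0.\<close>

lemma enn2ereal_le_ereal_iff: "enn2ereal a \<le> ereal P \<longleftrightarrow> 0 \<le> P \<and> a \<le> ennreal P"
proof (cases "0 \<le> P")
  case True
  then show ?thesis by (metis e2ennreal_ereal e2ennreal_enn2ereal enn2ereal_ennreal less_eq_ennreal.rep_eq)
next
  case False
  then show ?thesis using order_trans[OF enn2ereal_nonneg[of a], of "ereal P"] by auto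
qed

text \<open>Overwriting one coordinate by an independent copy preserves the product law: the
  overwritten coordinate integrates out with mass 1. This is what lets a code be viewed as a channel
  fed with \<open>x\<close> at position \<open>i\<close>.\<close>

lemma nn_integral_PiM_update:
  assumes "prob_space M" "finite I" "i \<in> I" and F: "F \<in> borel_measurable (\<Pi>\<^sub>M i\<in>I. M)"
  shows "(\<integral>\<^sup>+x. \<integral>\<^sup>+w. F (w(i := x)) \<partial>(\<Pi>\<^sub>M i\<in>I. M) \<partial>M) = (\<integral>\<^sup>+w. F w \<partial>(\<Pi>\<^sub>M i\<in>I. M))"
proof -
  interpret M: prob_space M by fact
  interpret product_prob_space "\<lambda>_. M" I ..
  define J where "J = I - {i}"
  have J: "finite J" "i \<notin> J" "I = insert i J" using assms by (auto simp: J_def)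
  note F[unfolded J(3), measurable]
  have [measurable]: "(\<lambda>w. F (w(i := x))) \<in> borel_measurable (\<Pi>\<^sub>M i\<in>J. M)" if "x \<in> space M" for x
    using that by (intro measurable_compose[OF _ F[unfolded J(3)]] measurable_fun_upd[where J = J]) auto
  have [measurable]: "(\<lambda>w. F (w(i := x))) \<in> borel_measurable (\<Pi>\<^sub>M i\<in>insert i J. M)" if "x \<in> space M" for x
    using that by (intro measurable_compose[OF _ F[unfolded J(3)]] measurable_fun_upd[where J = "insert i J"]) auto
  have "(\<integral>\<^sup>+w. F (w(i := x)) \<partial>(\<Pi>\<^sub>M i\<in>insert i J. M)) = (\<integral>\<^sup>+w. F (w(i := x)) \<partial>(\<Pi>\<^sub>M i\<in>J. M))"
    if x: "x \<in> space M" for x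
    using x by (subst product_nn_integral_insert[OF J(1,2)]) (auto simp: M.emeasure_space_1)
  then have "(\<integral>\<^sup>+x. \<integral>\<^sup>+w. F (w(i := x)) \<partial>(\<Pi>\<^sub>M i\<in>insert i J. M) \<partial>M)
      = (\<integral>\<^sup>+x. \<integral>\<^sup>+w. F (w(i := x)) \<partial>(\<Pi>\<^sub>M i\<in>J. M) \<partial>M)"
    by (intro nn_integral_cong) auto
  also have "\<dots> = (\<integral>\<^sup>+w. F w \<partial>(\<Pi>\<^sub>M i\<in>insert i J. M))"
    by (rule product_nn_integral_insert_rev[symmetric]) (use J F[unfolded J(3)] in auto)
  finally show ?thesis by (simp add: J(3))
qed

lemma nn_integral_nat_valued:
  fixes f :: "'b \<Rightarrow> nat"
  assumes [measurable]: "f \<in> N \<rightarrow>\<^sub>M count_space UNIV" "\<And>z. F z \<in> borel_measurable N"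
  shows "(\<integral>\<^sup>+w. F (f w) w \<partial>N) = (\<Sum>z. \<integral>\<^sup>+w. F z w * indicator (f -` {z} \<inter> space N) w \<partial>N)"
proof -
  have "(\<integral>\<^sup>+w. F (f w) w \<partial>N) = (\<integral>\<^sup>+w. (\<Sum>z. F z w * indicator (f -` {z} \<inter> space N) w) \<partial>N)"
  proof (rule nn_integral_cong)
    fix w assume "w \<in> space N"
    then have "(\<lambda>z. F z w * indicator (f -` {z} \<inter> space N) w) = (\<lambda>z. if z = f w then F (f w) w else 0)"
      by (auto simp: fun_eq_iff split: split_indicator)
    then show "F (f w) w = (\<Sum>z. F z w * indicator (f -` {z} \<inter> space N) w)"
      using sums_single[of "f w" "\<lambda>_. F (f w) w"] by (simp add: sums_iff)
  qed
  also have "\<dots> = (\<Sum>z. \<integral>\<^sup>+w. F z w * indicator (f -` {z} \<inter> space N) w \<partial>N)"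
    by (intro nn_integral_suminf) (auto intro!: borel_measurable_times_ennreal borel_measurable_indicator measurable_sets[OF assms(1)] assms)
  finally show ?thesis .
qed

text \<open>Entropy is the mean of minus the logarithm of the probability of the observed value; the
  factor \<open>ln 2\<close> passes from bits to nats. All terms are nonnegative, so infinite
  entropy is covered.\<close>

lemma entropy_disc_eq_nn_integral:
  fixes f :: "'b \<Rightarrow> nat"
  assumes N: "prob_space N" and [measurable]: "f \<in> N \<rightarrow>\<^sub>M count_space UNIV"
  shows "(\<integral>\<^sup>+w. ennreal (- ln (measure N (f -` {f w} \<inter> space N))) \<partial>N) = ennreal (ln 2) * entropy_disc N f"
proof -
  interpret prob_space N by fact
  define p where "p z = measure N (f -` {z} \<inter> space N)" for z
  have p: "0 \<le> p z" "p z \<le> 1" for z by (auto simp: p_def)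
  have lnp: "0 \<le> - ln (p z)" for z using p[of z] by (cases "p z = 0") auto
  have "(\<integral>\<^sup>+w. ennreal (- ln (p (f w))) \<partial>N) = (\<Sum>z. ennreal (- ln (p z)) * emeasure N (f -` {z} \<inter> space N))"
    by (subst nn_integral_nat_valued[where F = "\<lambda>z w. ennreal (- ln (p z))"])
       (auto intro!: suminf_cong nn_integral_cmult_indicator)
  also have "\<dots> = (\<Sum>z. ennreal (ln 2) * ennreal (- (p z * log 2 (p z))))"
  proof (intro suminf_cong)
    fix z
    have e: "- ln (p z) * p z = ln 2 * (- (p z * log 2 (p z)))"
      by (simp add: log_def)
    show "ennreal (- ln (p z)) * emeasure N (f -` {z} \<inter> space N) = ennreal (ln 2) * ennreal (- (p z * log 2 (p z)))"
      using lnp[of z] by (simp only: emeasure_eq_measure ennreal_mult'[symmetric] ln_gt_zero less_imp_le e flip: p_def)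
  qed
  also have "\<dots> = ennreal (ln 2) * entropy_disc N f"
    by (simp add: entropy_disc_def p_def)
  finally show ?thesis by (simp add: p_def)
qed

lemma ennreal_1_div: "0 < n \<Longrightarrow> a / of_nat n = ennreal (1 / real n) * a"
  by (simp add: divide_ennreal_def ennreal_of_nat_eq_real_of_nat inverse_ennreal mult.commute inverse_eq_divide)

text \<open>The channel seen by a symbol placed at a uniformly random position of the block.\<close>

definition code_kernel :: "'a::polish_space measure \<Rightarrow> nat \<Rightarrow> ((nat \<Rightarrow> 'a) \<Rightarrow> nat) \<Rightarrow> (nat \<Rightarrow> nat \<Rightarrow> 'a) \<Rightarrow> 'a \<Rightarrow> 'a measure" where
  "code_kernel M n f g x = distr (measure_pmf (pmf_of_set {..<n}) \<Otimes>\<^sub>M (\<Pi>\<^sub>M i\<in>{..<n}. M)) borel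
     (\<lambda>(t, w). if t < n then g (f (w(t := x))) t else g 0 0)"

locale block_code =
  fixes M :: "'a::polish_space measure" and n :: nat
    and f :: "(nat \<Rightarrow> 'a) \<Rightarrow> nat" and g :: "nat \<Rightarrow> nat \<Rightarrow> 'a"
  assumes M: "prob_meas M" and n: "0 < n"
    and f0: "f \<in> (\<Pi>\<^sub>M i\<in>{..<n}. (borel :: 'a measure)) \<rightarrow>\<^sub>M count_space UNIV"
begin

abbreviation "PM \<equiv> \<Pi>\<^sub>M i\<in>{..<n}. M"
abbreviation "K \<equiv> code_kernel M n f g"
abbreviation "q \<equiv> outlaw M K"
abbreviation "r \<equiv> kdens M K"

sublocale M: prob_space M by (rule prob_measD[OF M])
sublocale PM: product_prob_space "\<lambda>_. M" "{..<n}" ..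

lemma sets_M [measurable_cong]: "sets M = sets borel" by (rule prob_measD[OF M])

lemma f [measurable]: "f \<in> PM \<rightarrow>\<^sub>M count_space UNIV"
  using f0 by (subst measurable_cong_sets[OF sets_PiM_cong[OF refl sets_M] refl])

lemma measurable_to_M: "h \<in> N \<rightarrow>\<^sub>M M \<longleftrightarrow> h \<in> N \<rightarrow>\<^sub>M borel"
  by (subst measurable_cong_sets[OF refl sets_M]) simp

lemma measurable_coord [measurable (raw)]: "t < n \<Longrightarrow> (\<lambda>w. w t) \<in> PM \<rightarrow>\<^sub>M borel"
  by (subst measurable_to_M[symmetric]) (rule measurable_component_singleton, simp)

lemma measurable_out: "t < n \<Longrightarrow> (\<lambda>w. g (f w) t) \<in> PM \<rightarrow>\<^sub>M borel"
  by (rule measurable_compose[OF f]) auto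

text \<open>The position is a discrete coordinate, so measurability may be checked for each fixed
  \<open>t\<close>. The branch \<open>g 0 0\<close> has probability 0 and only keeps the map
  total.\<close>

lemma measurable_code_map:
  "(\<lambda>(x, t, w). if t < n then g (f (w(t := x))) t else g 0 0)
     \<in> borel \<Otimes>\<^sub>M (measure_pmf (pmf_of_set {..<n}) \<Otimes>\<^sub>M PM) \<rightarrow>\<^sub>M borel"
proof -
  let ?N = "(borel :: 'a measure) \<Otimes>\<^sub>M (measure_pmf (pmf_of_set {..<n}) \<Otimes>\<^sub>M PM)"
  have "(\<lambda>z. if t < n then g (f ((snd (snd z))(t := fst z))) t else g 0 0) \<in> ?N \<rightarrow>\<^sub>M borel" for t
  proof (cases "t < n")
    case True
    have "(\<lambda>z. (snd (snd z))(t := fst z)) \<in> ?N \<rightarrow>\<^sub>M PM"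
    proof (rule measurable_fun_upd[where J = "{..<n}"])
      show "{..<n} = {..<n} \<union> {t}" using True by auto
      show "(\<lambda>z. snd (snd z)) \<in> ?N \<rightarrow>\<^sub>M PM"
        by (rule measurable_compose[OF measurable_snd measurable_snd])
      show "fst \<in> ?N \<rightarrow>\<^sub>M M"
        unfolding measurable_to_M by (rule measurable_fst)
    qed
    from measurable_compose[OF this measurable_out[OF True]] show ?thesis using True by (simp only: if_True)
  qed simp
  then have "(\<lambda>z. (\<lambda>t z. if t < n then g (f ((snd (snd z))(t := fst z))) t else g 0 0) (fst (snd z)) z) \<in> ?N \<rightarrow>\<^sub>M borel"
    by (rule measurable_compose_countable) (rule measurable_compose[OF measurable_snd measurable_compose[OF measurable_fst]], simp)
  then show ?thesis by (simp add: case_prod_beta')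
qed

lemma K: "markov_kernel K"
proof -
  interpret pmf: prob_space "measure_pmf (pmf_of_set {..<n})" by (rule measure_pmf.prob_space_axioms)
  interpret P: pair_prob_space "measure_pmf (pmf_of_set {..<n})" PM ..
  have *: "(\<lambda>_. measure_pmf (pmf_of_set {..<n}) \<Otimes>\<^sub>M PM) \<in> (borel :: 'a measure) \<rightarrow>\<^sub>M prob_algebra (measure_pmf (pmf_of_set {..<n}) \<Otimes>\<^sub>M PM)"
    by (intro measurable_const) (auto simp: space_prob_algebra intro: P.prob_space_axioms)
  have "(\<lambda>x. distr (measure_pmf (pmf_of_set {..<n}) \<Otimes>\<^sub>M PM) borel ((\<lambda>x (t, w). if t < n then g (f (w(t := x))) t else g 0 0) x))
    \<in> borel \<rightarrow>\<^sub>M prob_algebra borel"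
    using measurable_code_map by (intro measurable_distr_prob_space2[OF *]) (simp add: case_prod_beta')
  then show ?thesis by (simp add: markov_kernel_def code_kernel_def[abs_def])
qed

lemma q: "prob_meas q" by (rule prob_meas_outlaw[OF M K])

lemma nn_integral_K:
  assumes [measurable]: "h \<in> borel_measurable borel"
  shows "(\<integral>\<^sup>+y. h y \<partial>K x) = ennreal (1 / n) * (\<Sum>t<n. \<integral>\<^sup>+w. h (g (f (w(t := x))) t) \<partial>PM)"
proof -
  have m: "(\<lambda>(t, w). if t < n then g (f (w(t := x))) t else g 0 0) \<in> measure_pmf (pmf_of_set {..<n}) \<Otimes>\<^sub>M PM \<rightarrow>\<^sub>M borel"
    using measurable_compose[OF measurable_Pair1' measurable_code_map, of x] by simp
  have "(\<integral>\<^sup>+y. h y \<partial>K x) = (\<integral>\<^sup>+z. h ((\<lambda>(t, w). if t < n then g (f (w(t := x))) t else g 0 0) z) \<partial>(measure_pmf (pmf_of_set {..<n}) \<Otimes>\<^sub>M PM))"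
    unfolding code_kernel_def using m by (subst nn_integral_distr) auto
  also have "\<dots> = (\<integral>\<^sup>+t. \<integral>\<^sup>+w. h (if t < n then g (f (w(t := x))) t else g 0 0) \<partial>PM \<partial>measure_pmf (pmf_of_set {..<n}))"
    using m by (subst PM.P.nn_integral_fst[symmetric]) auto
  also have "\<dots> = (\<Sum>t<n. \<integral>\<^sup>+w. h (if t < n then g (f (w(t := x))) t else g 0 0) \<partial>PM) / of_nat n"
    using n by (subst nn_integral_pmf_of_set) (auto simp: lessThan_empty_iff)
  finally show ?thesis
    using n by (simp add: ennreal_1_div)
qed

text \<open>The uniform position turns the sum over \<open>t\<close> into \<open>n\<close> times one
  integral, and at each position feeding a fresh \<open>x\<close> to the code leaves the joint law
  of input and output unchanged. Through this identity distortion, output law and information of the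
  block become single-letter quantities.\<close>

lemma sum_nn_integral_code:
  assumes \<phi>[measurable]: "\<phi> \<in> borel_measurable (borel \<Otimes>\<^sub>M borel)"
  shows "(\<Sum>t<n. \<integral>\<^sup>+w. \<phi> (w t, g (f w) t) \<partial>PM) = of_nat n * (\<integral>\<^sup>+x. \<integral>\<^sup>+y. \<phi> (x, y) \<partial>K x \<partial>M)"
proof -
  have m: "(\<lambda>(x, w). \<phi> (x, g (f (w(t := x))) t)) \<in> borel_measurable (M \<Otimes>\<^sub>M PM)" if t: "t < n" for t
  proof -
    have "(\<lambda>z. (snd z)(t := fst z)) \<in> M \<Otimes>\<^sub>M PM \<rightarrow>\<^sub>M PM"
      using t by (intro measurable_fun_upd[where J = "{..<n}"]) auto
    from measurable_compose[OF this measurable_out[OF t]]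
    have [measurable]: "(\<lambda>z. g (f ((snd z)(t := fst z))) t) \<in> M \<Otimes>\<^sub>M PM \<rightarrow>\<^sub>M borel" .
    show ?thesis unfolding case_prod_beta' by measurable
  qed
  have [measurable]: "(\<lambda>x. \<integral>\<^sup>+w. \<phi> (x, g (f (w(t := x))) t) \<partial>PM) \<in> borel_measurable M" if "t < n" for t
    using m[OF that] by (intro PM.P.borel_measurable_nn_integral)
  have "of_nat n * (\<integral>\<^sup>+x. \<integral>\<^sup>+y. \<phi> (x, y) \<partial>K x \<partial>M)
      = of_nat n * (\<integral>\<^sup>+x. ennreal (1 / n) * (\<Sum>t<n. \<integral>\<^sup>+w. \<phi> (x, g (f (w(t := x))) t) \<partial>PM) \<partial>M)"
    by (intro arg_cong2[where f = "(*)"] nn_integral_cong refl nn_integral_K) measurable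
  also have "\<dots> = of_nat n * ennreal (1 / n) * (\<Sum>t<n. \<integral>\<^sup>+x. \<integral>\<^sup>+w. \<phi> (x, g (f (w(t := x))) t) \<partial>PM \<partial>M)"
    by (subst nn_integral_cmult, measurable, subst nn_integral_sum) (auto simp: mult.assoc)
  also have "of_nat n * ennreal (1 / n) = 1"
    using n by (simp add: ennreal_of_nat_eq_real_of_nat flip: ennreal_mult')
  also have "(\<Sum>t<n. \<integral>\<^sup>+x. \<integral>\<^sup>+w. \<phi> (x, g (f (w(t := x))) t) \<partial>PM \<partial>M) = (\<Sum>t<n. \<integral>\<^sup>+w. \<phi> (w t, g (f w) t) \<partial>PM)"
  proof (intro sum.cong refl)
    fix t assume "t \<in> {..<n}"
    then have t: "t < n" by simp
    note measurable_out[OF t, measurable]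
    note measurable_coord[OF t, measurable]
    show "(\<integral>\<^sup>+x. \<integral>\<^sup>+w. \<phi> (x, g (f (w(t := x))) t) \<partial>PM \<partial>M) = (\<integral>\<^sup>+w. \<phi> (w t, g (f w) t) \<partial>PM)"
      using t nn_integral_PiM_update[OF M.prob_space_axioms, of "{..<n}" t "\<lambda>w. \<phi> (w t, g (f w) t)"] by simp
  qed
  finally show ?thesis by simp
qed

text \<open>All letters that the decoder can ever emit. They are countable in number because the
  code alphabet is, and this makes \<open>kdens\<close> a true density for the channel of the
  code.\<close>

definition C :: "'a set" where "C = (\<lambda>(z, t). g z t) ` UNIV"

lemma C: "countable C" "C \<in> sets borel"
proof -
  show "countable C" unfolding C_def by (intro countable_image) auto
  then show "C \<in> sets borel" by (rule sets.countable[rotated]) auto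
qed

lemma AE_q_C: "AE y in q. y \<in> C"
proof -
  have "of_nat n * emeasure q (- C) = of_nat n * (\<integral>\<^sup>+x. \<integral>\<^sup>+y. indicator (- C) (snd (x, y)) \<partial>K x \<partial>M)"
    using nn_integral_outlaw[OF M K, of "indicator (- C)"] C(2) prob_measD(2)[OF q] by simp
  also have "\<dots> = (\<Sum>t<n. \<integral>\<^sup>+w. indicator (- C) (g (f w) t) \<partial>PM)"
    using C(2) by (subst sum_nn_integral_code[symmetric]) auto
  also have "\<dots> = (\<Sum>t<n. \<integral>\<^sup>+w. 0 \<partial>PM)"
    by (intro sum.cong nn_integral_cong refl) (auto simp: C_def image_iff split: split_indicator)
  finally have "emeasure q (- C) = 0" using n by simp
  then show ?thesis
    using C(2) prob_measD[OF q] by (subst AE_iff_measurable[of "- C"]) auto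
qed

lemma r [measurable]: "case_prod r \<in> borel_measurable (borel \<Otimes>\<^sub>M borel)"
  by (rule measurable_kdens[OF M K])

lemma sets_q [measurable_cong]: "sets q = sets borel" by (rule prob_measD[OF q])

sublocale q: prob_space q by (rule prob_measD[OF q])

lemma sum_nn_integral_code_dens:
  assumes \<phi>[measurable]: "\<phi> \<in> borel_measurable (borel \<Otimes>\<^sub>M borel)"
  shows "(\<Sum>t<n. \<integral>\<^sup>+w. \<phi> (w t, g (f w) t) \<partial>PM) = of_nat n * (\<integral>\<^sup>+x. \<integral>\<^sup>+y. ennreal (r x y) * \<phi> (x, y) \<partial>q \<partial>M)"
proof -
  have "(\<integral>\<^sup>+x. \<integral>\<^sup>+y. \<phi> (x, y) \<partial>K x \<partial>M) = (\<integral>\<^sup>+x. \<integral>\<^sup>+y. ennreal (r x y) * \<phi> (x, y) \<partial>q \<partial>M)"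
    using nn_integral_kernel_kdens[OF M K C(1) AE_q_C]
  proof (intro nn_integral_cong_AE, eventually_elim)
    fix x assume *: "\<forall>h\<in>borel_measurable borel. (\<integral>\<^sup>+y. h y \<partial>K x) = (\<integral>\<^sup>+y. ennreal (r x y) * h y \<partial>q)"
    show "(\<integral>\<^sup>+y. \<phi> (x, y) \<partial>K x) = (\<integral>\<^sup>+y. ennreal (r x y) * \<phi> (x, y) \<partial>q)"
      by (rule bspec[OF *]) measurable
  qed
  then show ?thesis by (simp add: sum_nn_integral_code)
qed

text \<open>The numerators \<open>measure (K x) {y}\<close> average over \<open>x\<close> to the
  denominator, so the value is 1 at atoms of \<open>q\<close> and 0 elsewhere. The bound holds for
  every \<open>y\<close>, not just almost every one, hence for the letters of any codeword.\<close>

lemma nn_integral_r_le_1: "(\<integral>\<^sup>+x. ennreal (r x y) \<partial>M) \<le> 1"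
proof -
  have [measurable]: "(\<lambda>x. measure (K x) {y}) \<in> borel_measurable M"
    using measurable_compose[OF measurable_Pair2' measurable_measure_singleton[OF markov_kernelD(1)[OF K]], of y]
    by (subst measurable_cong_sets[OF sets_M refl]) simp
  have k: "emeasure (K x) {y} = ennreal (measure (K x) {y})" for x
  proof -
    interpret k: prob_space "K x" by (rule prob_measD[OF markov_kernelD(2)[OF K]])
    show ?thesis by (rule k.emeasure_eq_measure)
  qed
  have "(\<integral>\<^sup>+x. ennreal (r x y) \<partial>M) = (\<integral>\<^sup>+x. ennreal (1 / measure q {y}) * ennreal (measure (K x) {y}) \<partial>M)"
    by (intro nn_integral_cong) (simp add: kdens_def flip: ennreal_mult')
  also have "\<dots> = ennreal (1 / measure q {y}) * emeasure q {y}"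
    by (simp add: nn_integral_cmult emeasure_outlaw[OF M K] k)
  also have "\<dots> \<le> 1" by (simp add: q.emeasure_eq_measure flip: ennreal_mult')
  finally show ?thesis .
qed

end

lemma prod_le_one_ennreal:
  fixes a :: "'i \<Rightarrow> ennreal"
  assumes "\<And>i. i \<in> I \<Longrightarrow> a i \<le> 1"
  shows "(\<Prod>i\<in>I. a i) \<le> 1"
  using assms
proof (induction I rule: infinite_finite_induct)
  case (insert i I)
  then show ?case using mult_mono[of "a i" 1 "prod a I" 1] by simp
qed auto

context block_code
begin

text \<open>With subtraction allowed, the proof would read
  \<open>0 \<ge> E ln Y = - ln 2 * H(Z) + n * ln 2 * I\<close>. Integrals in \<open>ennreal\<close>
  cannot be subtracted and the entropy may be infinite, so every logarithm is completed to a
  nonnegative term, and the completions cancel only at the end.\<close>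

lemma mutual_info_le_entropy: "of_nat n * mutual_info M K \<le> entropy_disc PM f"
proof -
  define p where "p z = measure PM (f -` {z} \<inter> space PM)" for z
  have p: "0 \<le> p z" "p z \<le> 1" for z by (auto simp: p_def)
  define rt where "rt w t = r (w t) (g (f w) t)" for w t
  have [measurable]: "(\<lambda>w. rt w t) \<in> borel_measurable PM" if t: "t < n" for t
  proof -
    note measurable_out[OF t, measurable]
    note measurable_coord[OF t, measurable]
    show ?thesis unfolding rt_def by measurable
  qed
  have ry[measurable]: "(\<lambda>x. r x y) \<in> borel_measurable M" for y
    by measurable
  define Y where "Y w = p (f w) * (\<Prod>t<n. rt w t)" for w
  \<comment> \<open>For fixed \<open>z\<close> the letters \<open>g z t\<close> are constants, so
    the factors are independent under the product law. The event \<open>f w = z\<close> is dropped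
    by bounding its indicator by 1; its probability survives as the weight
    \<open>p z\<close>.\<close>
  have Y1: "(\<integral>\<^sup>+w. ennreal (Y w) \<partial>PM) \<le> 1"
  proof -
    let ?F = "\<lambda>z w. ennreal (p z) * (\<Prod>t<n. ennreal (r (w t) (g z t)))"
    have wt[measurable]: "(\<lambda>w. r (w t) y) \<in> borel_measurable PM" if "t < n" for t y
      using that by (intro measurable_compose[OF measurable_component_singleton[of t "{..<n}" "\<lambda>_. M"] ry]) auto
    have "(\<integral>\<^sup>+w. ennreal (Y w) \<partial>PM) = (\<integral>\<^sup>+w. ?F (f w) w \<partial>PM)"
      by (simp add: Y_def rt_def ennreal_mult p prod_nonneg kdens_nonneg prod_ennreal)
    also have "\<dots> = (\<Sum>z. \<integral>\<^sup>+w. ?F z w * indicator (f -` {z} \<inter> space PM) w \<partial>PM)"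
      by (rule nn_integral_nat_valued) measurable
    also have "\<dots> \<le> (\<Sum>z. \<integral>\<^sup>+w. ?F z w \<partial>PM)"
      by (intro suminf_le nn_integral_mono) (auto split: split_indicator)
    also have "\<dots> \<le> (\<Sum>z. emeasure PM (f -` {z} \<inter> space PM))"
    proof (intro suminf_le)
      fix z
      have "(\<integral>\<^sup>+w. ?F z w \<partial>PM) = ennreal (p z) * (\<Prod>t<n. \<integral>\<^sup>+x. ennreal (r x (g z t)) \<partial>M)"
        by (subst nn_integral_cmult, measurable,
            subst PM.product_nn_integral_prod[where f = "\<lambda>t x. ennreal (r x (g z t))"]) auto
      also have "\<dots> \<le> ennreal (p z) * 1"
        by (intro mult_left_mono prod_le_one_ennreal) (auto simp: nn_integral_r_le_1)
      finally show "(\<integral>\<^sup>+w. ?F z w \<partial>PM) \<le> emeasure PM (f -` {z} \<inter> space PM)"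
        by (simp add: p_def PM.P.emeasure_eq_measure)
    qed auto
    also have "\<dots> = (\<integral>\<^sup>+w. 1 \<partial>PM)"
      by (subst nn_integral_nat_valued[where F = "\<lambda>_ _. 1" and f = f]) auto
    finally show ?thesis by (simp add: PM.P.emeasure_space_1)
  qed
  \<comment> \<open>This step and the next show that all factors of \<open>Y\<close> are positive
    almost surely, so that its logarithm splits into a sum.\<close>
  have AEp: "AE w in PM. 0 < p (f w)"
  proof -
    have "(\<integral>\<^sup>+w. (if p (f w) = 0 then 1 else 0) \<partial>PM) = (\<Sum>z. (if p z = 0 then 1 else 0) * emeasure PM (f -` {z} \<inter> space PM))"
      by (subst nn_integral_nat_valued[where F = "\<lambda>z w. (if p z = 0 then 1 else 0)" and f = f])
         (auto intro!: suminf_cong)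
    also have "\<dots> = (\<Sum>z. 0)"
      by (intro suminf_cong) (auto simp: p_def PM.P.emeasure_eq_measure)
    also have "\<dots> = 0" by simp
    finally have "AE w in PM. (if p (f w) = 0 then 1 else 0) = (0::ennreal)"
      by (subst (asm) nn_integral_0_iff_AE) auto
    then show ?thesis by eventually_elim (use p in \<open>auto simp: less_le split: if_splits\<close>)
  qed
  have AEr: "AE w in PM. \<forall>t<n. 0 < rt w t"
  proof -
    have "(\<Sum>t<n. \<integral>\<^sup>+w. (if rt w t = 0 then 1 else 0) \<partial>PM)
      = of_nat n * (\<integral>\<^sup>+x. \<integral>\<^sup>+y. ennreal (r x y) * (if r x y = 0 then 1 else 0) \<partial>q \<partial>M)"
      using sum_nn_integral_code_dens[of "\<lambda>(x, y). if r x y = 0 then 1 else 0"] by (simp add: rt_def)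
    also have "\<dots> = of_nat n * (\<integral>\<^sup>+x. \<integral>\<^sup>+y. 0 \<partial>q \<partial>M)"
      by (intro arg_cong2[where f = "(*)"] nn_integral_cong refl) auto
    finally have "\<forall>t<n. (\<integral>\<^sup>+w. (if rt w t = 0 then 1 else 0) \<partial>PM) = 0"
      by auto
    then have *: "AE w in PM. (if rt w t = 0 then 1 else 0) = (0::ennreal)" if "t < n" for t
      using that by (subst nn_integral_0_iff_AE[symmetric]) auto
    have "AE w in PM. 0 < rt w t" if "t < n" for t
      by (rule eventually_mono[OF *[OF that]]) (auto simp: rt_def less_le kdens_nonneg split: if_splits)
    then have "AE w in PM. \<forall>t\<in>{..<n}. 0 < rt w t"
      by (subst AE_ball_countable) auto
    then show ?thesis by (rule eventually_mono) auto
  qed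
  \<comment> \<open>\<open>ln s - 1 + 1 / s\<close> is \<open>ln s\<close> made nonnegative. The
    correction is harmless: under the joint law of input and output, the mean of
    \<open>1 / r\<close> is the mass of the set where the density is positive, at most 1.\<close>
  define v where "v s = (if s = 0 then 0 else ln s - 1 + 1 / s)" for s :: real
  have [measurable]: "v \<in> borel_measurable borel" unfolding v_def by measurable
  have v0: "0 \<le> v s" if "0 \<le> s" for s
    using that ln_le_minus_one[of "1 / s"] by (auto simp: v_def ln_div)
  have vrt: "0 \<le> v (rt w t)" for w t by (simp add: v0 rt_def kdens_nonneg)
  have rt0: "0 \<le> rt w t" for w t by (simp add: rt_def kdens_nonneg)
  \<comment> \<open>This is \<open>ln Y \<le> Y - 1\<close> with every negative quantity moved to
    the other side.\<close>
  have "AE w in PM. (\<Sum>t<n. ennreal (v (rt w t))) + of_nat (n + 1)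
      \<le> ennreal (Y w) + ennreal (- ln (p (f w))) + (\<Sum>t<n. ennreal (1 / rt w t))"
    using AEp AEr
  proof eventually_elim
    fix w assume a: "0 < p (f w)" and b: "\<forall>t<n. 0 < rt w t"
    have "ln (Y w) = ln (p (f w)) + (\<Sum>t<n. ln (rt w t))"
      unfolding Y_def using a b by (subst ln_mult) (auto intro!: prod_pos ln_prod simp: less_le)
    moreover have "0 < Y w" unfolding Y_def using a b by (auto intro!: mult_pos_pos prod_pos)
    moreover have "ln (Y w) \<le> Y w - 1" using \<open>0 < Y w\<close> by (rule ln_le_minus_one)
    moreover have "(\<Sum>t<n. v (rt w t)) = (\<Sum>t<n. ln (rt w t)) - n + (\<Sum>t<n. 1 / rt w t)"
    proof -
      have "(\<Sum>t<n. v (rt w t)) = (\<Sum>t<n. ln (rt w t) - 1 + 1 / rt w t)"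
        using b by (intro sum.cong) (auto simp: v_def)
      then show ?thesis by (simp add: sum.distrib sum_subtractf)
    qed
    ultimately have "(\<Sum>t<n. v (rt w t)) + real (n + 1) \<le> Y w + (- ln (p (f w))) + (\<Sum>t<n. 1 / rt w t)"
      by simp
    then have "ennreal ((\<Sum>t<n. v (rt w t)) + real (n + 1)) \<le> ennreal (Y w + (- ln (p (f w))) + (\<Sum>t<n. 1 / rt w t))"
      by (rule ennreal_leI)
    moreover have "ennreal ((\<Sum>t<n. v (rt w t)) + real (n + 1)) = (\<Sum>t<n. ennreal (v (rt w t))) + of_nat (n + 1)"
      by (subst ennreal_plus) (auto simp: vrt intro!: sum_nonneg simp: sum_ennreal ennreal_of_nat_eq_real_of_nat)
    moreover have "0 \<le> - ln (p (f w))" using p[of "f w"] a by simp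
    moreover have "0 \<le> (\<Sum>t<n. 1 / rt w t)" by (auto intro!: sum_nonneg simp: rt0)
    moreover have "ennreal (\<Sum>t<n. 1 / rt w t) = (\<Sum>t<n. ennreal (1 / rt w t))"
      by (subst sum_ennreal) (auto simp: rt0)
    ultimately show "(\<Sum>t<n. ennreal (v (rt w t))) + of_nat (n + 1)
      \<le> ennreal (Y w) + ennreal (- ln (p (f w))) + (\<Sum>t<n. ennreal (1 / rt w t))"
      using \<open>0 < Y w\<close> by (simp only: ennreal_plus less_imp_le add_nonneg_nonneg)
  qed
  note main = nn_integral_mono_AE[OF this]
  have ns: "(\<integral>\<^sup>+w. (\<Sum>t<n. ennreal (h (rt w t))) \<partial>PM) = (\<Sum>t<n. \<integral>\<^sup>+w. ennreal (h (rt w t)) \<partial>PM)"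
    if [measurable]: "h \<in> borel_measurable borel" for h :: "real \<Rightarrow> real"
    by (subst nn_integral_sum) auto
  have [measurable]: "Y \<in> borel_measurable PM" unfolding Y_def by measurable
  have "(\<Sum>t<n. \<integral>\<^sup>+w. ennreal (v (rt w t)) \<partial>PM) + of_nat (n + 1)
      = (\<integral>\<^sup>+w. (\<Sum>t<n. ennreal (v (rt w t))) + of_nat (n + 1) \<partial>PM)"
    by (subst nn_integral_add) (auto simp: ns PM.P.emeasure_space_1)
  also note main
  also have "(\<integral>\<^sup>+w. ennreal (Y w) + ennreal (- ln (p (f w))) + (\<Sum>t<n. ennreal (1 / rt w t)) \<partial>PM)
      = (\<integral>\<^sup>+w. ennreal (Y w) \<partial>PM) + (\<integral>\<^sup>+w. ennreal (- ln (p (f w))) \<partial>PM) + (\<Sum>t<n. \<integral>\<^sup>+w. ennreal (1 / rt w t) \<partial>PM)"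
    using ns[of "\<lambda>s. 1 / s"] by (subst nn_integral_add, measurable, subst nn_integral_add) auto
  also have "\<dots> \<le> 1 + ennreal (ln 2) * entropy_disc PM f + (\<Sum>t<n. \<integral>\<^sup>+w. ennreal (1 / rt w t) \<partial>PM)"
    by (intro add_mono Y1 order_refl) (simp add: p_def entropy_disc_eq_nn_integral[OF PM.P.prob_space_axioms f])
  finally have 1: "(\<Sum>t<n. \<integral>\<^sup>+w. ennreal (v (rt w t)) \<partial>PM) + of_nat (n + 1)
      \<le> 1 + ennreal (ln 2) * entropy_disc PM f + (\<Sum>t<n. \<integral>\<^sup>+w. ennreal (1 / rt w t) \<partial>PM)" .
  \<comment> \<open>The mass, under the product of source and output law, of the set where the
    density vanishes. There \<open>kl_fun 0 = 1 / ln 2\<close> contributes to the information while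
    \<open>r * v r\<close> does not, and the same mass is missing from the mean of
    \<open>1 / r\<close>; adding \<open>n * m0\<close> to both sides repairs both.\<close>
  define m0 where "m0 = (\<integral>\<^sup>+x. \<integral>\<^sup>+y. (if r x y = 0 then 1 else 0) \<partial>q \<partial>M)"
  have "(\<Sum>t<n. \<integral>\<^sup>+w. ennreal (v (rt w t)) \<partial>PM) = of_nat n * (\<integral>\<^sup>+x. \<integral>\<^sup>+y. ennreal (r x y) * ennreal (v (r x y)) \<partial>q \<partial>M)"
    using sum_nn_integral_code_dens[of "\<lambda>(x, y). ennreal (v (r x y))"] by (simp add: rt_def)
  moreover have "(\<Sum>t<n. \<integral>\<^sup>+w. ennreal (1 / rt w t) \<partial>PM) = of_nat n * (\<integral>\<^sup>+x. \<integral>\<^sup>+y. ennreal (r x y) * ennreal (1 / r x y) \<partial>q \<partial>M)"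
    using sum_nn_integral_code_dens[of "\<lambda>(x, y). ennreal (1 / r x y)"] by (simp add: rt_def)
  moreover have "(\<integral>\<^sup>+x. \<integral>\<^sup>+y. ennreal (r x y) * ennreal (v (r x y)) \<partial>q \<partial>M) + m0 = ennreal (ln 2) * mutual_info M K"
  proof -
    have "(\<integral>\<^sup>+x. \<integral>\<^sup>+y. ennreal (r x y) * ennreal (v (r x y)) \<partial>q \<partial>M) + m0
      = (\<integral>\<^sup>+x. \<integral>\<^sup>+y. (ennreal (r x y) * ennreal (v (r x y)) + (if r x y = 0 then 1 else 0)) \<partial>q \<partial>M)"
      unfolding m0_def by (simp add: nn_integral_add)
    also have "\<dots> = (\<integral>\<^sup>+x. \<integral>\<^sup>+y. ennreal (ln 2) * ennreal (kl_fun (r x y)) \<partial>q \<partial>M)"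
    proof (intro nn_integral_cong)
      fix x y
      have k: "s * v s + (if s = 0 then 1 else 0) = ln 2 * kl_fun s" for s
        by (auto simp: v_def kl_fun_def log_def field_simps)
      have "0 \<le> r x y" by (rule kdens_nonneg)
      then show "ennreal (r x y) * ennreal (v (r x y)) + (if r x y = 0 then 1 else 0) = ennreal (ln 2) * ennreal (kl_fun (r x y))"
        using k[of "r x y"] by (cases "r x y = 0") (auto simp flip: ennreal_mult')
    qed
    also have "\<dots> = ennreal (ln 2) * mutual_info M K"
      by (simp add: nn_integral_cmult mutual_info_eq_nn_integral_kl[OF M K C(1) AE_q_C])
    finally show ?thesis .
  qed
  moreover have "(\<integral>\<^sup>+x. \<integral>\<^sup>+y. ennreal (r x y) * ennreal (1 / r x y) \<partial>q \<partial>M) + m0 = 1"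
  proof -
    have "(\<integral>\<^sup>+x. \<integral>\<^sup>+y. ennreal (r x y) * ennreal (1 / r x y) \<partial>q \<partial>M) + m0
      = (\<integral>\<^sup>+x. \<integral>\<^sup>+y. (ennreal (r x y) * ennreal (1 / r x y) + (if r x y = 0 then 1 else 0)) \<partial>q \<partial>M)"
      unfolding m0_def by (simp add: nn_integral_add)
    also have "\<dots> = (\<integral>\<^sup>+x. \<integral>\<^sup>+y. 1 \<partial>q \<partial>M)"
      by (intro nn_integral_cong) (auto simp: kdens_nonneg simp flip: ennreal_mult')
    finally show ?thesis by (simp add: M.emeasure_space_1 q.emeasure_space_1)
  qed
  ultimately have "ennreal (ln 2) * (of_nat n * mutual_info M K) + of_nat (n + 1)
      \<le> ennreal (ln 2) * entropy_disc PM f + of_nat (n + 1)"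
  proof -
    let ?A = "\<integral>\<^sup>+x. \<integral>\<^sup>+y. ennreal (r x y) * ennreal (v (r x y)) \<partial>q \<partial>M"
    let ?B = "\<integral>\<^sup>+x. \<integral>\<^sup>+y. ennreal (r x y) * ennreal (1 / r x y) \<partial>q \<partial>M"
    assume a: "(\<Sum>t<n. \<integral>\<^sup>+w. ennreal (v (rt w t)) \<partial>PM) = of_nat n * (\<integral>\<^sup>+x. \<integral>\<^sup>+y. ennreal (r x y) * ennreal (v (r x y)) \<partial>q \<partial>M)"
      and b: "(\<Sum>t<n. \<integral>\<^sup>+w. ennreal (1 / rt w t) \<partial>PM) = of_nat n * (\<integral>\<^sup>+x. \<integral>\<^sup>+y. ennreal (r x y) * ennreal (1 / r x y) \<partial>q \<partial>M)"
      and c: "?A + m0 = ennreal (ln 2) * mutual_info M K" and e: "?B + m0 = 1"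
    have "ennreal (ln 2) * (of_nat n * mutual_info M K) + of_nat (n + 1) = of_nat n * ?A + of_nat (n + 1) + of_nat n * m0"
      by (simp add: mult.left_commute[of "ennreal (ln 2)"] distrib_left ac_simps flip: c)
    also have "\<dots> \<le> (1 + ennreal (ln 2) * entropy_disc PM f + of_nat n * ?B) + of_nat n * m0"
      using 1 unfolding a b by (rule add_right_mono)
    also have "\<dots> = 1 + ennreal (ln 2) * entropy_disc PM f + of_nat n * (?B + m0)"
      by (simp add: distrib_left ac_simps)
    also have "\<dots> = ennreal (ln 2) * entropy_disc PM f + of_nat (n + 1)"
      unfolding e by (simp add: ac_simps)
    finally show ?thesis .
  qed
  then have "ennreal (ln 2) * (of_nat n * mutual_info M K) \<le> ennreal (ln 2) * entropy_disc PM f"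
    by (subst (asm) (1 2) add.commute, subst (asm) ennreal_add_left_cancel_le) auto
  then show ?thesis
    by (subst (asm) ennreal_mult_le_mult_iff) auto
qed

end

text \<open>The channel \<open>code_kernel\<close> of one code of one positive length is a
  competitor in the infimum: its information, distortion and divergence inherit the bounds of the
  code.\<close>

lemma RDP_le_of_nr_code:
  assumes M: "prob_meas M" and [measurable]: "case_prod \<Delta> \<in> borel_measurable (borel \<Otimes>\<^sub>M borel)"
    and d: "mix_convex (d M)" and n: "0 < n" and code: "nr_code M \<Delta> d D P R n"
  shows "RDP M \<Delta> d D P \<le> ereal R"
proof -
  from code obtain f g where f: "f \<in> (\<Pi>\<^sub>M i\<in>{..<n}. (borel :: 'a measure)) \<rightarrow>\<^sub>M count_space UNIV"
    and H: "enn2ereal (entropy_disc (\<Pi>\<^sub>M i\<in>{..<n}. M) f) \<le> ereal (real n * R)"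
    and Di: "enn2ereal (\<Sum>t<n. \<integral>\<^sup>+ x. ennreal (\<Delta> (x t) (g (f x) t)) \<partial>(\<Pi>\<^sub>M i\<in>{..<n}. M)) \<le> ereal (real n * D)"
    and Pe: "\<And>t. t < n \<Longrightarrow> enn2ereal (d M (distr (\<Pi>\<^sub>M i\<in>{..<n}. M) borel (\<lambda>x. g (f x) t))) \<le> ereal P"
    unfolding nr_code_def by blast
  interpret block_code M n f g by standard fact+
  have n': "(of_nat n :: ennreal) = ennreal (real n)" by (simp add: ennreal_of_nat_eq_real_of_nat)
  have cancel: "0 \<le> B \<and> a \<le> ennreal B" if "of_nat n * a \<le> ennreal (real n * B)" "0 \<le> real n * B" for a B
  proof -
    have B: "0 \<le> B" using that(2) n by (simp add: zero_le_mult_iff)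
    have "ennreal (real n) * a \<le> ennreal (real n) * ennreal B"
      using that B by (simp add: n' ennreal_mult)
    then show ?thesis using n B by (subst (asm) ennreal_mult_le_mult_iff) auto
  qed
  have "enn2ereal (mutual_info M K) \<le> ereal R"
    using H mutual_info_le_entropy cancel[of "mutual_info M K" R] by (auto simp: enn2ereal_le_ereal_iff)
  moreover have "enn2ereal (exp_dist M \<Delta> K) \<le> ereal D"
    using Di sum_nn_integral_code[of "\<lambda>(x, y). ennreal (\<Delta> x y)"] cancel[of "exp_dist M \<Delta> K" D]
    by (auto simp: enn2ereal_le_ereal_iff exp_dist_def)
  \<comment> \<open>The output law of the channel is the uniform mixture of the \<open>n\<close>
    output marginals, each of which satisfies the perception constraint; convexity passes the bound
    to the mixture.\<close>
  moreover have "d M q \<le> ennreal P"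
  proof (rule mix_convex_finite_mixture_le[OF d, of "{..<n}" "\<lambda>t. distr PM borel (\<lambda>x. g (f x) t)" _ "\<lambda>_. 1 / n"])
    fix A :: "'a set" assume A: "A \<in> sets borel"
    have "of_nat n * emeasure q A = of_nat n * (\<integral>\<^sup>+x. \<integral>\<^sup>+y. indicator A (snd (x, y)) \<partial>K x \<partial>M)"
      using nn_integral_outlaw[OF M K, of "indicator A"] A prob_measD(2)[OF q] by simp
    also have "\<dots> = (\<Sum>t<n. \<integral>\<^sup>+w. indicator A (g (f w) t) \<partial>PM)"
      using A by (subst sum_nn_integral_code[symmetric]) auto
    also have "\<dots> = (\<Sum>t<n. emeasure (distr PM borel (\<lambda>x. g (f x) t)) A)"
      using A measurable_out
      by (intro sum.cong refl) (simp flip: nn_integral_indicator add: nn_integral_distr)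
    finally have "of_nat n * emeasure q A = (\<Sum>t<n. emeasure (distr PM borel (\<lambda>x. g (f x) t)) A)" .
    then have "ennreal (1 / n) * (of_nat n * emeasure q A) = (\<Sum>t<n. ennreal (1 / n) * emeasure (distr PM borel (\<lambda>x. g (f x) t)) A)"
      by (simp add: sum_distrib_left)
    then show "emeasure q A = (\<Sum>i<n. ennreal (1 / real n) * emeasure (distr PM borel (\<lambda>x. g (f x) i)) A)"
      using n by (simp add: n' mult.assoc[symmetric] flip: ennreal_mult')
  qed (use n q Pe measurable_out in \<open>auto simp: enn2ereal_le_ereal_iff prob_meas_def intro: PM.P.prob_space_distr\<close>)
  moreover have "0 \<le> P" using Pe[OF n] by (simp add: enn2ereal_le_ereal_iff)
  ultimately show ?thesis
    unfolding RDP_def using K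
    by (intro Inf_lower2[of "enn2ereal (mutual_info M K)"]) (auto simp: enn2ereal_le_ereal_iff)
qed

section \<open>Derandomization and first hits\<close>

text \<open>If every value exceeded the mean, the mean would be finite and strictly larger than
  itself.\<close>

lemma (in prob_space) ex_le_nn_integral:
  assumes [measurable]: "F \<in> borel_measurable M"
  shows "\<exists>w\<in>space M. F w \<le> (\<integral>\<^sup>+w. F w \<partial>M)"
proof (rule ccontr)
  let ?c = "\<integral>\<^sup>+w. F w \<partial>M"
  assume "\<not> ?thesis"
  then have less: "?c < F w" if "w \<in> space M" for w using that by (auto simp: not_le)
  obtain w where "w \<in> space M" using not_empty by auto
  then have "?c \<noteq> \<infinity>" using order.strict_trans2[OF less[of w] top_greatest] by auto
  have "\<not> (AE w in M. F w \<le> ?c)"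
  proof
    assume "AE w in M. F w \<le> ?c"
    then have "AE w in M. False" by (rule AE_mp) (auto intro!: AE_I2 dest: less)
    then show False by simp
  qed
  then have "(\<integral>\<^sup>+w. ?c \<partial>M) < (\<integral>\<^sup>+w. F w \<partial>M)"
    using \<open>?c \<noteq> \<infinity>\<close> less by (intro nn_integral_less) (auto simp: emeasure_space_1 intro!: AE_I2 less_imp_le)
  then show False by (simp add: emeasure_space_1)
qed

text \<open>Centering kills the cross term, and a variable with values in \<open>[0, v]\<close>
  deviates from its mean by at most \<open>v\<close>. The shift \<open>a\<close> will be the
  deviation accumulated by the choices already fixed.\<close>

lemma (in prob_space) nn_integral_shifted_square_le:
  assumes [measurable]: "G \<in> borel_measurable M" and G: "\<And>w. 0 \<le> G w" "\<And>w. G w \<le> v"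
  shows "(\<integral>\<^sup>+w. ennreal ((a + (G w - expectation G))\<^sup>2) \<partial>M) \<le> ennreal (a\<^sup>2 + v\<^sup>2)"
proof -
  have iG: "integrable M G"
    by (rule integrable_const_bound[of _ v]) (use G in auto)
  have m: "0 \<le> expectation G" "expectation G \<le> v"
    using G integral_mono[OF iG, of "\<lambda>_. v"] by (auto simp: prob_space)
  have b: "\<bar>G w - expectation G\<bar> \<le> v" for w using G(1)[of w] G(2)[of w] m by auto
  have b2: "(G w - expectation G)\<^sup>2 \<le> v\<^sup>2" for w
    using b[of w] power_mono[of "\<bar>G w - expectation G\<bar>" v 2] by simp
  have i2: "integrable M (\<lambda>w. (G w - expectation G)\<^sup>2)"
    by (rule integrable_const_bound[of _ "v\<^sup>2"]) (use b2 in auto)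
  have e: "(a + (G w - expectation G))\<^sup>2 = a\<^sup>2 + 2 * a * (G w - expectation G) + (G w - expectation G)\<^sup>2" for w
    by (simp add: power2_eq_square algebra_simps)
  have i: "integrable M (\<lambda>w. (a + (G w - expectation G))\<^sup>2)"
    unfolding e using iG i2 by auto
  have "expectation (\<lambda>w. (a + (G w - expectation G))\<^sup>2) = a\<^sup>2 + expectation (\<lambda>w. (G w - expectation G)\<^sup>2)"
    unfolding e using iG i2 by (simp add: prob_space)
  also have "\<dots> \<le> a\<^sup>2 + v\<^sup>2"
    using integral_mono[OF i2, of "\<lambda>_. v\<^sup>2"] b2 by (simp add: prob_space)
  finally show ?thesis
    using i by (subst nn_integral_eq_integral) (auto intro: ennreal_leI simp del: ennreal_plus)
qed

text \<open>Conditional expectations: the choices are fixed one index at a time, so that the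
  deviations behave as if they were independent.\<close>

lemma (in prob_space) ex_choice_small_deviation:
  fixes G :: "'i \<Rightarrow> 'b \<Rightarrow> 'a \<Rightarrow> real" and F :: "'b \<Rightarrow> 'a \<Rightarrow> ennreal" and v :: "'b \<Rightarrow> real"
  assumes B: "finite B" and I: "finite I"
    and Gm: "\<And>i b. i \<in> I \<Longrightarrow> b \<in> B \<Longrightarrow> G i b \<in> borel_measurable M"
    and G0: "\<And>i b w. i \<in> I \<Longrightarrow> b \<in> B \<Longrightarrow> 0 \<le> G i b w" and G1: "\<And>i b w. i \<in> I \<Longrightarrow> b \<in> B \<Longrightarrow> G i b w \<le> v b"
    and Fm: "\<And>b. b \<in> B \<Longrightarrow> F b \<in> borel_measurable M"
  shows "\<exists>\<psi>. (\<forall>b\<in>B. \<psi> b \<in> space M) \<and>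
    ennreal (\<Sum>i\<in>I. (\<Sum>b\<in>B. G i b (\<psi> b) - expectation (G i b))\<^sup>2) + (\<Sum>b\<in>B. F b (\<psi> b))
      \<le> ennreal (card I * (\<Sum>b\<in>B. (v b)\<^sup>2)) + (\<Sum>b\<in>B. \<integral>\<^sup>+w. F b w \<partial>M)"
  using B Gm G0 G1 Fm
proof (induction B rule: finite_induct)
  case empty
  then show ?case by simp
next
  case (insert b B)
  have "\<exists>\<psi>. (\<forall>b\<in>B. \<psi> b \<in> space M) \<and>
    ennreal (\<Sum>i\<in>I. (\<Sum>b\<in>B. G i b (\<psi> b) - expectation (G i b))\<^sup>2) + (\<Sum>b\<in>B. F b (\<psi> b))
      \<le> ennreal (card I * (\<Sum>b\<in>B. (v b)\<^sup>2)) + (\<Sum>b\<in>B. \<integral>\<^sup>+w. F b w \<partial>M)"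
    using insert.prems by (intro insert.IH) auto
  then obtain \<psi> where \<psi>: "\<forall>b\<in>B. \<psi> b \<in> space M" and
    le: "ennreal (\<Sum>i\<in>I. (\<Sum>b\<in>B. G i b (\<psi> b) - expectation (G i b))\<^sup>2) + (\<Sum>b\<in>B. F b (\<psi> b))
      \<le> ennreal (card I * (\<Sum>b\<in>B. (v b)\<^sup>2)) + (\<Sum>b\<in>B. \<integral>\<^sup>+w. F b w \<partial>M)" by blast
  define A where "A i = (\<Sum>b\<in>B. G i b (\<psi> b) - expectation (G i b))" for i
  note [measurable] = insert.prems(1)[OF _ insertI1] insert.prems(4)[OF insertI1]
  have [measurable]: "(\<lambda>w. \<Sum>i\<in>I. ennreal ((A i + (G i b w - expectation (G i b)))\<^sup>2)) \<in> borel_measurable M"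
    using insert.prems(1)[OF _ insertI1] by measurable
  \<comment> \<open>One choice has to control all indices \<open>i\<close> and the cost
    \<open>F\<close> at once. It can, because they enter through a single sum, and some value of a
    function does not exceed its mean.\<close>
  obtain w where w: "w \<in> space M" and "(\<Sum>i\<in>I. ennreal ((A i + (G i b w - expectation (G i b)))\<^sup>2)) + F b w
      \<le> (\<integral>\<^sup>+w. (\<Sum>i\<in>I. ennreal ((A i + (G i b w - expectation (G i b)))\<^sup>2)) + F b w \<partial>M)"
    using ex_le_nn_integral[of "\<lambda>w. (\<Sum>i\<in>I. ennreal ((A i + (G i b w - expectation (G i b)))\<^sup>2)) + F b w"] by auto
  note this(2)
  also have "(\<integral>\<^sup>+w. (\<Sum>i\<in>I. ennreal ((A i + (G i b w - expectation (G i b)))\<^sup>2)) + F b w \<partial>M)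
      = (\<Sum>i\<in>I. \<integral>\<^sup>+w. ennreal ((A i + (G i b w - expectation (G i b)))\<^sup>2) \<partial>M) + (\<integral>\<^sup>+w. F b w \<partial>M)"
    by (subst nn_integral_add, measurable, subst nn_integral_sum) auto
  also have "\<dots> \<le> (\<Sum>i\<in>I. ennreal ((A i)\<^sup>2 + (v b)\<^sup>2)) + (\<integral>\<^sup>+w. F b w \<partial>M)"
    using insert.prems by (intro add_mono sum_mono nn_integral_shifted_square_le) (auto simp del: ennreal_plus)
  also have "(\<Sum>i\<in>I. ennreal ((A i)\<^sup>2 + (v b)\<^sup>2)) = ennreal (\<Sum>i\<in>I. (A i)\<^sup>2) + ennreal (card I * (v b)\<^sup>2)"
    by (subst sum_ennreal) (auto simp: sum.distrib sum_nonneg)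
  finally have step: "(\<Sum>i\<in>I. ennreal ((A i + (G i b w - expectation (G i b)))\<^sup>2)) + F b w
      \<le> ennreal (\<Sum>i\<in>I. (A i)\<^sup>2) + ennreal (card I * (v b)\<^sup>2) + (\<integral>\<^sup>+w. F b w \<partial>M)" .
  let ?\<psi> = "\<psi>(b := w)"
  have upd: "(\<Sum>c\<in>insert b B. h c (?\<psi> c)) = h b w + (\<Sum>c\<in>B. h c (\<psi> c))" for h :: "'b \<Rightarrow> 'a \<Rightarrow> 'r::comm_monoid_add"
  proof -
    have "(\<Sum>c\<in>B. h c (?\<psi> c)) = (\<Sum>c\<in>B. h c (\<psi> c))"
      using insert.hyps by (intro sum.cong) auto
    then show ?thesis using insert.hyps by simp
  qed
  have "ennreal (\<Sum>i\<in>I. (\<Sum>c\<in>insert b B. G i c (?\<psi> c) - expectation (G i c))\<^sup>2) + (\<Sum>c\<in>insert b B. F c (?\<psi> c))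
    = ((\<Sum>i\<in>I. ennreal ((A i + (G i b w - expectation (G i b)))\<^sup>2)) + F b w) + (\<Sum>c\<in>B. F c (\<psi> c))"
    unfolding upd[of "\<lambda>c w. G _ c w - expectation (G _ c)"] upd[of F]
    by (simp add: A_def ac_simps sum_ennreal)
  also have "\<dots> \<le> (ennreal (\<Sum>i\<in>I. (A i)\<^sup>2) + ennreal (card I * (v b)\<^sup>2) + (\<integral>\<^sup>+w. F b w \<partial>M)) + (\<Sum>c\<in>B. F c (\<psi> c))"
    by (intro add_right_mono step)
  also have "\<dots> = (ennreal (\<Sum>i\<in>I. (A i)\<^sup>2) + (\<Sum>c\<in>B. F c (\<psi> c))) + (ennreal (card I * (v b)\<^sup>2) + (\<integral>\<^sup>+w. F b w \<partial>M))"
    by (simp add: ac_simps)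
  also have "\<dots> \<le> (ennreal (card I * (\<Sum>b\<in>B. (v b)\<^sup>2)) + (\<Sum>b\<in>B. \<integral>\<^sup>+w. F b w \<partial>M)) + (ennreal (card I * (v b)\<^sup>2) + (\<integral>\<^sup>+w. F b w \<partial>M))"
    using le unfolding A_def by (rule add_right_mono)
  also have "\<dots> = (ennreal (card I * (\<Sum>b\<in>B. (v b)\<^sup>2)) + ennreal (card I * (v b)\<^sup>2)) + (\<Sum>b\<in>insert b B. \<integral>\<^sup>+w. F b w \<partial>M)"
    using insert.hyps by (simp add: ac_simps)
  also have "ennreal (card I * (\<Sum>b\<in>B. (v b)\<^sup>2)) + ennreal (card I * (v b)\<^sup>2) = ennreal (card I * (\<Sum>b\<in>insert b B. (v b)\<^sup>2))"
    using insert.hyps by (simp add: distrib_left sum_nonneg add.commute flip: ennreal_plus)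
  finally show ?case
    using \<psi> w by (intro exI[of _ ?\<psi>]) auto
qed

text \<open>The value \<open>N\<close> reports that none of the candidates below \<open>N\<close> is
  accepted, so a codebook of \<open>N\<close> candidates gives rise to \<open>N + 1\<close>
  indices.\<close>

definition first_hit :: "nat \<Rightarrow> ('c \<Rightarrow> bool) \<Rightarrow> (nat \<Rightarrow> 'c) \<Rightarrow> nat" where
  "first_hit N acc \<psi> = (LEAST j. j = N \<or> acc (\<psi> j))"

lemma first_hit_le: "first_hit N acc \<psi> \<le> N"
  unfolding first_hit_def by (rule Least_le) simp

lemma first_hit_eq_iff: "j < N \<Longrightarrow> first_hit N acc \<psi> = j \<longleftrightarrow> acc (\<psi> j) \<and> (\<forall>i<j. \<not> acc (\<psi> i))"
  unfolding first_hit_def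
proof
  assume j: "j < N" and "(LEAST j. j = N \<or> acc (\<psi> j)) = j"
  moreover from this LeastI[of "\<lambda>j. j = N \<or> acc (\<psi> j)" N] have "j = N \<or> acc (\<psi> j)" by simp
  ultimately show "acc (\<psi> j) \<and> (\<forall>i<j. \<not> acc (\<psi> i))"
    using not_less_Least[of _ "\<lambda>j. j = N \<or> acc (\<psi> j)"] by auto
next
  assume "j < N" "acc (\<psi> j) \<and> (\<forall>i<j. \<not> acc (\<psi> i))"
  then show "(LEAST j. j = N \<or> acc (\<psi> j)) = j"
    by (intro Least_equality) (auto simp: not_less[symmetric])
qed

lemma first_hit_eq_N_iff: "first_hit N acc \<psi> = N \<longleftrightarrow> (\<forall>i<N. \<not> acc (\<psi> i))"
proof
  assume "first_hit N acc \<psi> = N"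
  then show "\<forall>i<N. \<not> acc (\<psi> i)"
    using not_less_Least[of _ "\<lambda>j. j = N \<or> acc (\<psi> j)"] by (auto simp: first_hit_def)
next
  assume "\<forall>i<N. \<not> acc (\<psi> i)"
  then show "first_hit N acc \<psi> = N"
    unfolding first_hit_def by (intro Least_equality) (auto simp: not_less[symmetric])
qed

text \<open>An accepted candidate has the law of \<open>T\<close> conditioned on acceptance, so
  \<open>\<beta>\<close> bounds its mean cost. Candidate \<open>j\<close> is reached with
  probability \<open>(1 - \<alpha>) ^ j\<close>, and \<open>\<alpha>\<close> times the sum of these
  is at most 1; all \<open>N\<close> candidates fail with probability
  \<open>(1 - \<alpha>) ^ N \<le> exp (- \<alpha> * N)\<close>.\<close>

lemma nn_integral_first_hit_le:
  assumes T: "prob_space T" and acc[measurable]: "Measurable.pred T acc" and h[measurable]: "h \<in> borel_measurable T"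
    and \<alpha>: "emeasure T {c\<in>space T. acc c} = ennreal \<alpha>" "0 < \<alpha>"
    and \<beta>: "(\<integral>\<^sup>+c. indicator {c\<in>space T. acc c} c * h c \<partial>T) \<le> ennreal \<alpha> * \<beta>"
  shows "(\<integral>\<^sup>+\<psi>. (if first_hit N acc \<psi> < N then h (\<psi> (first_hit N acc \<psi>)) else H) \<partial>(\<Pi>\<^sub>M i\<in>{..<N}. T))
    \<le> \<beta> + ennreal (exp (- \<alpha> * N)) * H"
proof -
  interpret T: prob_space T by fact
  interpret P: product_prob_space "\<lambda>_. T" "{..<N}" ..
  let ?P = "\<Pi>\<^sub>M i\<in>{..<N}. T"
  let ?a = "\<lambda>c. indicator {c\<in>space T. acc c} c :: ennreal" and ?b = "\<lambda>c. indicator {c\<in>space T. \<not> acc c} c :: ennreal"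
  have \<alpha>1: "\<alpha> \<le> 1" using T.emeasure_le_1[of "{c\<in>space T. acc c}"] \<alpha> by simp
  have b: "emeasure T {c\<in>space T. \<not> acc c} = ennreal (1 - \<alpha>)"
  proof -
    have "{c\<in>space T. \<not> acc c} = space T - {c\<in>space T. acc c}" by auto
    then show ?thesis using \<alpha> by (simp add: emeasure_compl T.emeasure_space_1 ennreal_minus flip: ennreal_1)
  qed
  \<comment> \<open>The product of \<open>\<phi> j i (\<psi> i)\<close> over \<open>i\<close> is
    \<open>h (\<psi> j)\<close> on the event that \<open>j\<close> is the first hit and 0 elsewhere;
    candidates after \<open>j\<close> contribute the factor 1. Being a product, it integrates factor
    by factor.\<close>
  define \<phi> where "\<phi> j i c = (if i < j then ?b c else if i = j then ?a c * h c else 1)" for j i :: nat and c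
  have [measurable]: "\<phi> j i \<in> borel_measurable T" for j i unfolding \<phi>_def by measurable
  have ci[measurable]: "(\<lambda>\<psi>. \<psi> i) \<in> ?P \<rightarrow>\<^sub>M T" if "i < N" for i using that by (intro measurable_component_singleton) auto
  have "(\<integral>\<^sup>+\<psi>. (if first_hit N acc \<psi> < N then h (\<psi> (first_hit N acc \<psi>)) else H) \<partial>?P)
    \<le> (\<integral>\<^sup>+\<psi>. (\<Sum>j<N. \<Prod>i<N. \<phi> j i (\<psi> i)) + H * (\<Prod>i<N. ?b (\<psi> i)) \<partial>?P)"
  proof (rule nn_integral_mono)
    fix \<psi> assume "\<psi> \<in> space ?P"
    then have sp: "\<psi> i \<in> space T" if "i < N" for i using that by (auto simp: space_PiM)
    show "(if first_hit N acc \<psi> < N then h (\<psi> (first_hit N acc \<psi>)) else H)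
      \<le> (\<Sum>j<N. \<Prod>i<N. \<phi> j i (\<psi> i)) + H * (\<Prod>i<N. ?b (\<psi> i))"
    proof (cases "first_hit N acc \<psi> < N")
      case True
      define j where "j = first_hit N acc \<psi>"
      have j: "j < N" "acc (\<psi> j)" "\<forall>i<j. \<not> acc (\<psi> i)"
        using True first_hit_eq_iff[of j N acc \<psi>] by (auto simp: j_def)
      have "(\<Prod>i<N. \<phi> j i (\<psi> i)) = (\<Prod>i\<in>{j}. \<phi> j i (\<psi> i))"
        using j sp by (intro prod.mono_neutral_right) (auto simp: \<phi>_def)
      also have "\<dots> = h (\<psi> j)" using j sp by (simp add: \<phi>_def)
      finally have "h (\<psi> j) = (\<Prod>i<N. \<phi> j i (\<psi> i))" ..
      also have "\<dots> \<le> (\<Sum>j<N. \<Prod>i<N. \<phi> j i (\<psi> i))" using j by (intro member_le_sum) auto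
      finally show ?thesis using True by (simp add: j_def[symmetric] add_increasing2)
    next
      case False
      then have "\<forall>i<N. \<not> acc (\<psi> i)" using first_hit_le[of N acc \<psi>] first_hit_eq_N_iff[of N acc \<psi>] by auto
      then have "(\<Prod>i<N. ?b (\<psi> i)) = 1" using sp by (intro prod.neutral) auto
      then show ?thesis using False by auto
    qed
  qed
  also have "\<dots> = (\<Sum>j<N. \<Prod>i<N. \<integral>\<^sup>+c. \<phi> j i c \<partial>T) + H * (\<Prod>i<N. \<integral>\<^sup>+c. ?b c \<partial>T)"
  proof -
    have m: "(\<lambda>\<psi>. \<Prod>i<N. u i (\<psi> i)) \<in> borel_measurable ?P" if "\<And>i. u i \<in> borel_measurable T" for u :: "nat \<Rightarrow> 'a \<Rightarrow> ennreal"
      by (intro borel_measurable_prod_ennreal measurable_compose[OF ci that]) auto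
    have i: "(\<integral>\<^sup>+\<psi>. (\<Prod>i<N. u i (\<psi> i)) \<partial>?P) = (\<Prod>i<N. \<integral>\<^sup>+c. u i c \<partial>T)" if "\<And>i. u i \<in> borel_measurable T" for u :: "nat \<Rightarrow> 'a \<Rightarrow> ennreal"
      using that by (intro P.product_nn_integral_prod) auto
    have mb: "?b \<in> borel_measurable T" by measurable
    have "(\<integral>\<^sup>+\<psi>. (\<Sum>j<N. \<Prod>i<N. \<phi> j i (\<psi> i)) + H * (\<Prod>i<N. ?b (\<psi> i)) \<partial>?P)
      = (\<integral>\<^sup>+\<psi>. (\<Sum>j<N. \<Prod>i<N. \<phi> j i (\<psi> i)) \<partial>?P) + (\<integral>\<^sup>+\<psi>. H * (\<Prod>i<N. ?b (\<psi> i)) \<partial>?P)"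
      by (intro nn_integral_add borel_measurable_sum borel_measurable_times_ennreal m mb) auto
    also have "(\<integral>\<^sup>+\<psi>. (\<Sum>j<N. \<Prod>i<N. \<phi> j i (\<psi> i)) \<partial>?P) = (\<Sum>j<N. \<integral>\<^sup>+\<psi>. (\<Prod>i<N. \<phi> j i (\<psi> i)) \<partial>?P)"
      by (intro nn_integral_sum m) auto
    also have "(\<integral>\<^sup>+\<psi>. H * (\<Prod>i<N. ?b (\<psi> i)) \<partial>?P) = H * (\<integral>\<^sup>+\<psi>. (\<Prod>i<N. ?b (\<psi> i)) \<partial>?P)"
      by (intro nn_integral_cmult m mb)
    finally show ?thesis
      using i[of "\<phi> _"] i[of "\<lambda>_. ?b"] mb by simp
  qed
  finally have main: "(\<integral>\<^sup>+\<psi>. (if first_hit N acc \<psi> < N then h (\<psi> (first_hit N acc \<psi>)) else H) \<partial>?P)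
    \<le> (\<Sum>j<N. \<Prod>i<N. \<integral>\<^sup>+c. \<phi> j i c \<partial>T) + H * (\<Prod>i<N. \<integral>\<^sup>+c. ?b c \<partial>T)" .
  have "(\<Prod>i<N. \<integral>\<^sup>+c. ?b c \<partial>T) = ennreal ((1 - \<alpha>) ^ N)"
    using \<alpha>1 by (simp add: b ennreal_power)
  also have "\<dots> \<le> ennreal (exp (- \<alpha> * N))"
  proof (intro ennreal_leI)
    have "(1 - \<alpha>) ^ N \<le> exp (- \<alpha>) ^ N"
      using \<alpha>1 exp_ge_add_one_self[of "- \<alpha>"] by (intro power_mono) auto
    then show "(1 - \<alpha>) ^ N \<le> exp (- \<alpha> * N)" by (simp add: exp_of_nat_mult[symmetric] mult.commute)
  qed
  finally have 2: "H * (\<Prod>i<N. \<integral>\<^sup>+c. ?b c \<partial>T) \<le> ennreal (exp (- \<alpha> * N)) * H"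
    by (subst mult.commute) (rule mult_right_mono, auto)
  have "(\<Sum>j<N. \<Prod>i<N. \<integral>\<^sup>+c. \<phi> j i c \<partial>T) \<le> (\<Sum>j<N. ennreal ((1 - \<alpha>) ^ j) * (ennreal \<alpha> * \<beta>))"
  proof (rule sum_mono)
    fix j assume "j \<in> {..<N}"
    then have j: "j < N" by simp
    have "(\<Prod>i<N. \<integral>\<^sup>+c. \<phi> j i c \<partial>T) = (\<Prod>i<Suc j. \<integral>\<^sup>+c. \<phi> j i c \<partial>T)"
      using j by (intro prod.mono_neutral_right) (auto simp: \<phi>_def T.emeasure_space_1)
    also have "\<dots> = ennreal ((1 - \<alpha>) ^ j) * (\<integral>\<^sup>+c. ?a c * h c \<partial>T)"
      using \<alpha>1 by (simp add: \<phi>_def b ennreal_power)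
    also have "\<dots> \<le> ennreal ((1 - \<alpha>) ^ j) * (ennreal \<alpha> * \<beta>)"
      by (intro mult_left_mono \<beta>) auto
    finally show "(\<Prod>i<N. \<integral>\<^sup>+c. \<phi> j i c \<partial>T) \<le> ennreal ((1 - \<alpha>) ^ j) * (ennreal \<alpha> * \<beta>)" .
  qed
  also have "(\<Sum>j<N. ennreal ((1 - \<alpha>) ^ j) * (ennreal \<alpha> * \<beta>)) = ennreal ((\<Sum>j<N. (1 - \<alpha>) ^ j) * \<alpha>) * \<beta>"
  proof -
    have "(\<Sum>j<N. ennreal ((1 - \<alpha>) ^ j) * (ennreal \<alpha> * \<beta>)) = (\<Sum>j<N. ennreal ((1 - \<alpha>) ^ j)) * (ennreal \<alpha> * \<beta>)"
      by (rule sum_distrib_right[symmetric])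
    also have "(\<Sum>j<N. ennreal ((1 - \<alpha>) ^ j)) = ennreal (\<Sum>j<N. (1 - \<alpha>) ^ j)"
      using \<alpha>1 by (intro sum_ennreal) auto
    finally show ?thesis using \<alpha>(2) by (subst ennreal_mult'') (auto simp: mult.assoc)
  qed
  also have "(\<Sum>j<N. (1 - \<alpha>) ^ j) * \<alpha> = 1 - (1 - \<alpha>) ^ N"
    using \<alpha>(2) by (subst geometric_sum) (auto simp: field_simps)
  also have "ennreal (1 - (1 - \<alpha>) ^ N) * \<beta> \<le> 1 * \<beta>"
    using \<alpha>1 by (intro mult_right_mono) (auto simp: ennreal_le_1)
  finally have 1: "(\<Sum>j<N. \<Prod>i<N. \<integral>\<^sup>+c. \<phi> j i c \<partial>T) \<le> \<beta>" by simp
  show ?thesis by (rule order_trans[OF main add_mono[OF 1 2]])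
qed

section \<open>Rejection coding\<close>

abbreviation unit_uniform :: "real measure" where
  "unit_uniform \<equiv> uniform_measure lborel {0..1}"

lemma prob_space_unit_uniform: "prob_space unit_uniform"
  by (rule prob_space_uniform_measure) auto

text \<open>The minimum with 1 is the cap of rejection sampling: ratios above \<open>L\<close> are
  accepted with certainty.\<close>

lemma emeasure_unit_uniform_le:
  assumes "0 \<le> s" "0 < L"
  shows "emeasure unit_uniform {u. u * L \<le> s} = ennreal (min 1 (s / L))"
proof -
  have e: "{0..1} \<inter> {u. u * L \<le> s} = {0..min 1 (s / L)}"
    using assms by (auto simp: field_simps)
  have "{u. u * L \<le> s} \<in> sets borel" by measurable
  then show ?thesis
    using assms by (subst emeasure_uniform_measure) (auto simp: e divide_ennreal_def)
qed

text \<open>A candidate \<open>c\<close> passes with probability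
  \<open>min 1 (\<rho> c / L)\<close>. The part of the density above \<open>L\<close> has mass at
  most \<open>\<eta>0\<close> and the rest at most \<open>L\<close> times the acceptance
  probability, which is therefore at least \<open>(1 - \<eta>0) / L\<close>. Hence an accepted
  candidate has density at most \<open>\<rho> / (1 - \<eta>0)\<close>; the cap leaves an upper bound
  in place of the exact law.\<close>

lemma nn_integral_rejection_le:
  assumes Q: "prob_space Q" and [measurable]: "\<rho> \<in> borel_measurable Q" and \<rho>0: "\<And>c. 0 \<le> \<rho> c"
    and \<rho>1: "(\<integral>\<^sup>+c. ennreal (\<rho> c) \<partial>Q) = 1"
    and \<eta>: "(\<integral>\<^sup>+c. ennreal (if L < \<rho> c then \<rho> c else 0) \<partial>Q) \<le> ennreal \<eta>0" "0 \<le> \<eta>0" "\<eta>0 < 1"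
    and L: "0 < L" and [measurable]: "h \<in> borel_measurable Q"
  shows "(\<integral>\<^sup>+\<psi>. (if first_hit N (\<lambda>(c, u). u * L \<le> \<rho> c) \<psi> < N then h (fst (\<psi> (first_hit N (\<lambda>(c, u). u * L \<le> \<rho> c) \<psi>))) else H)
       \<partial>(\<Pi>\<^sub>M i\<in>{..<N}. Q \<Otimes>\<^sub>M unit_uniform))
    \<le> ennreal (1 / (1 - \<eta>0)) * (\<integral>\<^sup>+c. ennreal (\<rho> c) * h c \<partial>Q) + ennreal (exp (- (1 - \<eta>0) / L * N)) * H"
proof -
  interpret Q: prob_space Q by fact
  interpret U: prob_space unit_uniform by (rule prob_space_unit_uniform)
  interpret T: pair_prob_space Q unit_uniform ..
  let ?T = "Q \<Otimes>\<^sub>M unit_uniform"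
  let ?acc = "\<lambda>(c, u). u * L \<le> \<rho> c"
  have acc[measurable]: "Measurable.pred ?T ?acc" by measurable
  let ?A = "{z \<in> space ?T. ?acc z}"
  have int: "(\<integral>\<^sup>+z. indicator ?A z * g (fst z) \<partial>?T) = (\<integral>\<^sup>+c. ennreal (min 1 (\<rho> c / L)) * g c \<partial>Q)"
    if [measurable]: "g \<in> borel_measurable Q" for g
  proof -
    have "(\<integral>\<^sup>+z. indicator ?A z * g (fst z) \<partial>?T) = (\<integral>\<^sup>+c. \<integral>\<^sup>+u. indicator ?A (c, u) * g c \<partial>unit_uniform \<partial>Q)"
      by (subst U.nn_integral_fst[symmetric]) auto
    also have "\<dots> = (\<integral>\<^sup>+c. ennreal (min 1 (\<rho> c / L)) * g c \<partial>Q)"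
    proof (rule nn_integral_cong)
      fix c assume c: "c \<in> space Q"
      have "(\<integral>\<^sup>+u. indicator ?A (c, u) * g c \<partial>unit_uniform) = (\<integral>\<^sup>+u. indicator {u. u * L \<le> \<rho> c} u * g c \<partial>unit_uniform)"
        using c by (intro nn_integral_cong) (auto simp: space_pair_measure split: split_indicator)
      also have "\<dots> = emeasure unit_uniform {u. u * L \<le> \<rho> c} * g c"
        by (subst nn_integral_multc) auto
      finally show "(\<integral>\<^sup>+u. indicator ?A (c, u) * g c \<partial>unit_uniform) = ennreal (min 1 (\<rho> c / L)) * g c"
        by (simp only: emeasure_unit_uniform_le[OF \<rho>0 L])
    qed
    finally show ?thesis .
  qed
  define \<alpha> where "\<alpha> = measure ?T ?A"
  have \<alpha>: "emeasure ?T ?A = ennreal \<alpha>" by (simp add: \<alpha>_def T.emeasure_eq_measure)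
  have "1 = (\<integral>\<^sup>+c. ennreal (if L < \<rho> c then \<rho> c else 0) + ennreal (if L < \<rho> c then 0 else \<rho> c) \<partial>Q)"
    unfolding \<rho>1[symmetric] by (intro nn_integral_cong) auto
  also have "\<dots> = (\<integral>\<^sup>+c. ennreal (if L < \<rho> c then \<rho> c else 0) \<partial>Q) + (\<integral>\<^sup>+c. ennreal (if L < \<rho> c then 0 else \<rho> c) \<partial>Q)"
    by (intro nn_integral_add) auto
  also have "\<dots> \<le> ennreal \<eta>0 + (\<integral>\<^sup>+c. ennreal L * ennreal (min 1 (\<rho> c / L)) \<partial>Q)"
  proof (intro add_mono \<eta> nn_integral_mono)
    fix c
    show "ennreal (if L < \<rho> c then 0 else \<rho> c) \<le> ennreal L * ennreal (min 1 (\<rho> c / L))"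
      using L \<rho>0[of c] by (auto simp: min_def field_simps simp flip: ennreal_mult')
  qed
  also have "(\<integral>\<^sup>+c. ennreal L * ennreal (min 1 (\<rho> c / L)) \<partial>Q) = ennreal L * ennreal \<alpha>"
  proof -
    have "?A \<in> sets ?T" using acc by (rule predE)
    then have "(\<integral>\<^sup>+c. ennreal (min 1 (\<rho> c / L)) \<partial>Q) = ennreal \<alpha>"
      using int[of "\<lambda>_. 1"] nn_integral_indicator[of ?A ?T] \<alpha> by (simp only: mult_1_right borel_measurable_const)
    then show ?thesis by (simp add: nn_integral_cmult)
  qed
  also have "ennreal \<eta>0 + ennreal L * ennreal \<alpha> = ennreal (\<eta>0 + L * \<alpha>)"
    using \<eta> L by (simp add: \<alpha>_def ennreal_mult)
  finally have "1 \<le> \<eta>0 + L * \<alpha>"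
    using \<eta> L by (simp add: \<alpha>_def del: ennreal_plus flip: ennreal_1)
  then have \<alpha>L: "(1 - \<eta>0) / L \<le> \<alpha>" using L by (simp add: field_simps)
  then have \<alpha>0: "0 < \<alpha>" using \<eta> L by (smt (verit) divide_pos_pos)
  let ?\<beta> = "ennreal (1 / (1 - \<eta>0)) * (\<integral>\<^sup>+c. ennreal (\<rho> c) * h c \<partial>Q)"
  have "(\<integral>\<^sup>+z. indicator ?A z * h (fst z) \<partial>?T) = (\<integral>\<^sup>+c. ennreal (min 1 (\<rho> c / L)) * h c \<partial>Q)"
    by (rule int) measurable
  also have "\<dots> \<le> (\<integral>\<^sup>+c. ennreal (1 / L) * (ennreal (\<rho> c) * h c) \<partial>Q)"
  proof (rule nn_integral_mono)
    fix c
    have "ennreal (min 1 (\<rho> c / L)) * h c \<le> ennreal (1 / L * \<rho> c) * h c"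
      by (intro mult_right_mono ennreal_leI) auto
    also have "ennreal (1 / L * \<rho> c) * h c = ennreal (1 / L) * (ennreal (\<rho> c) * h c)"
      using L \<rho>0[of c] by (subst ennreal_mult) (auto simp: mult.assoc)
    finally show "ennreal (min 1 (\<rho> c / L)) * h c \<le> ennreal (1 / L) * (ennreal (\<rho> c) * h c)" .
  qed
  also have "\<dots> = ennreal (1 / L) * (\<integral>\<^sup>+c. ennreal (\<rho> c) * h c \<partial>Q)"
    by (rule nn_integral_cmult) measurable
  also have "\<dots> \<le> ennreal (\<alpha> * (1 / (1 - \<eta>0))) * (\<integral>\<^sup>+c. ennreal (\<rho> c) * h c \<partial>Q)"
    using \<alpha>L \<eta> L by (intro mult_right_mono ennreal_leI) (auto simp: field_simps)
  also have "\<dots> = ennreal \<alpha> * ?\<beta>"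
    using \<alpha>0 \<eta> by (subst ennreal_mult) (auto simp: mult.assoc)
  finally have \<beta>: "(\<integral>\<^sup>+z. indicator ?A z * h (fst z) \<partial>?T) \<le> ennreal \<alpha> * ?\<beta>" .
  have "(\<integral>\<^sup>+\<psi>. (if first_hit N ?acc \<psi> < N then (\<lambda>z. h (fst z)) (\<psi> (first_hit N ?acc \<psi>)) else H) \<partial>(\<Pi>\<^sub>M i\<in>{..<N}. ?T))
    \<le> ?\<beta> + ennreal (exp (- \<alpha> * N)) * H"
    by (rule nn_integral_first_hit_le[OF T.prob_space_axioms acc _ \<alpha> \<alpha>0 \<beta>]) measurable
  also have "\<dots> \<le> ?\<beta> + ennreal (exp (- (1 - \<eta>0) / L * N)) * H"
  proof (intro add_left_mono mult_right_mono ennreal_leI)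
    have "- \<alpha> * N \<le> - (1 - \<eta>0) / L * N"
      using \<alpha>L by (intro mult_right_mono) (auto simp: minus_divide_left[symmetric] simp del: minus_diff_eq)
    then show "exp (- \<alpha> * N) \<le> exp (- (1 - \<eta>0) / L * N)" by simp
  qed simp
  finally show ?thesis by simp
qed

text \<open>\<open>N\<close> is the size of a codebook, \<open>L\<close> the cap in the acceptance
  test, \<open>\<eta>0\<close> the density mass above the cap that is tolerated for an input,
  \<open>y0\<close> the letter written in case of failure. \<open>r1\<close> is required at every
  \<open>x\<close>, so that the product density has mass 1 for every input sequence.\<close>

locale rejection_code =
  fixes M q :: "'a::polish_space measure" and n N :: nat and L \<eta>0 :: real
    and r :: "'a \<Rightarrow> 'a \<Rightarrow> real" and y0 :: 'a
  assumes M: "prob_meas M" and q: "prob_meas q"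
    and r[measurable]: "case_prod r \<in> borel_measurable (borel \<Otimes>\<^sub>M borel)" and r0: "\<And>x y. 0 \<le> r x y"
    and r1: "\<And>x. (\<integral>\<^sup>+y. ennreal (r x y) \<partial>q) = 1"
    and L: "0 < L" and \<eta>0: "0 \<le> \<eta>0" "\<eta>0 < 1"
begin

abbreviation "PM \<equiv> \<Pi>\<^sub>M i\<in>{..<n}. M"
abbreviation "Q \<equiv> \<Pi>\<^sub>M i\<in>{..<n}. q"
abbreviation "T \<equiv> Q \<Otimes>\<^sub>M unit_uniform"
abbreviation "W \<equiv> \<Pi>\<^sub>M i\<in>{..<N}. T"

sublocale M: prob_space M by (rule prob_measD[OF M])
sublocale q: prob_space q by (rule prob_measD[OF q])
sublocale U: prob_space unit_uniform by (rule prob_space_unit_uniform)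
sublocale PM: product_prob_space "\<lambda>_. M" "{..<n}" ..
sublocale Q: product_prob_space "\<lambda>_. q" "{..<n}" ..
sublocale T: pair_prob_space Q unit_uniform ..
sublocale W: product_prob_space "\<lambda>_. T" "{..<N}" ..
sublocale PW: pair_prob_space PM W ..

lemma sets_M [measurable_cong]: "sets M = sets borel" by (rule prob_measD[OF M])
lemma sets_q [measurable_cong]: "sets q = sets borel" by (rule prob_measD[OF q])

lemma measurable_coord_M: "t < n \<Longrightarrow> (\<lambda>x. x t) \<in> PM \<rightarrow>\<^sub>M borel"
  using measurable_component_singleton[of t "{..<n}" "\<lambda>_. M"] by (simp add: measurable_cong_sets[OF refl sets_M])

lemma measurable_coord_q: "t < n \<Longrightarrow> (\<lambda>x. x t) \<in> Q \<rightarrow>\<^sub>M borel"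
  using measurable_component_singleton[of t "{..<n}" "\<lambda>_. q"] by (simp add: measurable_cong_sets[OF refl sets_q])

lemma measurable_snd_T: "snd \<in> borel_measurable T"
proof -
  have s: "sets unit_uniform = sets borel" by simp
  show ?thesis using measurable_snd[of Q unit_uniform] unfolding measurable_cong_sets[OF refl s] .
qed

lemma measurable_coord_W: "j < N \<Longrightarrow> (\<lambda>\<psi>. \<psi> j) \<in> W \<rightarrow>\<^sub>M T"
  by (rule measurable_component_singleton) simp

definition rn :: "(nat \<Rightarrow> 'a) \<Rightarrow> (nat \<Rightarrow> 'a) \<Rightarrow> real" where
  "rn x c = (\<Prod>t<n. r (x t) (c t))"

lemma measurable_rn: "case_prod rn \<in> borel_measurable (PM \<Otimes>\<^sub>M Q)"
proof -
  have "(\<lambda>z. r (fst z t) (snd z t)) \<in> borel_measurable (PM \<Otimes>\<^sub>M Q)" if "t < n" for t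
  proof -
    have [measurable]: "(\<lambda>z. fst z t) \<in> PM \<Otimes>\<^sub>M Q \<rightarrow>\<^sub>M borel" "(\<lambda>z. snd z t) \<in> PM \<Otimes>\<^sub>M Q \<rightarrow>\<^sub>M borel"
      using measurable_compose[OF measurable_fst measurable_coord_M[OF that]]
        measurable_compose[OF measurable_snd measurable_coord_q[OF that]] by auto
    show ?thesis by measurable
  qed
  then show ?thesis unfolding rn_def case_prod_beta' by (intro borel_measurable_prod) auto
qed

lemma rn_nonneg: "0 \<le> rn x c"
  unfolding rn_def by (intro prod_nonneg) (simp add: r0)

text \<open>The probability, under the memoryless channel fed with \<open>x\<close>, that the
  likelihood ratio exceeds the cap. Its mean becomes exponentially small once \<open>ln L\<close>
  exceeds \<open>n\<close> times the information in nats by a linear margin.\<close>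

definition \<eta> :: "(nat \<Rightarrow> 'a) \<Rightarrow> ennreal" where
  "\<eta> x = (\<integral>\<^sup>+c. ennreal (if L < rn x c then rn x c else 0) \<partial>Q)"

lemma measurable_\<eta> [measurable]: "\<eta> \<in> borel_measurable PM"
proof -
  note measurable_rn[measurable]
  show ?thesis unfolding \<eta>_def by measurable
qed

text \<open>Inputs with too much density mass above the cap are sent to failure at once, since the
  rejection estimate does not apply to them.\<close>

definition hit :: "(nat \<Rightarrow> 'a) \<Rightarrow> (nat \<Rightarrow> (nat \<Rightarrow> 'a) \<times> real) \<Rightarrow> nat" where
  "hit x \<psi> = (if \<eta> x \<le> ennreal \<eta>0 then first_hit N (\<lambda>(c, u). u * L \<le> rn x c) \<psi> else N)"

lemma hit_le: "hit x \<psi> \<le> N"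
  by (simp add: hit_def first_hit_le)

lemma measurable_hit: "(\<lambda>z. hit (fst z) (snd z)) \<in> PM \<Otimes>\<^sub>M W \<rightarrow>\<^sub>M count_space UNIV"
proof -
  \<comment> \<open>Only the coordinates of \<open>\<psi>\<close> below \<open>N\<close> are known
    to be measurable, so the test is restricted to \<open>j < N\<close>; the alternative
    \<open>j = N\<close> ends the search there.\<close>
  have fh: "first_hit N acc \<psi> = (LEAST j. j = N \<or> (j < N \<and> acc (\<psi> j)))" for acc \<psi>
  proof (cases "first_hit N acc \<psi> < N")
    case True
    then show ?thesis
      using first_hit_eq_iff[OF True, of acc \<psi>] by (intro Least_equality[symmetric]) (auto intro: leI)
  next
    case False
    then have "first_hit N acc \<psi> = N" using first_hit_le[of N acc \<psi>] by simp
    then show ?thesis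
      using first_hit_eq_N_iff[of N acc \<psi>] by (intro Least_equality[symmetric]) auto
  qed
  have acc: "Measurable.pred (PM \<Otimes>\<^sub>M W) (\<lambda>z. j < N \<and> (case snd z j of (c, u) \<Rightarrow> u * L \<le> rn (fst z) c))" for j
  proof (cases "j < N")
    case True
    have sj: "(\<lambda>z. snd z j) \<in> PM \<Otimes>\<^sub>M W \<rightarrow>\<^sub>M T"
      using measurable_compose[OF measurable_snd measurable_coord_W[OF True]] .
    have "(\<lambda>z. (fst z, fst (snd z j))) \<in> PM \<Otimes>\<^sub>M W \<rightarrow>\<^sub>M PM \<Otimes>\<^sub>M Q"
      by (rule measurable_Pair[OF measurable_fst measurable_compose[OF sj measurable_fst]])
    from measurable_compose[OF this measurable_rn]
    have 1: "(\<lambda>z. rn (fst z) (fst (snd z j))) \<in> borel_measurable (PM \<Otimes>\<^sub>M W)" by simp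
    have 2: "(\<lambda>z. snd (snd z j) * L) \<in> borel_measurable (PM \<Otimes>\<^sub>M W)"
      using measurable_compose[OF sj measurable_snd_T] by (rule borel_measurable_times) simp
    have "Measurable.pred (PM \<Otimes>\<^sub>M W) (\<lambda>z. snd (snd z j) * L \<le> rn (fst z) (fst (snd z j)))"
      unfolding pred_def using borel_measurable_le[OF 2 1] .
    then show ?thesis by (simp only: case_prod_beta' True simp_thms)
  qed simp
  have h: "(\<lambda>z. LEAST j. j = N \<or> (j < N \<and> (case snd z j of (c, u) \<Rightarrow> u * L \<le> rn (fst z) c))) \<in> PM \<Otimes>\<^sub>M W \<rightarrow>\<^sub>M count_space UNIV"
  proof (rule measurable_Least)
    fix j
    show "Measurable.pred (PM \<Otimes>\<^sub>M W) (\<lambda>z. j = N \<or> (j < N \<and> (case snd z j of (c, u) \<Rightarrow> u * L \<le> rn (fst z) c)))"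
    proof (cases "j = N")
      case False
      then show ?thesis using acc[of j] by (simp only: simp_thms)
    qed simp
  qed
  have good: "{z \<in> space (PM \<Otimes>\<^sub>M W). \<eta> (fst z) \<le> ennreal \<eta>0} \<in> sets (PM \<Otimes>\<^sub>M W)"
    by (rule borel_measurable_le[OF measurable_compose[OF measurable_fst measurable_\<eta>]]) simp
  have e: "(\<lambda>z. hit (fst z) (snd z)) = (\<lambda>z. if \<eta> (fst z) \<le> ennreal \<eta>0
      then LEAST j. j = N \<or> (j < N \<and> (case snd z j of (c, u) \<Rightarrow> u * L \<le> rn (fst z) c)) else N)"
    unfolding hit_def fh by (rule refl)
  show ?thesis unfolding e by (rule measurable_If[OF h _ good]) (rule measurable_const, simp)
qed

definition out :: "(nat \<Rightarrow> 'a) \<Rightarrow> (nat \<Rightarrow> (nat \<Rightarrow> 'a) \<times> real) \<Rightarrow> nat \<Rightarrow> 'a" where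
  "out x \<psi> t = (if hit x \<psi> < N then fst (\<psi> (hit x \<psi>)) t else y0)"

lemma measurable_out:
  assumes t: "t < n"
  shows "(\<lambda>z. out (fst z) (snd z) t) \<in> PM \<Otimes>\<^sub>M W \<rightarrow>\<^sub>M borel"
proof -
  have "(\<lambda>z. (if j < N then fst (snd z j) t else y0)) \<in> PM \<Otimes>\<^sub>M W \<rightarrow>\<^sub>M borel" for j
  proof (cases "j < N")
    case True
    have "(\<lambda>z. fst (snd z j)) \<in> PM \<Otimes>\<^sub>M W \<rightarrow>\<^sub>M Q"
      by (rule measurable_compose[OF measurable_compose[OF measurable_snd measurable_coord_W[OF True]] measurable_fst])
    from measurable_compose[OF this measurable_coord_q[OF t]] True show ?thesis by simp
  qed simp
  from measurable_compose_countable[OF this measurable_hit] show ?thesis unfolding out_def .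
qed

text \<open>The density of the \<open>n\<close>-fold channel factorizes, and all coordinates but
  \<open>t\<close> integrate to 1, which leaves the single-letter channel at position
  \<open>t\<close>.\<close>

lemma nn_integral_rn:
  assumes "t < n" and [measurable]: "h \<in> borel_measurable borel"
  shows "(\<integral>\<^sup>+c. ennreal (rn x c) * h (c t) \<partial>Q) = (\<integral>\<^sup>+y. ennreal (r (x t) y) * h y \<partial>q)"
proof -
  let ?u = "\<lambda>i y. ennreal (r (x i) y) * (if i = t then h y else 1)"
  have m: "?u i \<in> borel_measurable q" for i by measurable
  have "ennreal (rn x c) * h (c t) = (\<Prod>i<n. ?u i (c i))" for c
    using assms(1) by (simp add: rn_def prod.distrib prod_ennreal r0 prod.delta)
  then have "(\<integral>\<^sup>+c. ennreal (rn x c) * h (c t) \<partial>Q) = (\<Prod>i<n. \<integral>\<^sup>+y. ?u i y \<partial>q)"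
    using Q.product_nn_integral_prod[of "{..<n}" ?u] m by simp
  also have "\<dots> = (\<Prod>i\<in>{t}. \<integral>\<^sup>+y. ?u i y \<partial>q)"
    using assms(1) by (intro prod.mono_neutral_right) (auto simp: r1)
  finally show ?thesis by simp
qed

abbreviation "e\<^sub>0 \<equiv> exp (- (1 - \<eta>0) / L * N)"

lemma nn_integral_out_le:
  assumes x: "x \<in> space PM" and t: "t < n" and h[measurable]: "h \<in> borel_measurable borel"
  shows "(\<integral>\<^sup>+\<psi>. h (out x \<psi> t) \<partial>W) \<le> ennreal (1 / (1 - \<eta>0)) * (\<integral>\<^sup>+y. ennreal (r (x t) y) * h y \<partial>q)
     + (ennreal e\<^sub>0 + (if \<eta> x \<le> ennreal \<eta>0 then 0 else 1)) * h y0"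
proof (cases "\<eta> x \<le> ennreal \<eta>0")
  case True
  have ct: "(\<lambda>c. h (c t)) \<in> borel_measurable Q"
    by (rule measurable_compose[OF measurable_coord_q[OF t] h])
  have rm: "rn x \<in> borel_measurable Q"
    using measurable_compose[OF measurable_Pair1'[OF x] measurable_rn] by simp
  have 1: "(\<integral>\<^sup>+c. ennreal (rn x c) \<partial>Q) = 1"
    using nn_integral_rn[OF t, of "\<lambda>_. 1" x] by (simp add: r1)
  have "(\<integral>\<^sup>+\<psi>. h (out x \<psi> t) \<partial>W) = (\<integral>\<^sup>+\<psi>. (if first_hit N (\<lambda>(c, u). u * L \<le> rn x c) \<psi> < N
      then (\<lambda>c. h (c t)) (fst (\<psi> (first_hit N (\<lambda>(c, u). u * L \<le> rn x c) \<psi>))) else h y0) \<partial>W)"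
    using True by (intro nn_integral_cong) (simp add: out_def hit_def)
  also have "\<dots> \<le> ennreal (1 / (1 - \<eta>0)) * (\<integral>\<^sup>+c. ennreal (rn x c) * h (c t) \<partial>Q) + ennreal e\<^sub>0 * h y0"
    using True by (intro nn_integral_rejection_le Q.P.prob_space_axioms rm rn_nonneg 1 L \<eta>0 ct) (simp add: \<eta>_def)
  finally show ?thesis using True by (simp add: nn_integral_rn[OF t h])
next
  case False
  then have "(\<integral>\<^sup>+\<psi>. h (out x \<psi> t) \<partial>W) = h y0"
    by (simp add: out_def hit_def W.P.emeasure_space_1)
  also have "\<dots> = (0 + 1) * h y0" by simp
  also have "\<dots> \<le> ennreal (1 / (1 - \<eta>0)) * (\<integral>\<^sup>+y. ennreal (r (x t) y) * h y \<partial>q) + (ennreal e\<^sub>0 + 1) * h y0"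
    by (intro add_increasing mult_right_mono add_mono) auto
  finally show ?thesis using False by simp
qed

text \<open>Three sources of cost: the ideal channel, inflated by the rejection factor; exhausted
  codebooks, with failure probability at most \<open>e\<^sub>0\<close>; and inputs sent to failure.
  The last term keeps \<open>h\<close> under the integral over the exceptional inputs, because a
  distortion may be unbounded there.\<close>

definition bound :: "nat \<Rightarrow> ('a \<times> 'a \<Rightarrow> ennreal) \<Rightarrow> ennreal" where
  "bound t h = ennreal (1 / (1 - \<eta>0)) * (\<integral>\<^sup>+x. \<integral>\<^sup>+y. ennreal (r x y) * h (x, y) \<partial>q \<partial>M)
     + ennreal e\<^sub>0 * (\<integral>\<^sup>+x. h (x, y0) \<partial>M)
     + (\<integral>\<^sup>+x. (if \<eta> x \<le> ennreal \<eta>0 then 0 else h (x t, y0)) \<partial>PM)"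

lemma nn_integral_coord:
  assumes "t < n" "h \<in> borel_measurable borel"
  shows "(\<integral>\<^sup>+x. h (x t) \<partial>PM) = (\<integral>\<^sup>+x. h x \<partial>M)"
proof -
  have "distr PM M (\<lambda>x. x t) = M" using assms by (intro PM.PiM_component) auto
  then have "(\<integral>\<^sup>+x. h x \<partial>M) = (\<integral>\<^sup>+x. h x \<partial>distr PM M (\<lambda>x. x t))" by simp
  also have "\<dots> = (\<integral>\<^sup>+x. h (x t) \<partial>PM)"
    using assms by (intro nn_integral_distr measurable_component_singleton) (auto simp: measurable_cong_sets[OF sets_M refl])
  finally show ?thesis ..
qed

lemma nn_integral_nn_integral_out_le:
  assumes t: "t < n" and h[measurable]: "h \<in> borel_measurable (borel \<Otimes>\<^sub>M borel)"
  shows "(\<integral>\<^sup>+x. \<integral>\<^sup>+\<psi>. h (x t, out x \<psi> t) \<partial>W \<partial>PM) \<le> bound t h"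
proof -
  note measurable_coord_M[OF t, measurable]
  have m1[measurable]: "(\<lambda>x. \<integral>\<^sup>+y. ennreal (r x y) * h (x, y) \<partial>q) \<in> borel_measurable borel" by measurable
  have "(\<integral>\<^sup>+x. \<integral>\<^sup>+\<psi>. h (x t, out x \<psi> t) \<partial>W \<partial>PM) \<le> (\<integral>\<^sup>+x. ennreal (1 / (1 - \<eta>0)) * (\<integral>\<^sup>+y. ennreal (r (x t) y) * h (x t, y) \<partial>q)
     + (ennreal e\<^sub>0 + (if \<eta> x \<le> ennreal \<eta>0 then 0 else 1)) * h (x t, y0) \<partial>PM)"
    by (intro nn_integral_mono nn_integral_out_le t) measurable
  also have "\<dots> = (\<integral>\<^sup>+x. ennreal (1 / (1 - \<eta>0)) * (\<integral>\<^sup>+y. ennreal (r (x t) y) * h (x t, y) \<partial>q) \<partial>PM)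
     + (\<integral>\<^sup>+x. (ennreal e\<^sub>0 + (if \<eta> x \<le> ennreal \<eta>0 then 0 else 1)) * h (x t, y0) \<partial>PM)"
    by (intro nn_integral_add) measurable
  also have "(\<integral>\<^sup>+x. ennreal (1 / (1 - \<eta>0)) * (\<integral>\<^sup>+y. ennreal (r (x t) y) * h (x t, y) \<partial>q) \<partial>PM)
     = ennreal (1 / (1 - \<eta>0)) * (\<integral>\<^sup>+x. \<integral>\<^sup>+y. ennreal (r x y) * h (x, y) \<partial>q \<partial>M)"
    using nn_integral_coord[OF t m1] by (subst nn_integral_cmult) auto
  also have "(\<integral>\<^sup>+x. (ennreal e\<^sub>0 + (if \<eta> x \<le> ennreal \<eta>0 then 0 else 1)) * h (x t, y0) \<partial>PM)
     = (\<integral>\<^sup>+x. ennreal e\<^sub>0 * h (x t, y0) + (if \<eta> x \<le> ennreal \<eta>0 then 0 else h (x t, y0)) \<partial>PM)"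
    by (intro nn_integral_cong) (auto simp: distrib_right)
  also have "\<dots> = (\<integral>\<^sup>+x. ennreal e\<^sub>0 * h (x t, y0) \<partial>PM) + (\<integral>\<^sup>+x. (if \<eta> x \<le> ennreal \<eta>0 then 0 else h (x t, y0)) \<partial>PM)"
    by (intro nn_integral_add) measurable
  also have "(\<integral>\<^sup>+x. ennreal e\<^sub>0 * h (x t, y0) \<partial>PM) = ennreal e\<^sub>0 * (\<integral>\<^sup>+x. h (x, y0) \<partial>M)"
    using nn_integral_coord[OF t, of "\<lambda>x. h (x, y0)"] by (subst nn_integral_cmult) auto
  finally show ?thesis by (simp add: bound_def add.assoc)
qed

end

section \<open>Separate codebooks for the patterns of the leading source symbols\<close>

locale split_rejection_code = rejection_code M q n N L \<eta>0 r y0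
  for M q :: "'a::polish_space measure" and n N :: nat and L \<eta>0 :: real
    and r :: "'a \<Rightarrow> 'a \<Rightarrow> real" and y0 :: 'a +
  fixes E :: "'a set" and k :: nat and p :: real
  assumes E: "E \<in> sets borel" and k: "k \<le> n" and p: "measure M E \<le> p" "1 - measure M E \<le> p"
begin

definition pat :: "(nat \<Rightarrow> 'a) \<Rightarrow> nat set" where
  "pat x = {i. i < k \<and> x i \<in> E}"

lemma pat_in: "pat x \<in> Pow {..<k}" and finite_pat: "finite (pat x)"
  by (auto simp: pat_def)

lemma p0: "0 \<le> p" using p(1) by (rule order_trans[rotated]) simp

lemma sets_pat: "{x \<in> space PM. pat x = b} \<in> sets PM"
proof (cases "b \<subseteq> {..<k}")
  case True
  have "{x \<in> space PM. pat x = b} = {x \<in> space PM. \<forall>i\<in>{..<k}. x i \<in> (if i \<in> b then E else - E)}"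
    using True by (auto simp: pat_def)
  also have "\<dots> \<in> sets PM"
  proof (rule sets.sets_Collect_finite_All)
    fix i assume "i \<in> {..<k}"
    then have "(\<lambda>x. x i) \<in> PM \<rightarrow>\<^sub>M borel" using k by (intro measurable_coord_M) auto
    from measurable_sets[OF this, of "if i \<in> b then E else - E"] E
    have "(\<lambda>x. x i) -` (if i \<in> b then E else - E) \<inter> space PM \<in> sets PM" by auto
    then show "{x \<in> space PM. x i \<in> (if i \<in> b then E else - E)} \<in> sets PM"
      by (rule back_subst[of "\<lambda>S. S \<in> sets PM"]) auto
  qed simp
  finally show ?thesis .
next
  case False
  then have "{x \<in> space PM. pat x = b} = {}" by (auto simp: pat_def)
  then show ?thesis by (simp only: sets.empty_sets)
qed

lemma measurable_pat: "pat \<in> PM \<rightarrow>\<^sub>M count_space (Pow {..<k})"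
proof (subst measurable_count_space_eq2)
  show "finite (Pow {..<k})" by simp
  have "pat -` {b} \<inter> space PM \<in> sets PM" for b
    using sets_pat[of b] by (rule back_subst[of "\<lambda>S. S \<in> sets PM"]) auto
  then show "pat \<in> space PM \<rightarrow> Pow {..<k} \<and> (\<forall>a\<in>Pow {..<k}. pat -` {a} \<inter> space PM \<in> sets PM)"
    using pat_in by auto
qed

text \<open>This probability is also the largest influence that the choice of the codebook for
  \<open>b\<close> can have on any output probability.\<close>

definition v :: "nat set \<Rightarrow> real" where
  "v b = measure PM {x \<in> space PM. pat x = b}"

text \<open>By independence the probability of a pattern is a product of \<open>k\<close> factors,
  each the probability of \<open>E\<close> or of its complement; the other coordinates are
  unconstrained.\<close>

lemma v_le: "b \<in> Pow {..<k} \<Longrightarrow> v b \<le> p ^ k"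
proof -
  assume b: "b \<in> Pow {..<k}"
  let ?A = "\<lambda>i. if i < k then (if i \<in> b then E else - E) else UNIV"
  have A: "?A i \<in> sets M" for i using E by (auto simp: sets_M)
  have sp: "space M = UNIV" using prob_measD(3)[OF M] .
  have "{x \<in> space PM. pat x = b} = Pi\<^sub>E {..<n} ?A"
  proof (rule set_eqI)
    fix x
    have "x \<in> Pi\<^sub>E {..<n} ?A \<longleftrightarrow> x \<in> extensional {..<n} \<and> (\<forall>i<n. x i \<in> ?A i)"
      by (simp only: PiE_iff Ball_def lessThan_iff conj_commute)
    also have "(\<forall>i<n. x i \<in> ?A i) \<longleftrightarrow> (\<forall>i<k. x i \<in> E \<longleftrightarrow> i \<in> b)"
    proof
      assume a: "\<forall>i<n. x i \<in> ?A i"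
      show "\<forall>i<k. x i \<in> E \<longleftrightarrow> i \<in> b"
      proof (intro allI impI)
        fix i assume "i < k"
        then have "x i \<in> ?A i" using a[rule_format, OF order.strict_trans2[OF _ k]] by blast
        with \<open>i < k\<close> show "x i \<in> E \<longleftrightarrow> i \<in> b" by (cases "i \<in> b") auto
      qed
    qed simp
    also have "\<dots> \<longleftrightarrow> pat x = b" using b by (fastforce simp: pat_def)
    also have "x \<in> extensional {..<n} \<longleftrightarrow> x \<in> space PM" by (simp add: space_PiM sp PiE_def)
    finally show "x \<in> {x \<in> space PM. pat x = b} \<longleftrightarrow> x \<in> Pi\<^sub>E {..<n} ?A" by simp
  qed
  then have "v b = (\<Prod>i<n. measure M (?A i))"
  proof -
    assume eq: "{x \<in> space PM. pat x = b} = Pi\<^sub>E {..<n} ?A"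
    have "emeasure PM (Pi\<^sub>E {..<n} ?A) = (\<Prod>i<n. emeasure M (?A i))"
      by (rule PM.emeasure_PiM[OF finite_lessThan A])
    also have "\<dots> = (\<Prod>i<n. ennreal (measure M (?A i)))"
      by (intro prod.cong refl M.emeasure_eq_measure)
    also have "\<dots> = ennreal (\<Prod>i<n. measure M (?A i))"
      by (rule prod_ennreal) (rule measure_nonneg)
    finally have "emeasure PM (Pi\<^sub>E {..<n} ?A) = ennreal (\<Prod>i<n. measure M (?A i))" .
    then show ?thesis
      unfolding v_def eq by (rule measure_eq_emeasure_eq_ennreal[rotated]) (rule prod_nonneg, rule measure_nonneg)
  qed
  also have "\<dots> = (\<Prod>i<k. measure M (?A i))"
    using k M.prob_space by (intro prod.mono_neutral_right) (auto simp: sp)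
  also have "\<dots> \<le> (\<Prod>i<k. p)"
  proof (intro prod_mono conjI)
    fix i assume i: "i \<in> {..<k}"
    have "measure M (- E) = 1 - measure M E"
      using M.prob_compl[of E] E by (simp add: sets_M sp Compl_eq_Diff_UNIV)
    then show "measure M (?A i) \<le> p" using p i by simp
  qed simp
  finally show ?thesis by simp
qed

lemma sum_v: "(\<Sum>b\<in>Pow {..<k}. v b) = 1"
proof -
  have "(\<Sum>b\<in>Pow {..<k}. v b) = measure PM (\<Union>b\<in>Pow {..<k}. {x \<in> space PM. pat x = b})"
    unfolding v_def using sets_pat
    by (intro measure_finite_Union[symmetric]) (auto simp: disjoint_family_on_def PM.P.emeasure_eq_measure)
  also have "(\<Union>b\<in>Pow {..<k}. {x \<in> space PM. pat x = b}) = space PM" using pat_in by auto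
  finally show ?thesis by (simp add: PM.P.prob_space)
qed

text \<open>The largest weight times the total weight 1. The sum of squared influences plays the
  part of a variance in the derandomization.\<close>

lemma sum_v_squared: "(\<Sum>b\<in>Pow {..<k}. (v b)\<^sup>2) \<le> p ^ k"
proof -
  have "(\<Sum>b\<in>Pow {..<k}. (v b)\<^sup>2) \<le> (\<Sum>b\<in>Pow {..<k}. p ^ k * v b)"
    unfolding power2_eq_square by (intro sum_mono mult_right_mono v_le) (auto simp: v_def)
  also have "\<dots> = p ^ k" by (simp only: sum_distrib_left[symmetric] sum_v mult_1_right)
  finally show ?thesis .
qed

text \<open>The share of pattern \<open>b\<close> in the mean cost at position \<open>t\<close>. It
  depends on the codebook of \<open>b\<close> alone, so the total over all \<open>b\<close> is a sum
  of functions of separate choices.\<close>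

definition Gn :: "('a \<times> 'a \<Rightarrow> ennreal) \<Rightarrow> nat \<Rightarrow> nat set \<Rightarrow> (nat \<Rightarrow> (nat \<Rightarrow> 'a) \<times> real) \<Rightarrow> ennreal" where
  "Gn h t b \<psi> = (\<integral>\<^sup>+x. indicator {x \<in> space PM. pat x = b} x * h (x t, out x \<psi> t) \<partial>PM)"

lemma measurable_pair_out:
  assumes t: "t < n" and h: "h \<in> borel_measurable (borel \<Otimes>\<^sub>M borel)"
  shows "(\<lambda>z. h (fst z t, out (fst z) (snd z) t)) \<in> borel_measurable (PM \<Otimes>\<^sub>M W)"
  by (rule measurable_compose[OF measurable_Pair[OF measurable_compose[OF measurable_fst measurable_coord_M[OF t]] measurable_out[OF t]] h])

lemma measurable_Gn_integrand:
  fixes h :: "'a \<times> 'a \<Rightarrow> ennreal"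
  assumes t: "t < n" and h: "h \<in> borel_measurable (borel \<Otimes>\<^sub>M borel)"
  shows "(\<lambda>(x, \<psi>). indicator {x \<in> space PM. pat x = b} x * h (x t, out x \<psi> t)) \<in> borel_measurable (PM \<Otimes>\<^sub>M W)"
proof -
  have "(\<lambda>x. indicator {x \<in> space PM. pat x = b} x :: ennreal) \<in> borel_measurable PM"
    using sets_pat by measurable
  from measurable_compose[OF measurable_fst this] measurable_pair_out[OF t h] show ?thesis
    unfolding case_prod_beta' by (rule borel_measurable_times_ennreal)
qed

lemma measurable_Gn:
  assumes t: "t < n" and h: "h \<in> borel_measurable (borel \<Otimes>\<^sub>M borel)"
  shows "Gn h t b \<in> borel_measurable W"
proof -
  have "(\<lambda>(\<psi>, x). indicator {x \<in> space PM. pat x = b} x * h (x t, out x \<psi> t)) \<in> borel_measurable (W \<Otimes>\<^sub>M PM)"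
    using measurable_compose[OF measurable_pair_swap' measurable_Gn_integrand[OF t h, of b]] by (simp add: case_prod_beta')
  from PM.P.borel_measurable_nn_integral[OF this] show ?thesis unfolding Gn_def[abs_def] .
qed

lemma sum_indicator_pat:
  assumes "x \<in> space PM"
  shows "(\<Sum>b\<in>Pow {..<k}. indicator {x \<in> space PM. pat x = b} x * H b) = (H (pat x) :: ennreal)"
proof -
  have "(\<Sum>b\<in>Pow {..<k}. indicator {x \<in> space PM. pat x = b} x * H b) = (\<Sum>b\<in>Pow {..<k}. if pat x = b then H b else 0)"
    using assms by (intro sum.cong) auto
  then show ?thesis using pat_in[of x] by (simp add: sum.delta)
qed

text \<open>The codebooks of all patterns have the same random law, so after exchanging the
  integrals the shares add up to the mean cost of one random codebook.\<close>

lemma sum_nn_integral_Gn_le: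
  assumes t: "t < n" and h: "h \<in> borel_measurable (borel \<Otimes>\<^sub>M borel)"
  shows "(\<Sum>b\<in>Pow {..<k}. \<integral>\<^sup>+\<psi>. Gn h t b \<psi> \<partial>W) \<le> bound t h"
proof -
  have m1: "(\<lambda>\<psi>. h (x t, out x \<psi> t)) \<in> borel_measurable W" if "x \<in> space PM" for x
    using measurable_compose[OF measurable_Pair1'[OF that] measurable_pair_out[OF t h]] by simp
  have m2: "(\<lambda>x. \<integral>\<^sup>+\<psi>. h (x t, out x \<psi> t) \<partial>W) \<in> borel_measurable PM"
    using W.P.borel_measurable_nn_integral[of "\<lambda>x \<psi>. h (x t, out x \<psi> t)" PM] measurable_pair_out[OF t h]
    by (simp add: case_prod_beta')
  have "(\<Sum>b\<in>Pow {..<k}. \<integral>\<^sup>+\<psi>. Gn h t b \<psi> \<partial>W)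
    = (\<Sum>b\<in>Pow {..<k}. \<integral>\<^sup>+x. \<integral>\<^sup>+\<psi>. indicator {x \<in> space PM. pat x = b} x * h (x t, out x \<psi> t) \<partial>W \<partial>PM)"
    unfolding Gn_def using measurable_Gn_integrand[OF t h]
    by (intro sum.cong refl PW.Fubini') (simp add: case_prod_beta')
  also have "\<dots> = (\<Sum>b\<in>Pow {..<k}. \<integral>\<^sup>+x. indicator {x \<in> space PM. pat x = b} x * (\<integral>\<^sup>+\<psi>. h (x t, out x \<psi> t) \<partial>W) \<partial>PM)"
    by (intro sum.cong nn_integral_cong refl nn_integral_cmult m1)
  also have "\<dots> = (\<integral>\<^sup>+x. (\<Sum>b\<in>Pow {..<k}. indicator {x \<in> space PM. pat x = b} x * (\<integral>\<^sup>+\<psi>. h (x t, out x \<psi> t) \<partial>W)) \<partial>PM)"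
    by (intro nn_integral_sum[symmetric] borel_measurable_times_ennreal borel_measurable_indicator sets_pat m2)
  also have "\<dots> = (\<integral>\<^sup>+x. \<integral>\<^sup>+\<psi>. h (x t, out x \<psi> t) \<partial>W \<partial>PM)"
    by (intro nn_integral_cong sum_indicator_pat)
  also have "\<dots> \<le> bound t h"
    by (rule nn_integral_nn_integral_out_le[OF t h])
  finally show ?thesis .
qed

text \<open>The pattern is sent along with the index, so that the decoder knows which codebook to
  consult; this is what costs \<open>k\<close> bits. Both are packed into one natural
  number.\<close>

definition enc :: "(nat set \<Rightarrow> nat \<Rightarrow> (nat \<Rightarrow> 'a) \<times> real) \<Rightarrow> (nat \<Rightarrow> 'a) \<Rightarrow> nat" where
  "enc \<Psi> x = prod_encode (set_encode (pat x), hit x (\<Psi> (pat x)))"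

definition dec :: "(nat set \<Rightarrow> nat \<Rightarrow> (nat \<Rightarrow> 'a) \<times> real) \<Rightarrow> nat \<Rightarrow> nat \<Rightarrow> 'a" where
  "dec \<Psi> z t = (case prod_decode z of (c, j) \<Rightarrow> if j < N then fst (\<Psi> (set_decode c) j) t else y0)"

lemma dec_enc: "dec \<Psi> (enc \<Psi> x) t = out x (\<Psi> (pat x)) t"
  by (simp add: dec_def enc_def out_def finite_pat)

lemma measurable_enc:
  assumes \<Psi>: "\<And>b. b \<in> Pow {..<k} \<Longrightarrow> \<Psi> b \<in> space W"
  shows "enc \<Psi> \<in> PM \<rightarrow>\<^sub>M count_space UNIV"
  unfolding enc_def
proof (rule measurable_compose_countable'[OF _ measurable_pat])
  fix b assume "b \<in> Pow {..<k}"
  from measurable_compose[OF measurable_Pair2'[OF \<Psi>[OF this]] measurable_hit]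
  have "(\<lambda>x. hit x (\<Psi> b)) \<in> PM \<rightarrow>\<^sub>M count_space UNIV" by simp
  from measurable_compose[OF this, of "\<lambda>j. prod_encode (set_encode b, j)" "count_space UNIV"]
  show "(\<lambda>x. prod_encode (set_encode b, hit x (\<Psi> b))) \<in> PM \<rightarrow>\<^sub>M count_space UNIV" by simp
qed (rule countable_finite, simp)

lemma sum_Gn:
  assumes t: "t < n" and h: "h \<in> borel_measurable (borel \<Otimes>\<^sub>M borel)"
    and \<Psi>: "\<And>b. b \<in> Pow {..<k} \<Longrightarrow> \<Psi> b \<in> space W"
  shows "(\<Sum>b\<in>Pow {..<k}. Gn h t b (\<Psi> b)) = (\<integral>\<^sup>+x. h (x t, dec \<Psi> (enc \<Psi> x) t) \<partial>PM)"
proof -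
  have m1: "(\<lambda>x. h (x t, out x (\<Psi> b) t)) \<in> borel_measurable PM" if "b \<in> Pow {..<k}" for b
    using measurable_compose[OF measurable_Pair2'[OF \<Psi>[OF that]] measurable_pair_out[OF t h]] by simp
  have "(\<Sum>b\<in>Pow {..<k}. Gn h t b (\<Psi> b))
    = (\<integral>\<^sup>+x. (\<Sum>b\<in>Pow {..<k}. indicator {x \<in> space PM. pat x = b} x * h (x t, out x (\<Psi> b) t)) \<partial>PM)"
    unfolding Gn_def
    by (intro nn_integral_sum[symmetric] borel_measurable_times_ennreal borel_measurable_indicator sets_pat m1)
  also have "\<dots> = (\<integral>\<^sup>+x. h (x t, dec \<Psi> (enc \<Psi> x) t) \<partial>PM)"
    unfolding dec_enc by (intro nn_integral_cong sum_indicator_pat)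
  finally show ?thesis .
qed

lemma enc_in: "enc \<Psi> x \<in> prod_encode ` (set_encode ` Pow {..<k} \<times> {..N})"
  unfolding enc_def using pat_in[of x] hit_le[of x "\<Psi> (pat x)"] by blast

lemma card_codes: "card (prod_encode ` (set_encode ` Pow {..<k} \<times> {..N})) \<le> 2 ^ k * (N + 1)"
proof -
  have "card (prod_encode ` (set_encode ` Pow {..<k} \<times> {..N})) \<le> card (set_encode ` Pow {..<k} \<times> {..N})"
    by (intro card_image_le) auto
  also have "\<dots> = card (set_encode ` Pow {..<k}) * (N + 1)" by (simp add: card_cartesian_product)
  also have "\<dots> \<le> card (Pow {..<k}) * (N + 1)" by (intro mult_right_mono card_image_le) auto
  finally show ?thesis by (simp add: card_Pow)
qed

lemma Gn_le_v:
  assumes "\<And>z. h z \<le> 1"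
  shows "Gn h t b \<psi> \<le> ennreal (v b)"
proof -
  have "Gn h t b \<psi> \<le> (\<integral>\<^sup>+x. indicator {x \<in> space PM. pat x = b} x \<partial>PM)"
    unfolding Gn_def using assms by (intro nn_integral_mono) (auto split: split_indicator)
  also have "\<dots> = ennreal (v b)" using sets_pat by (simp add: v_def PM.P.emeasure_eq_measure)
  finally show ?thesis .
qed

text \<open>The choices to be fixed are the codebooks, one for each pattern. The controlled
  quantities, indexed by \<open>(t, s)\<close>, are the probabilities that the letter at position
  \<open>t\<close> lies in \<open>A s\<close>, and \<open>m t s\<close> is their mean over random
  codebooks. The distortion rides along with the exchange rate \<open>c\<close>, since the argument
  bounds one combined number only.\<close>

lemma ex_code:
  fixes A :: "'i \<Rightarrow> 'a set"
  assumes S: "finite S" and A: "\<And>s. s \<in> S \<Longrightarrow> A s \<in> sets borel" and c: "0 \<le> c" and h: "h \<in> borel_measurable (borel \<Otimes>\<^sub>M borel)"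
  shows "\<exists>\<Psi> m. enc \<Psi> \<in> PM \<rightarrow>\<^sub>M count_space UNIV \<and>
    (\<forall>t<n. \<forall>s\<in>S. 0 \<le> m t s \<and> ennreal (m t s) \<le> bound t (\<lambda>(x, y). indicator (A s) y)) \<and>
    ennreal (\<Sum>(t, s)\<in>{..<n} \<times> S. (measure PM {x \<in> space PM. dec \<Psi> (enc \<Psi> x) t \<in> A s} - m t s)\<^sup>2)
      + ennreal c * (\<Sum>t<n. \<integral>\<^sup>+x. h (x t, dec \<Psi> (enc \<Psi> x) t) \<partial>PM)
    \<le> ennreal (real n * card S * p ^ k) + ennreal c * (\<Sum>t<n. bound t h)"
proof -
  have hs: "(\<lambda>(x, y). indicator (A s) y :: ennreal) \<in> borel_measurable ((borel :: 'a measure) \<Otimes>\<^sub>M borel)" if "s \<in> S" for s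
    using A[OF that] by measurable
  let ?h = "\<lambda>s. (\<lambda>(x::'a, y). indicator (A s) y :: ennreal)"
  have h1: "?h s z \<le> 1" for s z by (cases z) (auto split: split_indicator)
  \<comment> \<open>Deviations are formed in the reals; the finite bound \<open>v b\<close> makes
    the passage from \<open>ennreal\<close> faithful.\<close>
  define G where "G i b \<psi> = enn2real (Gn (?h (snd i)) (fst i) b \<psi>)" for i :: "nat \<times> 'i" and b \<psi>
  have G: "ennreal (G i b \<psi>) = Gn (?h (snd i)) (fst i) b \<psi>" for i b \<psi>
    unfolding G_def using order.strict_trans1[OF Gn_le_v[of "?h (snd i)" "fst i" b \<psi>, OF h1] ennreal_less_top]
    by (intro ennreal_enn2real)
  have G0: "0 \<le> G i b \<psi>" for i b \<psi> by (simp add: G_def)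
  have G1: "G i b \<psi> \<le> v b" for i b \<psi>
    using Gn_le_v[of "?h (snd i)" "fst i" b \<psi>, OF h1] unfolding G[symmetric] by (subst (asm) ennreal_le_iff) (auto simp: v_def)
  have Gm: "G i b \<in> borel_measurable W" if "i \<in> {..<n} \<times> S" for i b
    unfolding G_def[abs_def] using that by (intro borel_measurable_enn2real measurable_Gn hs) auto
  define F where "F b \<psi> = ennreal c * (\<Sum>t<n. Gn h t b \<psi>)" for b \<psi>
  have Fm: "F b \<in> borel_measurable W" for b
    unfolding F_def[abs_def] using measurable_Gn[OF _ h] by (intro borel_measurable_times_ennreal borel_measurable_sum) auto
  have "\<exists>\<Psi>. (\<forall>b\<in>Pow {..<k}. \<Psi> b \<in> space W) \<and>
    ennreal (\<Sum>i\<in>{..<n} \<times> S. (\<Sum>b\<in>Pow {..<k}. G i b (\<Psi> b) - W.P.expectation (G i b))\<^sup>2) + (\<Sum>b\<in>Pow {..<k}. F b (\<Psi> b))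
      \<le> ennreal (card ({..<n} \<times> S) * (\<Sum>b\<in>Pow {..<k}. (v b)\<^sup>2)) + (\<Sum>b\<in>Pow {..<k}. \<integral>\<^sup>+w. F b w \<partial>W)"
    using S Gm Fm G0 G1 by (intro W.P.ex_choice_small_deviation) auto
  then obtain \<Psi> where \<Psi>: "\<And>b. b \<in> Pow {..<k} \<Longrightarrow> \<Psi> b \<in> space W" and
    le: "ennreal (\<Sum>i\<in>{..<n} \<times> S. (\<Sum>b\<in>Pow {..<k}. G i b (\<Psi> b) - W.P.expectation (G i b))\<^sup>2) + (\<Sum>b\<in>Pow {..<k}. F b (\<Psi> b))
      \<le> ennreal (card ({..<n} \<times> S) * (\<Sum>b\<in>Pow {..<k}. (v b)\<^sup>2)) + (\<Sum>b\<in>Pow {..<k}. \<integral>\<^sup>+w. F b w \<partial>W)"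
    by blast
  define m where "m t s = (\<Sum>b\<in>Pow {..<k}. W.P.expectation (G (t, s) b))" for t s
  have m0: "0 \<le> m t s" for t s unfolding m_def by (intro sum_nonneg integral_nonneg) (auto simp: G0)
  have m1: "ennreal (m t s) \<le> bound t (?h s)" if "t < n" "s \<in> S" for t s
  proof -
    have "ennreal (m t s) = (\<Sum>b\<in>Pow {..<k}. ennreal (W.P.expectation (G (t, s) b)))"
      unfolding m_def by (subst sum_ennreal) (auto simp: G0 intro!: integral_nonneg)
    also have "\<dots> = (\<Sum>b\<in>Pow {..<k}. \<integral>\<^sup>+\<psi>. Gn (?h s) t b \<psi> \<partial>W)"
    proof (intro sum.cong refl)
      fix b
      have "integrable W (G (t, s) b)"
        by (rule W.P.integrable_const_bound[of _ "v b"]) (use that Gm G0 G1 in auto)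
      then have "ennreal (W.P.expectation (G (t, s) b)) = (\<integral>\<^sup>+\<psi>. ennreal (G (t, s) b \<psi>) \<partial>W)"
        using G0 by (subst nn_integral_eq_integral) auto
      then show "ennreal (W.P.expectation (G (t, s) b)) = (\<integral>\<^sup>+\<psi>. Gn (?h s) t b \<psi> \<partial>W)"
        by (simp only: G fst_conv snd_conv)
    qed
    also have "\<dots> \<le> bound t (?h s)" by (rule sum_nn_integral_Gn_le[OF that(1) hs[OF that(2)]])
    finally show ?thesis .
  qed
  have me: "enc \<Psi> \<in> PM \<rightarrow>\<^sub>M count_space UNIV" by (rule measurable_enc[OF \<Psi>])
  have sumG: "(\<Sum>b\<in>Pow {..<k}. G (t, s) b (\<Psi> b)) = measure PM {x \<in> space PM. dec \<Psi> (enc \<Psi> x) t \<in> A s}"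
    if t: "t < n" and s: "s \<in> S" for t s
  proof -
    have sets: "{x \<in> space PM. dec \<Psi> (enc \<Psi> x) t \<in> A s} \<in> sets PM"
    proof -
      have "{x \<in> space PM. dec \<Psi> (enc \<Psi> x) t \<in> A s} = enc \<Psi> -` {z. dec \<Psi> z t \<in> A s} \<inter> space PM" by auto
      also have "\<dots> \<in> sets PM" using me by (rule measurable_sets) simp
      finally show ?thesis .
    qed
    have "ennreal (\<Sum>b\<in>Pow {..<k}. G (t, s) b (\<Psi> b)) = (\<Sum>b\<in>Pow {..<k}. Gn (?h s) t b (\<Psi> b))"
      using G0 by (subst sum_ennreal[symmetric]) (auto simp: G)
    also have "\<dots> = (\<integral>\<^sup>+x. ?h s (x t, dec \<Psi> (enc \<Psi> x) t) \<partial>PM)" by (rule sum_Gn[OF t hs[OF s] \<Psi>])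
    also have "\<dots> = (\<integral>\<^sup>+x. indicator {x \<in> space PM. dec \<Psi> (enc \<Psi> x) t \<in> A s} x \<partial>PM)"
      by (intro nn_integral_cong) (auto split: split_indicator)
    also have "\<dots> = ennreal (measure PM {x \<in> space PM. dec \<Psi> (enc \<Psi> x) t \<in> A s})"
      using sets by (simp add: PM.P.emeasure_eq_measure)
    finally show ?thesis by (subst (asm) ennreal_inj) (auto intro!: sum_nonneg simp: G0)
  qed
  have sumF: "(\<Sum>b\<in>Pow {..<k}. F b (\<Psi> b)) = ennreal c * (\<Sum>t<n. \<integral>\<^sup>+x. h (x t, dec \<Psi> (enc \<Psi> x) t) \<partial>PM)"
  proof -
    have "(\<Sum>b\<in>Pow {..<k}. F b (\<Psi> b)) = ennreal c * (\<Sum>t<n. \<Sum>b\<in>Pow {..<k}. Gn h t b (\<Psi> b))"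
      unfolding F_def sum_distrib_left[symmetric] by (subst sum.swap) (rule refl)
    also have "(\<Sum>t<n. \<Sum>b\<in>Pow {..<k}. Gn h t b (\<Psi> b)) = (\<Sum>t<n. \<integral>\<^sup>+x. h (x t, dec \<Psi> (enc \<Psi> x) t) \<partial>PM)"
      by (intro sum.cong refl sum_Gn h \<Psi>) auto
    finally show ?thesis .
  qed
  have intF: "(\<Sum>b\<in>Pow {..<k}. \<integral>\<^sup>+w. F b w \<partial>W) \<le> ennreal c * (\<Sum>t<n. bound t h)"
  proof -
    have "(\<Sum>b\<in>Pow {..<k}. \<integral>\<^sup>+w. F b w \<partial>W) = (\<Sum>b\<in>Pow {..<k}. ennreal c * (\<Sum>t<n. \<integral>\<^sup>+w. Gn h t b w \<partial>W))"
      unfolding F_def using measurable_Gn[OF _ h]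
      by (intro sum.cong refl) (subst nn_integral_cmult, force intro!: borel_measurable_sum, subst nn_integral_sum, auto)
    also have "\<dots> = ennreal c * (\<Sum>t<n. \<Sum>b\<in>Pow {..<k}. \<integral>\<^sup>+w. Gn h t b w \<partial>W)"
      unfolding sum_distrib_left[symmetric] by (subst sum.swap) (rule refl)
    also have "\<dots> \<le> ennreal c * (\<Sum>t<n. bound t h)"
      by (intro mult_left_mono sum_mono sum_nn_integral_Gn_le h) auto
    finally show ?thesis .
  qed
  have "(\<Sum>(t, s)\<in>{..<n} \<times> S. (measure PM {x \<in> space PM. dec \<Psi> (enc \<Psi> x) t \<in> A s} - m t s)\<^sup>2)
    = (\<Sum>i\<in>{..<n} \<times> S. (\<Sum>b\<in>Pow {..<k}. G i b (\<Psi> b) - W.P.expectation (G i b))\<^sup>2)"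
    by (intro sum.cong refl) (auto simp: sum_subtractf sumG m_def)
  note sq = this
  have cs: "real (card ({..<n} \<times> S)) * (\<Sum>b\<in>Pow {..<k}. (v b)\<^sup>2) \<le> real n * card S * p ^ k"
    using mult_left_mono[OF sum_v_squared, of "real n * card S"] by (simp add: card_cartesian_product)
  have "ennreal (\<Sum>(t, s)\<in>{..<n} \<times> S. (measure PM {x \<in> space PM. dec \<Psi> (enc \<Psi> x) t \<in> A s} - m t s)\<^sup>2)
      + ennreal c * (\<Sum>t<n. \<integral>\<^sup>+x. h (x t, dec \<Psi> (enc \<Psi> x) t) \<partial>PM)
    \<le> ennreal (real n * card S * p ^ k) + ennreal c * (\<Sum>t<n. bound t h)"
    unfolding sq using order_trans[OF le[unfolded sumF] add_mono[OF ennreal_leI[OF cs] intF]] .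
  then show ?thesis using me m0 m1 by blast
qed

end

section \<open>Exponents and entropy\<close>

context rejection_code
begin

text \<open>A Chernoff bound for the information density: where the density exceeds
  \<open>L\<close>, the factor \<open>(rn x c / L) powr s\<close> is at least 1. Inserting it bounds
  the tail by a moment, and the moment of a product density is the \<open>n\<close>-th power of the
  single-letter one.\<close>

lemma nn_integral_\<eta>_le:
  assumes s: "0 < s"
  shows "(\<integral>\<^sup>+x. \<eta> x \<partial>PM) \<le> ennreal (L powr (- s)) * (\<integral>\<^sup>+x. \<integral>\<^sup>+y. ennreal (r x y powr (1 + s)) \<partial>q \<partial>M) ^ n"
proof -
  define g where "g x = (\<integral>\<^sup>+y. ennreal (r x y powr (1 + s)) \<partial>q)" for x
  have g: "g \<in> borel_measurable M" unfolding g_def by measurable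
  have rs: "(\<lambda>y. ennreal (r x y powr (1 + s))) \<in> borel_measurable q" for x by measurable
  have \<eta>le: "\<eta> x \<le> ennreal (L powr (- s)) * (\<Prod>t<n. g (x t))" for x
  proof -
    have pt: "ennreal (if L < rn x c then rn x c else 0) \<le> ennreal (L powr (- s)) * (\<Prod>t<n. ennreal (r (x t) (c t) powr (1 + s)))" for c
    proof (cases "L < rn x c")
      case True
      then have r: "0 < rn x c" using L by simp
      have "1 \<le> (rn x c / L) powr s" using True L s by (intro ge_one_powr_ge_zero) auto
      then have "rn x c * 1 \<le> rn x c * (rn x c / L) powr s" using r by (intro mult_left_mono) auto
      also have "\<dots> = L powr (- s) * rn x c powr (1 + s)"
        using r L by (simp add: powr_divide powr_minus powr_add field_simps)
      also have "rn x c powr (1 + s) = (\<Prod>t<n. r (x t) (c t) powr (1 + s))"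
        unfolding rn_def by (subst prod_powr_distrib) (auto simp: r0)
      finally have "ennreal (rn x c) \<le> ennreal (L powr (- s) * (\<Prod>t<n. r (x t) (c t) powr (1 + s)))"
        by (intro ennreal_leI) simp
      then show ?thesis using True by (simp add: ennreal_mult prod_nonneg prod_ennreal)
    qed simp
    have "\<eta> x \<le> (\<integral>\<^sup>+c. ennreal (L powr (- s)) * (\<Prod>t<n. ennreal (r (x t) (c t) powr (1 + s))) \<partial>Q)"
      unfolding \<eta>_def by (intro nn_integral_mono pt)
    also have "\<dots> = ennreal (L powr (- s)) * (\<integral>\<^sup>+c. (\<Prod>t<n. ennreal (r (x t) (c t) powr (1 + s))) \<partial>Q)"
    proof (rule nn_integral_cmult, rule borel_measurable_prod_ennreal)
      fix t assume "t \<in> {..<n}"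
      then have "(\<lambda>c. c t) \<in> Q \<rightarrow>\<^sub>M q" by (rule measurable_component_singleton)
      from measurable_compose[OF this rs] show "(\<lambda>c. ennreal (r (x t) (c t) powr (1 + s))) \<in> borel_measurable Q" .
    qed
    also have "(\<integral>\<^sup>+c. (\<Prod>t<n. ennreal (r (x t) (c t) powr (1 + s))) \<partial>Q) = (\<Prod>t<n. g (x t))"
      unfolding g_def by (rule Q.product_nn_integral_prod[OF finite_lessThan rs])
    finally show ?thesis .
  qed
  have "(\<integral>\<^sup>+x. \<eta> x \<partial>PM) \<le> (\<integral>\<^sup>+x. ennreal (L powr (- s)) * (\<Prod>t<n. g (x t)) \<partial>PM)"
    by (intro nn_integral_mono \<eta>le)
  also have "\<dots> = ennreal (L powr (- s)) * (\<integral>\<^sup>+x. (\<Prod>t<n. g (x t)) \<partial>PM)"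
  proof (rule nn_integral_cmult, rule borel_measurable_prod_ennreal)
    fix t assume "t \<in> {..<n}"
    then have "(\<lambda>c. c t) \<in> PM \<rightarrow>\<^sub>M M" by (rule measurable_component_singleton)
    from measurable_compose[OF this g] show "(\<lambda>c. g (c t)) \<in> borel_measurable PM" .
  qed
  also have "(\<integral>\<^sup>+x. (\<Prod>t<n. g (x t)) \<partial>PM) = (\<integral>\<^sup>+x. g x \<partial>M) ^ n"
    using PM.product_nn_integral_prod[OF finite_lessThan g, of n] by simp
  finally show ?thesis unfolding g_def .
qed

end

text \<open>Gibbs' inequality against the weight \<open>1 / m\<close> at each point, from
  \<open>ln s \<le> s - 1\<close>. An upper bound \<open>m\<close> for the cardinality spares an
  exact count of the codes.\<close>

lemma entropy_disc_le_log_card: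
  fixes f :: "'b \<Rightarrow> nat"
  assumes N: "prob_space N" and f: "f \<in> N \<rightarrow>\<^sub>M count_space UNIV"
    and A: "finite A" "\<And>x. x \<in> space N \<Longrightarrow> f x \<in> A" and m: "real (card A) \<le> m"
  shows "entropy_disc N f \<le> ennreal (log 2 m)"
proof -
  interpret prob_space N by fact
  define p where "p z = measure N (f -` {z} \<inter> space N)" for z
  have p0: "0 \<le> p z" "p z \<le> 1" for z by (auto simp: p_def)
  have A0: "A \<noteq> {}" using A(2) not_empty by auto
  then have m0: "1 \<le> m" using m A(1) by (metis One_nat_def Suc_leI card_gt_0_iff of_nat_1 of_nat_le_iff order_trans)
  have sum1: "(\<Sum>z\<in>A. p z) = 1"
  proof -
    have "(\<Sum>z\<in>A. p z) = measure N (\<Union>z\<in>A. f -` {z} \<inter> space N)"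
      unfolding p_def using A(1) measurable_sets[OF f]
      by (intro measure_finite_Union[symmetric]) (auto simp: disjoint_family_on_def emeasure_eq_measure)
    also have "(\<Union>z\<in>A. f -` {z} \<inter> space N) = space N" using A(2) by auto
    finally show ?thesis by (simp add: prob_space)
  qed
  have out: "p z = 0" if "z \<notin> A" for z
  proof -
    have "f -` {z} \<inter> space N = {}" using that A(2) by auto
    then show ?thesis by (simp add: p_def)
  qed
  have nn: "0 \<le> - (p z * log 2 (p z))" for z
    using p0[of z] by (cases "p z = 0") (auto simp: mult_nonneg_nonpos)
  have pt: "- (p z * ln (p z)) \<le> p z * ln m + (1 / m - p z)" for z
  proof (cases "p z = 0")
    case True
    then show ?thesis using m0 by simp
  next
    case False
    then have pz: "0 < p z" using p0[of z] by simp
    have "ln (1 / (m * p z)) \<le> 1 / (m * p z) - 1" using pz m0 by (intro ln_le_minus_one) auto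
    then have "p z * ln (1 / (m * p z)) \<le> p z * (1 / (m * p z) - 1)" using pz by (intro mult_left_mono) auto
    also have "\<dots> = 1 / m - p z" using pz m0 by (simp add: field_simps)
    finally show ?thesis using pz m0 by (simp add: ln_div ln_mult algebra_simps)
  qed
  have "(\<Sum>z\<in>A. - (p z * ln (p z))) \<le> (\<Sum>z\<in>A. p z * ln m + (1 / m - p z))"
    by (intro sum_mono pt)
  also have "\<dots> = ln m + (card A / m - 1)"
    by (simp add: sum.distrib sum_subtractf sum1 flip: sum_distrib_right)
  also have "\<dots> \<le> ln m" using m m0 by (simp add: field_simps)
  finally have "(\<Sum>z\<in>A. - (p z * ln (p z))) / ln 2 \<le> ln m / ln 2" by (intro divide_right_mono) auto
  moreover have "(\<Sum>z\<in>A. - (p z * log 2 (p z))) = (\<Sum>z\<in>A. - (p z * ln (p z))) / ln 2"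
    unfolding sum_divide_distrib by (simp add: log_def)
  ultimately have le: "(\<Sum>z\<in>A. - (p z * log 2 (p z))) \<le> log 2 m"
    by (simp add: log_def)
  have "entropy_disc N f = (\<Sum>z. ennreal (- (p z * log 2 (p z))))"
    by (simp add: entropy_disc_def p_def)
  also have "\<dots> = (\<Sum>z\<in>A. ennreal (- (p z * log 2 (p z))))"
    by (rule suminf_finite[OF A(1)]) (simp add: out)
  also have "\<dots> = ennreal (\<Sum>z\<in>A. - (p z * log 2 (p z)))"
    by (intro sum_ennreal nn)
  also have "\<dots> \<le> ennreal (log 2 m)" by (intro ennreal_leI le)
  finally show ?thesis .
qed

section \<open>Moments of a bounded density near exponent 1\<close>

lemma exp_le_quadratic:
  fixes y :: real assumes "y \<le> 1"
  shows "exp y \<le> 1 + y + y\<^sup>2"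
proof (cases "0 \<le> y")
  case True
  then show ?thesis using assms by (intro exp_bound)
next
  case False
  have "1 - y \<le> exp (- y)" using exp_ge_add_one_self[of "- y"] by simp
  then have "exp y \<le> 1 / (1 - y)" using False by (simp add: exp_minus field_simps)
  also have "\<dots> \<le> 1 + y + y\<^sup>2"
  proof -
    have "1 \<le> (1 + y + y\<^sup>2) * (1 - y)"
    proof -
      have "(1 + y + y\<^sup>2) * (1 - y) = 1 - y ^ 3" by (simp add: algebra_simps power2_eq_square power3_eq_cube)
      moreover have "y ^ 3 \<le> 0" using False by (simp add: power3_eq_cube mult_nonneg_nonpos mult_nonpos_nonpos)
      ultimately show ?thesis by simp
    qed
    then show ?thesis using False by (simp add: field_simps)
  qed
  finally show ?thesis .
qed

text \<open>The left side stays bounded near 0: with \<open>u = 1 / sqrt t\<close>, the inequality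
  \<open>ln u \<le> u\<close> gives \<open>(ln t)^2 \<le> 4 / t\<close>. This is the origin of the
  constant 4; above 1 the function is increasing.\<close>

lemma mult_ln_squared_le:
  fixes t B :: real
  assumes "0 < t" "t \<le> B" "1 \<le> B"
  shows "t * (ln t)\<^sup>2 \<le> 4 + B * (ln B)\<^sup>2"
proof (cases "1 \<le> t")
  case True
  have "t * (ln t)\<^sup>2 \<le> B * (ln B)\<^sup>2"
    using True assms by (intro mult_mono power_mono) auto
  then show ?thesis by simp
next
  case False
  define u where "u = 1 / sqrt t"
  have u: "1 \<le> u" using False assms by (simp add: u_def)
  have "ln t = - 2 * ln u" using assms by (simp add: u_def ln_div ln_sqrt)
  then have "(ln t)\<^sup>2 = 4 * (ln u)\<^sup>2" by (simp add: power2_eq_square)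
  also have "\<dots> \<le> 4 * u\<^sup>2" using u ln_le_minus_one[of u] by (intro mult_left_mono power_mono) auto
  also have "u\<^sup>2 = 1 / t" using assms by (simp add: u_def power_divide)
  finally have "(ln t)\<^sup>2 \<le> 4 * (1 / t)" .
  from mult_left_mono[OF this, of t] have "t * (ln t)\<^sup>2 \<le> 4" using assms by simp
  then show ?thesis using assms by (smt (verit) mult_nonneg_nonneg zero_le_power2)
qed

text \<open>Second-order expansion of \<open>t powr (1 + s)\<close> in \<open>s\<close>: the
  derivative \<open>t * ln t\<close> equals \<open>ln 2 * kl_fun t + t - 1\<close>, and the
  remainder is uniform for \<open>t \<le> B\<close>. The term \<open>s\<close> stands on the left so
  that the inequality can be integrated in \<open>ennreal\<close> without subtraction.\<close>

lemma powr_one_plus_le: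
  assumes t: "0 \<le> t" "t \<le> B" and B: "1 \<le> B" and s: "0 < s" "s * ln B \<le> 1"
  shows "t powr (1 + s) + s \<le> (1 + s) * t + s * (ln 2 * kl_fun t) + s\<^sup>2 * (4 + B * (ln B)\<^sup>2)"
proof (cases "t = 0")
  case True
  then show ?thesis using s B by (simp add: kl_fun_def)
next
  case False
  then have t0: "0 < t" using t by simp
  have "s * ln t \<le> s * ln B" using t0 t s by (intro mult_left_mono) auto
  then have "exp (s * ln t) \<le> 1 + s * ln t + (s * ln t)\<^sup>2" using s(2) by (intro exp_le_quadratic) linarith
  then have "t * exp (s * ln t) \<le> t * (1 + s * ln t + (s * ln t)\<^sup>2)" using t0 by (intro mult_left_mono) auto
  also have "\<dots> = t + s * (t * ln t) + s\<^sup>2 * (t * (ln t)\<^sup>2)" by (simp add: algebra_simps power_mult_distrib)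
  also have "\<dots> \<le> t + s * (t * ln t) + s\<^sup>2 * (4 + B * (ln B)\<^sup>2)"
    using mult_ln_squared_le[OF t0 t(2) B] by (intro add_left_mono mult_left_mono) auto
  finally have "t powr (1 + s) \<le> t + s * (t * ln t) + s\<^sup>2 * (4 + B * (ln B)\<^sup>2)"
    using t0 by (simp add: powr_def distrib_right exp_add)
  moreover have e: "ln 2 * kl_fun t = t * ln t - (t - 1)" using t0 by (simp add: kl_fun_def log_def field_simps)
  ultimately show ?thesis unfolding e by (simp add: algebra_simps)
qed

text \<open>At \<open>s = 0\<close> the moment is 1 and its derivative is at most
  \<open>I * ln 2\<close>; as the density is bounded, the second-order remainder is uniform, and a
  small \<open>s\<close> leaves room for \<open>\<delta>\<close>.\<close>

lemma ex_powr_integral_le_exp: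
  fixes r :: "'a \<Rightarrow> 'b \<Rightarrow> real"
  assumes M: "prob_space M" and q: "prob_space q"
    and [measurable]: "case_prod r \<in> borel_measurable (M \<Otimes>\<^sub>M q)"
    and r: "\<And>x y. 0 \<le> r x y" "\<And>x y. r x y \<le> B" and B: "1 \<le> B"
    and r1: "\<And>x. x \<in> space M \<Longrightarrow> (\<integral>\<^sup>+y. ennreal (r x y) \<partial>q) = 1"
    and I: "(\<integral>\<^sup>+x. \<integral>\<^sup>+y. ennreal (kl_fun (r x y)) \<partial>q \<partial>M) \<le> ennreal I" "0 \<le> I" and \<delta>: "0 < \<delta>"
  shows "\<exists>s>0. (\<integral>\<^sup>+x. \<integral>\<^sup>+y. ennreal (r x y powr (1 + s)) \<partial>q \<partial>M) \<le> ennreal (exp (s * (I * ln 2 + \<delta>)))"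
proof -
  interpret M: prob_space M by fact
  interpret q: prob_space q by fact
  define C where "C = 4 + B * (ln B)\<^sup>2"
  have C: "0 < C" using B by (auto simp: C_def intro: add_pos_nonneg)
  \<comment> \<open>The first bound absorbs the remainder \<open>s\<^sup>2 * C\<close> into
    \<open>s * \<delta>\<close>; the second gives \<open>s * ln B \<le> 1\<close>, the range in
    which the quadratic bound for \<open>exp\<close> holds.\<close>
  define s where "s = min (\<delta> / C) (1 / (1 + ln B))"
  have lB: "0 \<le> ln B" using B by simp
  have s: "0 < s" "s * C \<le> \<delta>" "s * ln B \<le> 1"
  proof -
    show "0 < s" using \<delta> C lB by (simp add: s_def)
    have "s * C \<le> \<delta> / C * C" using C by (intro mult_right_mono) (auto simp: s_def)
    then show "s * C \<le> \<delta>" using C by simp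
    have "s * ln B \<le> 1 / (1 + ln B) * ln B" using lB by (intro mult_right_mono) (auto simp: s_def)
    also have "\<dots> \<le> 1" using lB by (simp add: field_simps)
    finally show "s * ln B \<le> 1" .
  qed
  let ?X = "\<integral>\<^sup>+x. \<integral>\<^sup>+y. ennreal (r x y powr (1 + s)) \<partial>q \<partial>M"
  have rx: "(\<lambda>y. u (r x y)) \<in> borel_measurable q" if "x \<in> space M" "u \<in> borel_measurable borel" for x and u :: "real \<Rightarrow> ennreal"
    using measurable_compose[OF measurable_compose[OF measurable_Pair1'[OF that(1)] assms(3)] that(2)] by simp
  have rm: "(\<lambda>x. \<integral>\<^sup>+y. u (r x y) \<partial>q) \<in> borel_measurable M" if [measurable]: "u \<in> borel_measurable borel" for u :: "real \<Rightarrow> ennreal"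
    by measurable
  have add: "(\<integral>\<^sup>+x. \<integral>\<^sup>+y. u (r x y) + w (r x y) \<partial>q \<partial>M) = (\<integral>\<^sup>+x. \<integral>\<^sup>+y. u (r x y) \<partial>q \<partial>M) + (\<integral>\<^sup>+x. \<integral>\<^sup>+y. w (r x y) \<partial>q \<partial>M)"
    if u: "u \<in> borel_measurable borel" and w: "w \<in> borel_measurable borel" for u w :: "real \<Rightarrow> ennreal"
    unfolding nn_integral_add[OF rm[OF u] rm[OF w], symmetric]
    by (intro nn_integral_cong nn_integral_add rx u w)
  have cmult: "(\<integral>\<^sup>+x. \<integral>\<^sup>+y. c * u (r x y) \<partial>q \<partial>M) = c * (\<integral>\<^sup>+x. \<integral>\<^sup>+y. u (r x y) \<partial>q \<partial>M)"
    if u: "u \<in> borel_measurable borel" for u :: "real \<Rightarrow> ennreal" and c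
    unfolding nn_integral_cmult[OF rm[OF u], symmetric]
    by (intro nn_integral_cong nn_integral_cmult rx u)
  have const: "(\<integral>\<^sup>+x. \<integral>\<^sup>+y. c \<partial>q \<partial>M) = c" for c
    by (simp add: q.emeasure_space_1 M.emeasure_space_1)
  have "?X + ennreal s = (\<integral>\<^sup>+x. \<integral>\<^sup>+y. ennreal (r x y powr (1 + s)) + ennreal s \<partial>q \<partial>M)"
    by (subst add[of "\<lambda>t. ennreal (t powr (1 + s))" "\<lambda>_. ennreal s"]) (simp_all only: const, simp_all)
  also have "\<dots> \<le> (\<integral>\<^sup>+x. \<integral>\<^sup>+y. ennreal (1 + s) * ennreal (r x y) + ennreal (s * ln 2) * ennreal (kl_fun (r x y)) + ennreal (s\<^sup>2 * C) \<partial>q \<partial>M)"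
  proof (intro nn_integral_mono)
    fix x y
    have k: "0 \<le> kl_fun (r x y)" by (intro kl_fun_nonneg r)
    have "r x y powr (1 + s) + s \<le> (1 + s) * r x y + s * (ln 2 * kl_fun (r x y)) + s\<^sup>2 * C"
      unfolding C_def using s r B by (intro powr_one_plus_le) auto
    then have "ennreal (r x y powr (1 + s) + s) \<le> ennreal ((1 + s) * r x y + (s * ln 2) * kl_fun (r x y) + s\<^sup>2 * C)"
      by (intro ennreal_leI) (simp add: mult.assoc)
    also have "\<dots> = ennreal (1 + s) * ennreal (r x y) + ennreal (s * ln 2) * ennreal (kl_fun (r x y)) + ennreal (s\<^sup>2 * C)"
    proof -
      have "0 \<le> (1 + s) * r x y" "0 \<le> (s * ln 2) * kl_fun (r x y)" "0 \<le> s\<^sup>2 * C"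
        using s(1) r(1)[of x y] k C by auto
      then have "ennreal ((1 + s) * r x y + (s * ln 2) * kl_fun (r x y) + s\<^sup>2 * C)
        = ennreal ((1 + s) * r x y) + ennreal ((s * ln 2) * kl_fun (r x y)) + ennreal (s\<^sup>2 * C)"
        by (simp only: ennreal_plus add_nonneg_nonneg)
      also have "ennreal ((1 + s) * r x y) = ennreal (1 + s) * ennreal (r x y)"
        using s(1) r(1) by (intro ennreal_mult) auto
      also have "ennreal ((s * ln 2) * kl_fun (r x y)) = ennreal (s * ln 2) * ennreal (kl_fun (r x y))"
        using s(1) k by (intro ennreal_mult) auto
      finally show ?thesis .
    qed
    finally show "ennreal (r x y powr (1 + s)) + ennreal s
      \<le> ennreal (1 + s) * ennreal (r x y) + ennreal (s * ln 2) * ennreal (kl_fun (r x y)) + ennreal (s\<^sup>2 * C)"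
      using s(1) by (simp add: ennreal_plus)
  qed
  also have "\<dots> = ennreal (1 + s) * (\<integral>\<^sup>+x. \<integral>\<^sup>+y. ennreal (r x y) \<partial>q \<partial>M)
      + ennreal (s * ln 2) * (\<integral>\<^sup>+x. \<integral>\<^sup>+y. ennreal (kl_fun (r x y)) \<partial>q \<partial>M) + ennreal (s\<^sup>2 * C)"
    by (subst add[of "\<lambda>t. ennreal (1 + s) * ennreal t + ennreal (s * ln 2) * ennreal (kl_fun t)" "\<lambda>_. ennreal (s\<^sup>2 * C)"],
        measurable, subst add[of "\<lambda>t. ennreal (1 + s) * ennreal t" "\<lambda>t. ennreal (s * ln 2) * ennreal (kl_fun t)"],
        measurable, subst cmult[of "\<lambda>t. ennreal t"], measurable, subst cmult[of "\<lambda>t. ennreal (kl_fun t)"], measurable)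
       (simp only: const)
  also have "(\<integral>\<^sup>+x. \<integral>\<^sup>+y. ennreal (r x y) \<partial>q \<partial>M) = (\<integral>\<^sup>+x. 1 \<partial>M)"
    by (intro nn_integral_cong r1)
  also have "ennreal (1 + s) * (\<integral>\<^sup>+x. 1 \<partial>M) + ennreal (s * ln 2) * (\<integral>\<^sup>+x. \<integral>\<^sup>+y. ennreal (kl_fun (r x y)) \<partial>q \<partial>M) + ennreal (s\<^sup>2 * C)
      \<le> ennreal (1 + s) * 1 + ennreal (s * ln 2) * ennreal I + ennreal (s\<^sup>2 * C)"
    by (intro add_mono mult_left_mono I) (auto simp: M.emeasure_space_1)
  also have "\<dots> = ennreal (1 + s * ln 2 * I + s\<^sup>2 * C) + ennreal s"
    using s(1) I(2) C by (simp add: ennreal_mult[symmetric] flip: ennreal_plus)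
  finally have "ennreal s + ?X \<le> ennreal s + ennreal (1 + s * ln 2 * I + s\<^sup>2 * C)" by (simp only: add.commute)
  then have "?X \<le> ennreal (1 + s * ln 2 * I + s\<^sup>2 * C)"
    by (subst (asm) ennreal_add_left_cancel_le) simp
  also have "1 + s * ln 2 * I + s\<^sup>2 * C \<le> 1 + s * (I * ln 2 + \<delta>)"
    using mult_left_mono[OF s(2), of s] s(1) by (simp add: algebra_simps power2_eq_square)
  also have "\<dots> \<le> exp (s * (I * ln 2 + \<delta>))"
    by (rule exp_ge_add_one_self)
  finally show ?thesis
    using s(1) by (intro exI[of _ s]) (auto simp: ennreal_leI)
qed

section \<open>Laws on a finite set and the divergence near a given one\<close>

lemma emeasure_finite_support:
  fixes \<nu> :: "'a::polish_space measure"
  assumes \<nu>: "prob_meas \<nu>" and S: "finite S" "emeasure \<nu> S = 1" and A: "A \<in> sets borel"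
  shows "emeasure \<nu> A = (\<Sum>s\<in>S. ennreal (measure \<nu> {s}) * indicator A s)"
proof -
  interpret prob_space \<nu> by (rule prob_measD[OF \<nu>])
  have Sb: "S \<in> sets \<nu>" using S prob_measD(2)[OF \<nu>] by (auto intro: borel_closed finite_imp_closed)
  have AE: "AE y in \<nu>. y \<in> S"
    using S(2) by (subst prob_eq_1[symmetric]) (auto simp: Sb emeasure_eq_measure)
  have "emeasure \<nu> A = (\<integral>\<^sup>+y. indicator A y \<partial>\<nu>)"
    using A prob_measD(2)[OF \<nu>] by simp
  also have "\<dots> = (\<integral>\<^sup>+c. indicator A c * emeasure \<nu> {c} \<partial>count_space S)"
    using A S by (intro nn_integral_countable_support prob_measD[OF \<nu>] AE) (auto intro: countable_finite)
  also have "\<dots> = (\<Sum>s\<in>S. ennreal (measure \<nu> {s}) * indicator A s)"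
    using S by (subst nn_integral_count_space_finite) (auto simp: emeasure_eq_measure mult.commute)
  finally show ?thesis .
qed

lemma prob_meas_return: "prob_meas (return borel s)"
  by (simp add: prob_meas_def prob_space_return)

lemma sum_measure_singletons:
  fixes \<nu> :: "'a::polish_space measure"
  assumes \<nu>: "prob_meas \<nu>" and S: "finite S" "emeasure \<nu> S = 1"
  shows "(\<Sum>s\<in>S. measure \<nu> {s}) = 1"
proof -
  have "S \<in> sets borel" using S by (auto intro: borel_closed finite_imp_closed)
  from emeasure_finite_support[OF \<nu> S this] S(2)
  have "ennreal (\<Sum>s\<in>S. measure \<nu> {s}) = 1"
    by (subst sum_ennreal[symmetric]) auto
  then show ?thesis by simp
qed

text \<open>The excess of \<open>\<gamma>\<close> over \<open>(1 - l) * q\<close>, divided by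
  \<open>l\<close>, is again a law on \<open>S\<close>, hence a mixture of point masses with
  \<open>\<phi>\<close> at most \<open>c\<close>. Convexity thus takes the place of
  continuity.\<close>

lemma mix_convex_near:
  assumes \<phi>: "mix_convex \<phi>" and q: "prob_meas q" and \<gamma>: "prob_meas \<gamma>"
    and S: "finite S" "emeasure q S = 1" "emeasure \<gamma> S = 1"
    and l: "0 < l" "l \<le> 1" and c: "\<And>s. s \<in> S \<Longrightarrow> \<phi> (return borel s) \<le> c"
    and ge: "\<And>s. s \<in> S \<Longrightarrow> (1 - l) * measure q {s} \<le> measure \<gamma> {s}"
  shows "\<phi> \<gamma> \<le> ennreal (1 - l) * \<phi> q + ennreal l * c"
proof -
  define w where "w s = (measure \<gamma> {s} - (1 - l) * measure q {s}) / l" for s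
  have w0: "0 \<le> w s" if "s \<in> S" for s using ge[OF that] l by (simp add: w_def)
  have w1: "sum w S = 1"
    unfolding w_def sum_divide_distrib[symmetric] sum_subtractf sum_distrib_left[symmetric]
      sum_measure_singletons[OF q S(1,2)] sum_measure_singletons[OF \<gamma> S(1,3)]
    using l by simp
  from mix_convex_ex_finite_mixture[of \<phi> S "return borel" c w] \<phi> S(1) c w0 w1 prob_meas_return
  obtain \<sigma> where \<sigma>: "prob_meas \<sigma>" "\<phi> \<sigma> \<le> c"
    "\<And>A. A \<in> sets borel \<Longrightarrow> emeasure \<sigma> A = (\<Sum>s\<in>S. ennreal (w s) * emeasure (return borel s) A)" by blast
  have "\<gamma> = mix (1 - l) q \<sigma>"
  proof (rule prob_meas_eqI[OF \<gamma>])
    show "prob_meas (mix (1 - l) q \<sigma>)" using l by (intro prob_meas_mix q \<sigma>) auto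
    fix A :: "'a set" assume A: "A \<in> sets borel"
    have "emeasure (mix (1 - l) q \<sigma>) A = ennreal (1 - l) * (\<Sum>s\<in>S. ennreal (measure q {s}) * indicator A s)
        + ennreal l * (\<Sum>s\<in>S. ennreal (w s) * indicator A s)"
      using A by (simp add: emeasure_mix[OF q \<sigma>(1)] emeasure_finite_support[OF q S(1,2)] \<sigma>(3))
    also have "\<dots> = (\<Sum>s\<in>S. (ennreal (1 - l) * ennreal (measure q {s}) + ennreal l * ennreal (w s)) * indicator A s)"
      by (simp add: sum_distrib_left sum.distrib distrib_right mult.assoc)
    also have "\<dots> = (\<Sum>s\<in>S. ennreal (measure \<gamma> {s}) * indicator A s)"
    proof (intro sum.cong refl arg_cong2[where f = "(*)"])
      fix s assume s: "s \<in> S"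
      have "ennreal (1 - l) * ennreal (measure q {s}) + ennreal l * ennreal (w s) = ennreal ((1 - l) * measure q {s} + l * w s)"
        using l w0[OF s] by (simp add: ennreal_mult)
      also have "(1 - l) * measure q {s} + l * w s = measure \<gamma> {s}" using l by (simp add: w_def)
      finally show "ennreal (1 - l) * ennreal (measure q {s}) + ennreal l * ennreal (w s) = ennreal (measure \<gamma> {s})" .
    qed
    also have "\<dots> = emeasure \<gamma> A" by (rule emeasure_finite_support[OF \<gamma> S(1,3) A, symmetric])
    finally show "emeasure \<gamma> A = emeasure (mix (1 - l) q \<sigma>) A" ..
  qed
  moreover have "\<phi> (mix (1 - l) q \<sigma>) \<le> ennreal (1 - l) * \<phi> q + ennreal (1 - (1 - l)) * \<phi> \<sigma>"
    using l by (intro mix_convexD \<phi> q \<sigma>) auto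
  moreover have "ennreal (1 - (1 - l)) * \<phi> \<sigma> \<le> ennreal l * c"
    using \<sigma>(2) by (auto intro: mult_left_mono)
  ultimately show ?thesis by (metis add_left_mono order_trans)
qed

text \<open>Both laws have total mass 1 on \<open>S\<close>, so upper bounds at the other points
  become a lower bound at \<open>s\<close>. The coding argument supplies estimates from above
  only.\<close>

lemma measure_ge_of_le:
  fixes l \<zeta> :: real and q \<gamma> :: "'a::polish_space measure"
  assumes q: "prob_meas q" and \<gamma>: "prob_meas \<gamma>"
    and S: "finite S" "emeasure q S = 1" "emeasure \<gamma> S = 1" and s: "s \<in> S"
    and le: "\<And>s. s \<in> S \<Longrightarrow> measure \<gamma> {s} \<le> measure q {s} + \<zeta>" and \<zeta>: "0 \<le> \<zeta>"
    and l: "card S * \<zeta> \<le> l * measure q {s}"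
  shows "(1 - l) * measure q {s} \<le> measure \<gamma> {s}"
proof -
  have "(\<Sum>s\<in>S - {s}. measure \<gamma> {s}) \<le> (\<Sum>s\<in>S - {s}. measure q {s} + \<zeta>)"
    using le by (intro sum_mono) auto
  also have "\<dots> = (\<Sum>s\<in>S - {s}. measure q {s}) + card (S - {s}) * \<zeta>"
    by (simp add: sum.distrib)
  also have "card (S - {s}) * \<zeta> \<le> card S * \<zeta>"
    using \<zeta> S(1) by (intro mult_right_mono) (auto intro: card_mono)
  finally have "(\<Sum>s\<in>S - {s}. measure \<gamma> {s}) \<le> (\<Sum>s\<in>S - {s}. measure q {s}) + card S * \<zeta>" by simp
  moreover have "measure \<gamma> {s} + (\<Sum>s\<in>S - {s}. measure \<gamma> {s}) = 1" "measure q {s} + (\<Sum>s\<in>S - {s}. measure q {s}) = 1"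
    using sum.remove[OF S(1) s, of "\<lambda>s. measure \<gamma> {s}"] sum.remove[OF S(1) s, of "\<lambda>s. measure q {s}"]
      sum_measure_singletons[OF \<gamma> S(1,3)] sum_measure_singletons[OF q S(1,2)] by auto
  ultimately have "measure q {s} - l * measure q {s} \<le> measure \<gamma> {s}" using l by linarith
  then show ?thesis by (simp add: algebra_simps)
qed

text \<open>At each atom \<open>s\<close> the density is at most the reciprocal of the output mass
  of \<open>s\<close>. \<open>kdens\<close> has total mass 1 only for almost every \<open>x\<close>,
  whereas rejection coding asks for it everywhere; exceptional inputs get the constant density 1,
  that is, output drawn from the output law. As they form a null set, no integral over the source
  changes.\<close>

lemma ex_bounded_density:
  fixes M :: "'a::polish_space measure"
  assumes M: "prob_meas M" and K: "markov_kernel K"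
    and S: "finite S" "emeasure (outlaw M K) S = 1" "\<And>s. s \<in> S \<Longrightarrow> 0 < emeasure (outlaw M K) {s}"
  obtains r B where "case_prod r \<in> borel_measurable (borel \<Otimes>\<^sub>M borel)" "\<And>x y. 0 \<le> r x y" "\<And>x y. r x y \<le> B" "1 \<le> B"
    "\<And>x. (\<integral>\<^sup>+y. ennreal (r x y) \<partial>outlaw M K) = 1"
    "\<And>h. h \<in> borel_measurable (borel \<Otimes>\<^sub>M borel) \<Longrightarrow>
       (\<integral>\<^sup>+x. \<integral>\<^sup>+y. ennreal (r x y) * h (x, y) \<partial>outlaw M K \<partial>M) = (\<integral>\<^sup>+x. \<integral>\<^sup>+y. h (x, y) \<partial>K x \<partial>M)"
    "(\<integral>\<^sup>+x. \<integral>\<^sup>+y. ennreal (kl_fun (r x y)) \<partial>outlaw M K \<partial>M) = mutual_info M K"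
proof -
  let ?q = "outlaw M K"
  have q: "prob_meas ?q" by (rule prob_meas_outlaw[OF M K])
  interpret q: prob_space ?q by (rule prob_measD[OF q])
  have [measurable_cong]: "sets M = sets borel" "sets ?q = sets borel"
    using prob_measD[OF q] prob_measD[OF M] by auto
  note measurable_kdens[OF M K, measurable]
  have Sb: "S \<in> sets ?q" using S prob_measD(2)[OF q] by (auto intro: borel_closed finite_imp_closed)
  have AES: "AE y in ?q. y \<in> S"
    using S(2) by (subst q.prob_eq_1[symmetric]) (auto simp: Sb q.emeasure_eq_measure)
  have Sc: "countable S" using S(1) by (rule countable_finite)
  define good where "good x \<longleftrightarrow> (\<integral>\<^sup>+y. ennreal (kdens M K x y) \<partial>?q) = 1" for x
  have [measurable]: "Measurable.pred borel good" unfolding good_def by measurable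
  define r where "r x y = (if good x then kdens M K x y else 1)" for x y
  have rm: "case_prod r \<in> borel_measurable (borel \<Otimes>\<^sub>M borel)"
    unfolding r_def by measurable
  have AEg: "AE x in M. (\<forall>h\<in>borel_measurable borel. (\<integral>\<^sup>+y. h y \<partial>K x) = (\<integral>\<^sup>+y. ennreal (kdens M K x y) * h y \<partial>?q)) \<and> r x = kdens M K x"
    using nn_integral_kernel_kdens[OF M K Sc AES]
  proof eventually_elim
    fix x assume *: "\<forall>h\<in>borel_measurable borel. (\<integral>\<^sup>+y. h y \<partial>K x) = (\<integral>\<^sup>+y. ennreal (kdens M K x y) * h y \<partial>?q)"
    interpret k: prob_space "K x" by (rule prob_measD[OF markov_kernelD(2)[OF K]])
    have "good x" unfolding good_def using bspec[OF *, of "\<lambda>_. 1"] by (simp add: k.emeasure_space_1)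
    then show "(\<forall>h\<in>borel_measurable borel. (\<integral>\<^sup>+y. h y \<partial>K x) = (\<integral>\<^sup>+y. ennreal (kdens M K x y) * h y \<partial>?q)) \<and> r x = kdens M K x"
      using * by (auto simp: r_def)
  qed
  \<comment> \<open>The sum dominates each reciprocal mass, and the summand 1 covers the constant
    density.\<close>
  define B where "B = 1 + (\<Sum>s\<in>S. 1 / measure ?q {s})"
  have B: "1 \<le> B" unfolding B_def by (simp add: sum_nonneg)
  have rB: "r x y \<le> B" for x y
  proof (cases "good x \<and> y \<in> S")
    case True
    interpret k: prob_space "K x" by (rule prob_measD[OF markov_kernelD(2)[OF K]])
    have "r x y \<le> 1 / measure ?q {y}"
      using True by (auto simp: r_def kdens_def intro!: divide_right_mono)
    also have "\<dots> \<le> (\<Sum>s\<in>S. 1 / measure ?q {s})"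
      using True S(1) by (intro member_le_sum) auto
    finally show ?thesis by (simp add: B_def)
  next
    case False
    have "measure ?q {y} = 0" if "y \<notin> S"
    proof -
      have "AE y' in ?q. y' \<notin> {y}" using AES by eventually_elim (use that in auto)
      then have "emeasure ?q {y} = 0"
        using prob_measD[OF q] by (subst (asm) AE_iff_measurable[of "{y}"]) auto
      then show ?thesis by (simp add: measure_def)
    qed
    then have "r x y \<le> 1" using False by (auto simp: r_def kdens_def)
    then show ?thesis using B by simp
  qed
  show thesis
  proof (rule that[of r B])
    show "0 \<le> r x y" for x y by (simp add: r_def kdens_nonneg)
    show "(\<integral>\<^sup>+y. ennreal (r x y) \<partial>?q) = 1" for x
      by (cases "good x") (simp_all add: r_def q.emeasure_space_1, simp add: good_def)
    show "(\<integral>\<^sup>+x. \<integral>\<^sup>+y. ennreal (r x y) * h (x, y) \<partial>?q \<partial>M) = (\<integral>\<^sup>+x. \<integral>\<^sup>+y. h (x, y) \<partial>K x \<partial>M)"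
      if [measurable]: "h \<in> borel_measurable (borel \<Otimes>\<^sub>M borel)" for h
    proof (rule nn_integral_cong_AE, use AEg in eventually_elim)
      fix x assume *: "(\<forall>h\<in>borel_measurable borel. (\<integral>\<^sup>+y. h y \<partial>K x) = (\<integral>\<^sup>+y. ennreal (kdens M K x y) * h y \<partial>?q)) \<and> r x = kdens M K x"
      have "(\<lambda>y. h (x, y)) \<in> borel_measurable borel" by measurable
      with * show "(\<integral>\<^sup>+y. ennreal (r x y) * h (x, y) \<partial>?q) = (\<integral>\<^sup>+y. h (x, y) \<partial>K x)" by auto
    qed
    show "(\<integral>\<^sup>+x. \<integral>\<^sup>+y. ennreal (kl_fun (r x y)) \<partial>?q \<partial>M) = mutual_info M K"
      unfolding mutual_info_eq_nn_integral_kl[OF M K Sc AES]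
      by (rule nn_integral_cong_AE, use AEg in eventually_elim) simp
  qed (fact rm rB B)+
qed

context split_rejection_code
begin

text \<open>Dropping either term of the combined bound leaves the other: the squared deviations give
  the marginals, the weighted term gives the distortion after division by \<open>c\<close>. One
  particular codebook is selected in the end, so almost sure statements about candidates do not
  apply to it; \<open>\<pi>\<close> redirects letters outside \<open>S\<close> to \<open>y0\<close>
  and forces the output into \<open>S\<close>.\<close>

lemma ex_code_on_finite_set:
  fixes c D2 :: real and u :: "'a \<Rightarrow> real" and \<Delta> :: "'a \<Rightarrow> 'a \<Rightarrow> real"
  assumes S: "finite S" and y0: "y0 \<in> S"
    and \<pi>: "\<pi> = (\<lambda>y. if y \<in> S then y else y0)"
    and \<Delta>: "case_prod \<Delta> \<in> borel_measurable (borel \<Otimes>\<^sub>M borel)"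
    and c: "0 < c" and D2: "0 \<le> D2" "\<And>t. t < n \<Longrightarrow> bound t (\<lambda>(x, y). ennreal (\<Delta> x (\<pi> y))) \<le> ennreal D2"
    and u: "\<And>t s. t < n \<Longrightarrow> s \<in> S \<Longrightarrow> bound t (\<lambda>(x, y). indicator (\<pi> -` {s}) y) \<le> ennreal (u s)"
      "\<And>s. s \<in> S \<Longrightarrow> 0 \<le> u s"
  shows "\<exists>f g. f \<in> PM \<rightarrow>\<^sub>M count_space UNIV \<and> entropy_disc PM f \<le> ennreal (log 2 (2 ^ k * (N + 1))) \<and>
    (\<Sum>t<n. \<integral>\<^sup>+x. ennreal (\<Delta> (x t) (g (f x) t)) \<partial>PM) \<le> ennreal ((real n * card S * p ^ k + c * (n * D2)) / c) \<and>
    (\<forall>z t. g z t \<in> S) \<and>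
    (\<forall>t<n. \<forall>s\<in>S. measure PM {x \<in> space PM. g (f x) t = s} \<le> u s + sqrt (real n * card S * p ^ k + c * (n * D2)))"
proof -
  let ?v = "real n * card S * p ^ k"
  have v0: "0 \<le> ?v" using p0 by auto
  have Sb: "S \<in> sets borel" using S by (auto intro: borel_closed finite_imp_closed)
  have \<pi>m[measurable]: "\<pi> \<in> borel \<rightarrow>\<^sub>M borel" unfolding \<pi> using Sb by measurable
  note \<Delta>[measurable]
  have A: "\<pi> -` {s} \<in> sets borel" for s
    using measurable_sets[OF \<pi>m, of "{s}"] by simp
  have h: "(\<lambda>(x, y). ennreal (\<Delta> x (\<pi> y))) \<in> borel_measurable (borel \<Otimes>\<^sub>M borel)" by measurable
  from ex_code[of S "\<lambda>s. \<pi> -` {s}" c, OF S A less_imp_le[OF c] h] obtain \<Psi> m where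
    e: "enc \<Psi> \<in> PM \<rightarrow>\<^sub>M count_space UNIV" and
    m: "\<And>t s. t < n \<Longrightarrow> s \<in> S \<Longrightarrow> 0 \<le> m t s \<and> ennreal (m t s) \<le> bound t (\<lambda>(x, y). indicator (\<pi> -` {s}) y)" and
    le: "ennreal (\<Sum>(t, s)\<in>{..<n} \<times> S. (measure PM {x \<in> space PM. dec \<Psi> (enc \<Psi> x) t \<in> \<pi> -` {s}} - m t s)\<^sup>2)
      + ennreal c * (\<Sum>t<n. \<integral>\<^sup>+x. (\<lambda>(x, y). ennreal (\<Delta> x (\<pi> y))) (x t, dec \<Psi> (enc \<Psi> x) t) \<partial>PM)
    \<le> ennreal ?v + ennreal c * (\<Sum>t<n. bound t (\<lambda>(x, y). ennreal (\<Delta> x (\<pi> y))))"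
    by blast
  define g where "g z t = \<pi> (dec \<Psi> z t)" for z t
  let ?f = "enc \<Psi>"
  define sq where "sq = (\<Sum>(t, s)\<in>{..<n} \<times> S. (measure PM {x \<in> space PM. g (?f x) t = s} - m t s)\<^sup>2)"
  define Di where "Di = (\<Sum>t<n. \<integral>\<^sup>+x. ennreal (\<Delta> (x t) (g (?f x) t)) \<partial>PM)"
  have "(\<Sum>t<n. bound t (\<lambda>(x, y). ennreal (\<Delta> x (\<pi> y)))) \<le> (\<Sum>t<n. ennreal D2)"
    using D2 by (intro sum_mono) auto
  also have "\<dots> = ennreal (n * D2)"
    using D2 by (subst sum_ennreal) auto
  finally have "ennreal c * (\<Sum>t<n. bound t (\<lambda>(x, y). ennreal (\<Delta> x (\<pi> y)))) \<le> ennreal c * ennreal (n * D2)"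
    by (rule mult_left_mono) simp
  then have "ennreal sq + ennreal c * Di \<le> ennreal ?v + ennreal c * ennreal (n * D2)"
    using le by (simp add: sq_def Di_def g_def) (meson add_left_mono order_trans)
  also have "\<dots> = ennreal (?v + c * (n * D2))"
    using v0 c D2 by (simp add: ennreal_mult)
  finally have main: "ennreal sq + ennreal c * Di \<le> ennreal (?v + c * (n * D2))" .
  have w0: "0 \<le> ?v + c * (n * D2)" using v0 c D2 by simp
  have "ennreal sq \<le> ennreal (?v + c * (n * D2))"
    using main by (rule order_trans[rotated]) simp
  then have sq: "sq \<le> ?v + c * (n * D2)" using w0 by (subst (asm) ennreal_le_iff) auto
  have "ennreal c * Di \<le> ennreal (?v + c * (n * D2))"
    using main by (rule order_trans[rotated]) simp
  also have "\<dots> = ennreal c * ennreal ((?v + c * (n * D2)) / c)"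
    using c w0 by (subst ennreal_mult[symmetric]) auto
  finally have Di: "Di \<le> ennreal ((?v + c * (n * D2)) / c)"
    using c by (subst (asm) ennreal_mult_le_mult_iff) auto
  have dev: "measure PM {x \<in> space PM. g (?f x) t = s} \<le> u s + sqrt (?v + c * (n * D2))" if "t < n" "s \<in> S" for t s
  proof -
    let ?d = "measure PM {x \<in> space PM. g (?f x) t = s} - m t s"
    have "?d\<^sup>2 \<le> sq"
      unfolding sq_def using that S
      by (intro member_le_sum[of "(t, s)" "{..<n} \<times> S" "\<lambda>(t, s). (measure PM {x \<in> space PM. g (?f x) t = s} - m t s)\<^sup>2", simplified]) auto
    then have "\<bar>?d\<bar> \<le> sqrt (?v + c * (n * D2))" using sq by (intro real_le_rsqrt) simp
    moreover have "m t s \<le> u s"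
      using order_trans[OF m[OF that, THEN conjunct2] u(1)[OF that]] u(2)[OF that(2)] by (subst (asm) ennreal_le_iff) auto
    ultimately show ?thesis by linarith
  qed
  have ent: "entropy_disc PM ?f \<le> ennreal (log 2 (2 ^ k * (N + 1)))"
  proof (rule entropy_disc_le_log_card[OF PM.P.prob_space_axioms e])
    show "finite (prod_encode ` (set_encode ` Pow {..<k} \<times> {..N}))" by simp
    show "?f x \<in> prod_encode ` (set_encode ` Pow {..<k} \<times> {..N})" for x by (rule enc_in)
    show "real (card (prod_encode ` (set_encode ` Pow {..<k} \<times> {..N}))) \<le> 2 ^ k * (N + 1)"
      using card_codes by (metis (mono_tags, lifting) of_nat_le_iff of_nat_mult of_nat_numeral of_nat_power)
  qed
  show ?thesis
    using e ent Di dev y0 unfolding Di_def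
    by (intro exI[of _ ?f] exI[of _ g]) (auto simp: g_def \<pi>)
qed

end

text \<open>Dominated convergence along integer levels. The cutoff controls an unbounded distortion
  on a set of small probability.\<close>

lemma ex_tail_nn_integral_le:
  fixes h :: "'a \<Rightarrow> real"
  assumes [measurable]: "h \<in> borel_measurable M" and fin: "(\<integral>\<^sup>+x. ennreal (h x) \<partial>M) < \<infinity>"
    and h0: "\<And>x. 0 \<le> h x" and \<epsilon>: "0 < \<epsilon>"
  shows "\<exists>\<tau>\<ge>0. (\<integral>\<^sup>+x. ennreal (if h x \<le> \<tau> then 0 else h x) \<partial>M) \<le> ennreal \<epsilon>"
proof -
  have "(\<lambda>i. \<integral>\<^sup>+x. ennreal (if h x \<le> real i then 0 else h x) \<partial>M) \<longlonglongrightarrow> (\<integral>\<^sup>+x. 0 \<partial>M)"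
  proof (rule nn_integral_dominated_convergence[where w = "\<lambda>x. ennreal (h x)"])
    show "AE x in M. (\<lambda>i. ennreal (if h x \<le> real i then 0 else h x)) \<longlonglongrightarrow> 0"
    proof (intro AE_I2 tendsto_eventually)
      fix x
      show "\<forall>\<^sub>F i in sequentially. ennreal (if h x \<le> real i then 0 else h x) = 0"
        using eventually_ge_at_top[of "nat \<lceil>h x\<rceil>"] by eventually_elim (auto simp: nat_le_iff ceiling_le_iff)
    qed
  qed (use fin h0 in auto)
  then have "(\<lambda>i. \<integral>\<^sup>+x. ennreal (if h x \<le> real i then 0 else h x) \<partial>M) \<longlonglongrightarrow> 0" by simp
  then have "\<forall>\<^sub>F i in sequentially. (\<integral>\<^sup>+x. ennreal (if h x \<le> real i then 0 else h x) \<partial>M) < ennreal \<epsilon>"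
    using \<epsilon> by (intro order_tendstoD(2)[of _ 0]) auto
  then obtain i where "(\<integral>\<^sup>+x. ennreal (if h x \<le> real i then 0 else h x) \<partial>M) < ennreal \<epsilon>"
    by (auto simp: eventually_sequentially)
  then show ?thesis by (intro exI[of _ "real i"]) auto
qed

context rejection_code
begin

lemma emeasure_bad_le:
  assumes "0 < \<eta>0"
  shows "emeasure PM {x \<in> space PM. \<not> \<eta> x \<le> ennreal \<eta>0} \<le> ennreal (1 / \<eta>0) * (\<integral>\<^sup>+x. \<eta> x \<partial>PM)"
proof -
  have 1: "ennreal (1 / \<eta>0) * ennreal \<eta>0 = 1" using assms by (simp flip: ennreal_mult')
  have "1 \<le> ennreal (1 / \<eta>0) * \<eta> x" if "\<not> \<eta> x \<le> ennreal \<eta>0" for x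
    using that mult_left_mono[of "ennreal \<eta>0" "\<eta> x" "ennreal (1 / \<eta>0)"] unfolding 1 by simp
  then have sub: "{x \<in> space PM. \<not> \<eta> x \<le> ennreal \<eta>0} \<subseteq> {x \<in> space PM. 1 \<le> ennreal (1 / \<eta>0) * \<eta> x}" by auto
  have "emeasure PM {x \<in> space PM. \<not> \<eta> x \<le> ennreal \<eta>0} \<le> emeasure PM {x \<in> space PM. 1 \<le> ennreal (1 / \<eta>0) * \<eta> x}"
    using sub by (rule emeasure_mono) measurable
  also have "\<dots> \<le> ennreal (1 / \<eta>0) * (\<integral>\<^sup>+x. \<eta> x * indicator (space PM) x \<partial>PM)"
    by (rule nn_integral_Markov_inequality) auto
  also have "(\<integral>\<^sup>+x. \<eta> x * indicator (space PM) x \<partial>PM) = (\<integral>\<^sup>+x. \<eta> x \<partial>PM)"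
    by (intro nn_integral_cong) auto
  finally show ?thesis .
qed

text \<open>The first two terms of \<open>bound\<close> are direct. In the third, \<open>h\<close>
  is cut at \<open>\<tau>\<close>: the part above contributes at most the tail
  \<open>\<epsilon>\<close>, whatever the exceptional set is, and the part below at most
  \<open>\<tau>\<close> times its probability.\<close>

lemma bound_le:
  fixes h :: "'a \<times> 'a \<Rightarrow> real"
  assumes t: "t < n" and hm: "h \<in> borel_measurable (borel \<Otimes>\<^sub>M borel)" and h0: "\<And>z. 0 \<le> h z"
    and J: "(\<integral>\<^sup>+x. \<integral>\<^sup>+y. ennreal (r x y) * ennreal (h (x, y)) \<partial>q \<partial>M) \<le> ennreal J" "0 \<le> J"
    and \<kappa>: "(\<integral>\<^sup>+x. ennreal (h (x, y0)) \<partial>M) \<le> ennreal \<kappa>" "0 \<le> \<kappa>"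
    and \<tau>: "(\<integral>\<^sup>+x. ennreal (if h (x, y0) \<le> \<tau> then 0 else h (x, y0)) \<partial>M) \<le> ennreal \<epsilon>" "0 \<le> \<epsilon>" "0 \<le> \<tau>"
    and \<beta>: "emeasure PM {x \<in> space PM. \<not> \<eta> x \<le> ennreal \<eta>0} \<le> ennreal \<beta>" "0 \<le> \<beta>"
    and e: "e\<^sub>0 \<le> e1"
  shows "bound t (\<lambda>z. ennreal (h z)) \<le> ennreal (1 / (1 - \<eta>0) * J + e1 * \<kappa> + (\<epsilon> + \<tau> * \<beta>))"
proof -
  let ?bad = "{x \<in> space PM. \<not> \<eta> x \<le> ennreal \<eta>0}"
  have bad: "?bad \<in> sets PM" by measurable
  have hy: "(\<lambda>x. h (x, y0)) \<in> borel_measurable borel"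
    using measurable_compose[OF measurable_Pair2' hm, of y0] by simp
  let ?T = "\<lambda>x. ennreal (if h (x, y0) \<le> \<tau> then 0 else h (x, y0))"
  have Tm: "?T \<in> borel_measurable borel" using hy by measurable
  have "(\<integral>\<^sup>+x. (if \<eta> x \<le> ennreal \<eta>0 then 0 else ennreal (h (x t, y0))) \<partial>PM)
    \<le> (\<integral>\<^sup>+x. ?T (x t) + ennreal \<tau> * indicator ?bad x \<partial>PM)"
  proof (rule nn_integral_mono)
    fix x assume "x \<in> space PM"
    then show "(if \<eta> x \<le> ennreal \<eta>0 then 0 else ennreal (h (x t, y0))) \<le> ?T (x t) + ennreal \<tau> * indicator ?bad x"
      using \<tau>(3) by (auto intro: ennreal_leI)
  qed
  also have "\<dots> = (\<integral>\<^sup>+x. ?T (x t) \<partial>PM) + ennreal \<tau> * emeasure PM ?bad"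
  proof -
    have "(\<lambda>x. ?T (x t)) \<in> borel_measurable PM" by (rule measurable_compose[OF measurable_coord_M[OF t] Tm])
    moreover have "(\<lambda>x. ennreal \<tau> * indicator ?bad x) \<in> borel_measurable PM" using bad by measurable
    ultimately have "(\<integral>\<^sup>+x. ?T (x t) + ennreal \<tau> * indicator ?bad x \<partial>PM) = (\<integral>\<^sup>+x. ?T (x t) \<partial>PM) + (\<integral>\<^sup>+x. ennreal \<tau> * indicator ?bad x \<partial>PM)"
      by (rule nn_integral_add)
    then show ?thesis using bad by (simp add: nn_integral_cmult_indicator)
  qed
  also have "(\<integral>\<^sup>+x. ?T (x t) \<partial>PM) = (\<integral>\<^sup>+x. ?T x \<partial>M)" by (rule nn_integral_coord[OF t Tm])
  also have "(\<integral>\<^sup>+x. ?T x \<partial>M) + ennreal \<tau> * emeasure PM ?bad \<le> ennreal \<epsilon> + ennreal \<tau> * ennreal \<beta>"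
    by (intro add_mono mult_left_mono \<tau> \<beta>) simp
  also have "\<dots> = ennreal (\<epsilon> + \<tau> * \<beta>)" using \<tau> \<beta> by (simp add: ennreal_mult)
  finally have 3: "(\<integral>\<^sup>+x. (if \<eta> x \<le> ennreal \<eta>0 then 0 else ennreal (h (x t, y0))) \<partial>PM) \<le> ennreal (\<epsilon> + \<tau> * \<beta>)" .
  have e0: "0 \<le> e1" using e by (rule order_trans[rotated]) simp
  have "bound t (\<lambda>z. ennreal (h z)) \<le> ennreal (1 / (1 - \<eta>0)) * ennreal J + ennreal e1 * ennreal \<kappa> + ennreal (\<epsilon> + \<tau> * \<beta>)"
    unfolding bound_def by (intro add_mono mult_mono J \<kappa> 3 ennreal_leI e order_refl) auto
  also have "\<dots> = ennreal (1 / (1 - \<eta>0) * J + e1 * \<kappa> + (\<epsilon> + \<tau> * \<beta>))"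
  proof -
    have "0 \<le> 1 / (1 - \<eta>0) * J" "0 \<le> e1 * \<kappa>" "0 \<le> \<epsilon> + \<tau> * \<beta>"
      using J \<kappa> \<tau> \<beta> e0 \<eta>0 by auto
    then have "ennreal (1 / (1 - \<eta>0) * J + e1 * \<kappa> + (\<epsilon> + \<tau> * \<beta>)) = ennreal (1 / (1 - \<eta>0) * J) + ennreal (e1 * \<kappa>) + ennreal (\<epsilon> + \<tau> * \<beta>)"
      by (simp only: ennreal_plus add_nonneg_nonneg)
    also have "ennreal (1 / (1 - \<eta>0) * J) = ennreal (1 / (1 - \<eta>0)) * ennreal J"
      using \<eta>0 J by (intro ennreal_mult) auto
    also have "ennreal (e1 * \<kappa>) = ennreal e1 * ennreal \<kappa>" using e0 \<kappa> by (intro ennreal_mult) auto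
    finally show ?thesis ..
  qed
  finally show ?thesis .
qed

end

context split_rejection_code
begin

text \<open>The perception constraint enters as an implication about laws on \<open>S\<close> with
  bounded atoms, so the bookkeeping of the code is kept apart from the convexity argument.\<close>

lemma nr_code_of_rejection:
  fixes c D2 D R P :: real and u :: "'a \<Rightarrow> real" and \<Delta> :: "'a \<Rightarrow> 'a \<Rightarrow> real"
  assumes n: "0 < n" and S: "finite S" and y0: "y0 \<in> S"
    and \<pi>: "\<pi> = (\<lambda>y. if y \<in> S then y else y0)"
    and \<Delta>: "case_prod \<Delta> \<in> borel_measurable (borel \<Otimes>\<^sub>M borel)"
    and c: "0 < c" and D2: "0 \<le> D2" "\<And>t. t < n \<Longrightarrow> bound t (\<lambda>(x, y). ennreal (\<Delta> x (\<pi> y))) \<le> ennreal D2"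
    and u: "\<And>t s. t < n \<Longrightarrow> s \<in> S \<Longrightarrow> bound t (\<lambda>(x, y). indicator (\<pi> -` {s}) y) \<le> ennreal (u s)"
      "\<And>s. s \<in> S \<Longrightarrow> 0 \<le> u s"
    and R: "log 2 (2 ^ k * (N + 1)) \<le> n * R"
    and D: "(real n * card S * p ^ k + c * (n * D2)) / c \<le> n * D"
    and P: "0 \<le> P" "\<And>\<gamma>. prob_meas \<gamma> \<Longrightarrow> emeasure \<gamma> S = 1 \<Longrightarrow>
      (\<And>s. s \<in> S \<Longrightarrow> measure \<gamma> {s} \<le> u s + sqrt (real n * card S * p ^ k + c * (n * D2))) \<Longrightarrow> d M \<gamma> \<le> ennreal P"
  shows "nr_code M \<Delta> d D P R n"
proof -
  from ex_code_on_finite_set[OF S y0 \<pi> \<Delta> c D2 u] obtain f g where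
    f: "f \<in> PM \<rightarrow>\<^sub>M count_space UNIV" and H: "entropy_disc PM f \<le> ennreal (log 2 (2 ^ k * (N + 1)))"
    and Di: "(\<Sum>t<n. \<integral>\<^sup>+x. ennreal (\<Delta> (x t) (g (f x) t)) \<partial>PM) \<le> ennreal ((real n * card S * p ^ k + c * (n * D2)) / c)"
    and gS: "\<And>z t. g z t \<in> S"
    and le: "\<And>t s. t < n \<Longrightarrow> s \<in> S \<Longrightarrow> measure PM {x \<in> space PM. g (f x) t = s} \<le> u s + sqrt (real n * card S * p ^ k + c * (n * D2))"
    by blast
  have f': "f \<in> (\<Pi>\<^sub>M i\<in>{..<n}. (borel :: 'a measure)) \<rightarrow>\<^sub>M count_space UNIV"
    using f by (subst (asm) measurable_cong_sets[OF sets_PiM_cong[OF refl sets_M] refl])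
  have Sb: "S \<in> sets borel" using S by (auto intro: borel_closed finite_imp_closed)
  have "0 < (2::nat) ^ k * (N + 1)" by (intro mult_pos_pos) auto
  then have "1 \<le> (2::nat) ^ k * (N + 1)" by linarith
  then have "1 \<le> real (2 ^ k * (N + 1))" by (metis of_nat_1 of_nat_le_iff)
  then have l0: "0 \<le> log 2 (2 ^ k * (N + 1))"
    unfolding log_def by (intro divide_nonneg_pos ln_ge_zero) (assumption, simp)
  have d0: "0 \<le> (real n * card S * p ^ k + c * (n * D2)) / c" using p0 c D2 by auto
  have "d M (distr PM borel (\<lambda>x. g (f x) t)) \<le> ennreal P" if t: "t < n" for t
  proof (rule P(2))
    have gm: "(\<lambda>x. g (f x) t) \<in> PM \<rightarrow>\<^sub>M borel" by (rule measurable_compose[OF f]) simp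
    show pm: "prob_meas (distr PM borel (\<lambda>x. g (f x) t))"
      using gm by (auto simp: prob_meas_def intro: PM.P.prob_space_distr)
    have "(\<lambda>x. g (f x) t) -` S \<inter> space PM = space PM" using gS by auto
    then show "emeasure (distr PM borel (\<lambda>x. g (f x) t)) S = 1"
      using gm Sb by (simp add: emeasure_distr PM.P.emeasure_space_1)
    fix s assume s: "s \<in> S"
    have "(\<lambda>x. g (f x) t) -` {s} \<inter> space PM = {x \<in> space PM. g (f x) t = s}" by auto
    then show "measure (distr PM borel (\<lambda>x. g (f x) t)) {s} \<le> u s + sqrt (real n * card S * p ^ k + c * (n * D2))"
      using le[OF t s] gm by (simp add: measure_distr)
  qed
  moreover have "entropy_disc PM f \<le> ennreal (n * R)"
    using H R by (meson ennreal_leI order_trans)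
  moreover have "(\<Sum>t<n. \<integral>\<^sup>+x. ennreal (\<Delta> (x t) (g (f x) t)) \<partial>PM) \<le> ennreal (n * D)"
    using Di D by (meson ennreal_leI order_trans)
  moreover have "0 \<le> n * R" "0 \<le> n * D" using l0 R d0 D by linarith+
  ultimately show ?thesis
    unfolding nr_code_def enn2ereal_le_ereal_iff using f' P(1)
    by (intro exI[of _ f] exI[of _ g]) auto
qed

end

section \<open>Achievability\<close>

lemma eventually_exp_minus_le:
  assumes "0 < a" "0 < (\<epsilon>::real)"
  shows "\<forall>\<^sub>F n in sequentially. exp (- a * real n) \<le> \<epsilon>"
proof -
  have "(\<lambda>n. exp (- a) ^ n) \<longlonglongrightarrow> 0" using assms by (intro LIMSEQ_realpow_zero) auto
  then have "\<forall>\<^sub>F n in sequentially. exp (- a) ^ n < \<epsilon>" using assms by (intro order_tendstoD(2)[of _ 0]) auto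
  then show ?thesis by eventually_elim (simp add: exp_of_nat_mult[symmetric] mult.commute less_imp_le)
qed

text \<open>Without rounding the power is geometric with ratio \<open>p powr \<delta> < 1\<close>,
  which absorbs the factor \<open>n\<close>; rounding the exponent down costs at most the factor
  \<open>1 / p\<close>.\<close>

lemma eventually_mult_power_floor_le:
  assumes p: "0 < p" "p < 1" and \<delta>: "0 < \<delta>" and "0 < (\<epsilon>::real)" "0 \<le> m"
  shows "\<forall>\<^sub>F n in sequentially. real n * m * p ^ nat \<lfloor>\<delta> * real n\<rfloor> \<le> \<epsilon>"
proof -
  define x where "x = p powr \<delta>"
  have x: "0 < x" "x < 1" using p \<delta> powr_less_mono2[of \<delta> p 1] by (auto simp: x_def)
  have "(\<lambda>n. real n * x ^ n) \<longlonglongrightarrow> 0" using x by (intro powser_times_n_limit_0) auto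
  then have "(\<lambda>n. m / p * (real n * x ^ n)) \<longlonglongrightarrow> m / p * 0" by (intro tendsto_intros)
  then have "(\<lambda>n. m / p * (real n * x ^ n)) \<longlonglongrightarrow> 0" by simp
  then have "\<forall>\<^sub>F n in sequentially. m / p * (real n * x ^ n) < \<epsilon>" using assms by (intro order_tendstoD(2)[of _ 0]) auto
  then show ?thesis
  proof eventually_elim
    fix n assume le: "m / p * (real n * x ^ n) < \<epsilon>"
    have "0 \<le> \<delta> * real n" using \<delta> by simp
    then have "\<delta> * n - 1 \<le> real (nat \<lfloor>\<delta> * real n\<rfloor>)" by linarith
    then have "p powr real (nat \<lfloor>\<delta> * real n\<rfloor>) \<le> p powr (\<delta> * n - 1)" using p by (intro powr_mono') auto
    then have "p ^ nat \<lfloor>\<delta> * real n\<rfloor> \<le> p powr (\<delta> * n) / p" using p by (simp add: powr_realpow powr_diff)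
    also have "p powr (\<delta> * n) = x ^ n" using p by (simp add: x_def powr_realpow[symmetric] powr_powr)
    finally have "real n * m * p ^ nat \<lfloor>\<delta> * real n\<rfloor> \<le> real n * m * (x ^ n / p)"
      using assms(5) by (intro mult_left_mono) auto
    with le show "real n * m * p ^ nat \<lfloor>\<delta> * real n\<rfloor> \<le> \<epsilon>" by (simp add: field_simps)
  qed
qed

lemma eventually_log_le:
  assumes "0 < \<delta>"
  shows "\<forall>\<^sub>F n in sequentially. log 2 (3 * real n) \<le> \<delta> * real n"
proof -
  have "(\<lambda>n. log 2 3 * inverse (real n) + ln (real n) / real n / ln 2) \<longlonglongrightarrow> log 2 3 * 0 + 0 / ln 2"
    by (intro tendsto_intros lim_inverse_n lim_ln_over_n) auto
  then have "\<forall>\<^sub>F n in sequentially. log 2 3 * inverse (real n) + ln (real n) / real n / ln 2 < \<delta>"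
    using assms by (intro order_tendstoD(2)[of _ 0]) auto
  then show ?thesis using eventually_gt_at_top[of 0]
  proof eventually_elim
    fix n :: nat assume le: "log 2 3 * inverse (real n) + ln (real n) / real n / ln 2 < \<delta>" and n: "0 < n"
    have "log 2 (3 * real n) = (log 2 3 * inverse (real n) + ln (real n) / real n / ln 2) * real n"
      using n by (simp add: log_def ln_mult field_simps)
    also have "\<dots> \<le> \<delta> * real n" using le n by (intro mult_right_mono) auto
    finally show "log 2 (3 * real n) \<le> \<delta> * real n" .
  qed
qed

text \<open>The gaps \<open>R - I\<close>, \<open>D - D'\<close> and \<open>P - P'\<close> are
  divided into fixed shares before the block length is chosen; the errors that remain are
  exponentially small, apart from a logarithmic number of bits.\<close>

lemma achievable_of_kernel:
  fixes M :: "'a::polish_space measure" and D P R :: real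
  assumes M: "prob_meas M" and K: "markov_kernel K"
    and \<Delta>: "case_prod \<Delta> \<in> borel_measurable (borel \<Otimes>\<^sub>M borel)" and \<Delta>0: "\<And>x y. 0 \<le> \<Delta> x y"
    and S: "finite S" "emeasure (outlaw M K) S = 1" "\<And>s. s \<in> S \<Longrightarrow> 0 < emeasure (outlaw M K) {s}"
    and E: "E \<in> sets borel" "0 < measure M E" "measure M E < 1"
    and I: "mutual_info M K \<le> ennreal I" "0 \<le> I" "I < R"
    and D': "exp_dist M \<Delta> K \<le> ennreal D'" "0 \<le> D'" "D' < D"
    and \<Delta>S: "\<And>s. s \<in> S \<Longrightarrow> (\<integral>\<^sup>+x. ennreal (\<Delta> x s) \<partial>M) < \<infinity>"
    and \<phi>: "mix_convex (d M)"
    and P': "d M (outlaw M K) \<le> ennreal P'" "0 \<le> P'" "P' < P"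
    and fin: "\<And>\<gamma>. prob_meas \<gamma> \<Longrightarrow> emeasure \<gamma> S = 1 \<Longrightarrow> d M \<gamma> < \<infinity>"
  shows "achievable_nr M \<Delta> d D P R"
proof -
  define q where "q = outlaw M K"
  have q: "prob_meas q" unfolding q_def by (rule prob_meas_outlaw[OF M K])
  interpret q: prob_space q by (rule prob_measD[OF q])
  interpret M: prob_space M by (rule prob_measD[OF M])
  have sM: "sets M = sets borel" by (rule prob_measD[OF M])
  note [measurable] = \<Delta>
  have S2: "emeasure q S = 1" and S3: "\<And>s. s \<in> S \<Longrightarrow> 0 < measure q {s}"
    using S(2,3) by (auto simp: q_def[symmetric] q.emeasure_eq_measure)
  have Sb: "S \<in> sets borel" using S by (auto intro: borel_closed finite_imp_closed)
  have "S \<noteq> {}" using S2 by auto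
  then obtain y0 where y0: "y0 \<in> S" by blast
  define \<pi> where "\<pi> = (\<lambda>y. if y \<in> S then y else y0)"
  have \<pi>m[measurable]: "\<pi> \<in> borel \<rightarrow>\<^sub>M borel" unfolding \<pi>_def using Sb by measurable
  have AES: "AE y in q. y \<in> S"
    using S2 Sb prob_measD(2)[OF q] by (subst q.prob_eq_1[symmetric]) (auto simp: q.emeasure_eq_measure)
  have AEK: "AE x in M. AE y in K x. y \<in> S"
    by (rule AE_kernel_support[OF M K Sb AES[unfolded q_def]])
  obtain r B where r: "case_prod r \<in> borel_measurable (borel \<Otimes>\<^sub>M borel)" "\<And>x y. 0 \<le> r x y" "\<And>x y. r x y \<le> B" "1 \<le> B"
    "\<And>x. (\<integral>\<^sup>+y. ennreal (r x y) \<partial>q) = 1"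
    "\<And>h. h \<in> borel_measurable (borel \<Otimes>\<^sub>M borel) \<Longrightarrow>
       (\<integral>\<^sup>+x. \<integral>\<^sup>+y. ennreal (r x y) * h (x, y) \<partial>q \<partial>M) = (\<integral>\<^sup>+x. \<integral>\<^sup>+y. h (x, y) \<partial>K x \<partial>M)"
    "(\<integral>\<^sup>+x. \<integral>\<^sup>+y. ennreal (kl_fun (r x y)) \<partial>q \<partial>M) = mutual_info M K"
    by (rule ex_bounded_density[OF M K S, folded q_def]) (assumption, rule that)
  have JD: "(\<integral>\<^sup>+x. \<integral>\<^sup>+y. ennreal (r x y) * ennreal (\<Delta> x (\<pi> y)) \<partial>q \<partial>M) \<le> ennreal D'"
  proof -
    have "(\<integral>\<^sup>+x. \<integral>\<^sup>+y. ennreal (r x y) * ennreal (\<Delta> x (\<pi> y)) \<partial>q \<partial>M) = (\<integral>\<^sup>+x. \<integral>\<^sup>+y. ennreal (\<Delta> x (\<pi> y)) \<partial>K x \<partial>M)"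
      using r(6)[of "\<lambda>(x, y). ennreal (\<Delta> x (\<pi> y))"] by simp
    also have "\<dots> = exp_dist M \<Delta> K"
      unfolding exp_dist_def
    proof (rule nn_integral_cong_AE, use AEK in eventually_elim)
      fix x assume "AE y in K x. y \<in> S"
      then show "(\<integral>\<^sup>+y. ennreal (\<Delta> x (\<pi> y)) \<partial>K x) = (\<integral>\<^sup>+y. ennreal (\<Delta> x y) \<partial>K x)"
        by (intro nn_integral_cong_AE) (auto simp: \<pi>_def)
    qed
    finally show ?thesis using D'(1) by simp
  qed
  have JS: "(\<integral>\<^sup>+x. \<integral>\<^sup>+y. ennreal (r x y) * ennreal (indicator (\<pi> -` {s}) y) \<partial>q \<partial>M) \<le> ennreal (measure q {s})" for s
  proof -
    have A: "\<pi> -` {s} \<in> sets borel" using measurable_sets[OF \<pi>m, of "{s}"] by simp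
    have "(\<integral>\<^sup>+x. \<integral>\<^sup>+y. ennreal (r x y) * ennreal (indicator (\<pi> -` {s}) y) \<partial>q \<partial>M) = (\<integral>\<^sup>+x. \<integral>\<^sup>+y. ennreal (indicator (\<pi> -` {s}) y) \<partial>K x \<partial>M)"
      using r(6)[of "\<lambda>(x, y). ennreal (indicator (\<pi> -` {s}) y)"] A by simp
    also have "\<dots> = (\<integral>\<^sup>+y. ennreal (indicator (\<pi> -` {s}) y) \<partial>q)"
      unfolding q_def using A by (intro nn_integral_outlaw[OF M K, symmetric]) simp
    also have "\<dots> = (\<integral>\<^sup>+y. indicator {s} y \<partial>q)"
      by (rule nn_integral_cong_AE, use AES in eventually_elim) (auto simp: \<pi>_def split: split_indicator)
    also have "\<dots> = ennreal (measure q {s})"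
      using prob_measD(2)[OF q] by (simp add: q.emeasure_eq_measure)
    finally show ?thesis by simp
  qed
  define p where "p = max (measure M E) (1 - measure M E)"
  have p: "0 < p" "p < 1" using E by (auto simp: p_def)
  \<comment> \<open>Rate budget per symbol: \<open>\<delta>\<close> for the pattern,
    \<open>\<delta>\<close> for the factor \<open>3 * n\<close>, and \<open>I + \<delta>\<close> for
    \<open>L\<close>, in total \<open>I + 3 * \<delta> < R\<close>. The minimum with 1 ensures
    \<open>k \<le> n\<close>.\<close>
  define \<delta> where "\<delta> = min 1 ((R - I) / 4)"
  have \<delta>: "0 < \<delta>" "\<delta> \<le> 1" "4 * \<delta> \<le> R - I" using I by (auto simp: \<delta>_def min_def)
  \<comment> \<open>Half of \<open>\<delta>\<close>, in nats. The exponent of \<open>L\<close>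
    exceeds the information by \<open>2 * \<delta>'\<close> per symbol: one half pays for the moment
    bound, the other leaves the decay \<open>exp (- (s * \<delta>') * n)\<close>.\<close>
  define \<delta>' where "\<delta>' = \<delta> * ln 2 / 2"
  have \<delta>': "0 < \<delta>'" using \<delta> by (simp add: \<delta>'_def)
  have rm: "case_prod r \<in> borel_measurable (M \<Otimes>\<^sub>M q)"
    using r(1) by (subst measurable_cong_sets[OF sets_pair_measure_cong[OF sM prob_measD(2)[OF q]] refl])
  obtain s where s: "0 < s" and X: "(\<integral>\<^sup>+x. \<integral>\<^sup>+y. ennreal (r x y powr (1 + s)) \<partial>q \<partial>M) \<le> ennreal (exp (s * (I * ln 2 + \<delta>')))"
    using ex_powr_integral_le_exp[OF M.prob_space_axioms q.prob_space_axioms rm r(2,3,4,5) _ I(2) \<delta>'] I(1) r(7) by auto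
  \<comment> \<open>A common bound for the divergence at the point masses of \<open>S\<close>,
    finite by \<open>fin\<close>.\<close>
  define Cm where "Cm = enn2real (\<Sum>s\<in>S. d M (return borel s))"
  have Cm: "d M (return borel s) \<le> ennreal Cm" if "s \<in> S" for s
  proof -
    have "d M (return borel s) < \<infinity>" if "s \<in> S" for s
      using that Sb by (intro fin prob_meas_return) auto
    then have "(\<Sum>s\<in>S. d M (return borel s)) < \<infinity>" using S(1) by simp
    then have "ennreal Cm = (\<Sum>s\<in>S. d M (return borel s))" by (simp add: Cm_def)
    then show ?thesis using that S(1) by (auto intro: member_le_sum)
  qed
  have Cm0: "0 \<le> Cm" by (simp add: Cm_def)
  \<comment> \<open>Weight of the part of a marginal that is not a multiple of \<open>q\<close>. It
    may cost \<open>Cm\<close>, and the gap \<open>P - P'\<close> pays for \<open>l * Cm\<close>;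
    the added 1 avoids a division by 0.\<close>
  define l where "l = min 1 ((P - P') / (Cm + 1))"
  have l: "0 < l" "l \<le> 1" using P' Cm0 by (auto simp: l_def)
  have lP: "P' + l * Cm \<le> P"
  proof -
    have "l * Cm \<le> (P - P') / (Cm + 1) * (Cm + 1)" using P' Cm0 by (intro mult_mono) (auto simp: l_def)
    then show ?thesis using Cm0 by simp
  qed
  define qm where "qm = Min ((\<lambda>s. measure q {s}) ` S)"
  have qm: "0 < qm" "\<And>s. s \<in> S \<Longrightarrow> qm \<le> measure q {s}"
    using S(1) S3 \<open>S \<noteq> {}\<close> by (auto simp: qm_def)
  have cS: "0 < card S" using S(1) \<open>S \<noteq> {}\<close> by (simp add: card_gt_0_iff)
  \<comment> \<open>Admissible excess at one atom: summed over \<open>S\<close> it equals the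
    fraction \<open>l\<close> of the smallest atom \<open>qm\<close>.\<close>
  define \<zeta> where "\<zeta> = l * qm / card S"
  have \<zeta>: "0 < \<zeta>" "card S * \<zeta> = l * qm" using l qm cS by (auto simp: \<zeta>_def)
  have near: "d M \<gamma> \<le> ennreal P" if \<gamma>: "prob_meas \<gamma>" "emeasure \<gamma> S = 1" "\<And>s. s \<in> S \<Longrightarrow> measure \<gamma> {s} \<le> measure q {s} + \<zeta>" for \<gamma>
  proof -
    have "(1 - l) * measure q {s} \<le> measure \<gamma> {s}" if "s \<in> S" for s
    proof (rule measure_ge_of_le[OF q \<gamma>(1) S(1) S2 \<gamma>(2) that \<gamma>(3)])
      show "card S * \<zeta> \<le> l * measure q {s}" using \<zeta>(2) qm(2)[OF that] l by (simp add: mult_left_mono)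
    qed (use \<zeta> in auto)
    then have "d M \<gamma> \<le> ennreal (1 - l) * d M q + ennreal l * ennreal Cm"
      by (intro mix_convex_near[OF \<phi> q \<gamma>(1) S(1) S2 \<gamma>(2) l Cm]) auto
    also have "\<dots> \<le> 1 * ennreal P' + ennreal l * ennreal Cm"
      using P' l by (intro add_mono mult_mono) (auto simp: q_def ennreal_le_1)
    also have "\<dots> = ennreal (P' + l * Cm)" using P' l Cm0 by (simp add: ennreal_mult)
    also have "\<dots> \<le> ennreal P" by (rule ennreal_leI[OF lP])
    finally show ?thesis .
  qed
  have cancel: "x / (m * z) * z = x / m" if "z \<noteq> 0" for x m z :: real using that by simp
  \<comment> \<open>Relative inflation by rejection sampling, since
    \<open>1 / (1 - \<eta>0) = 1 + \<theta>\<close>. It may use a quarter of \<open>\<zeta>\<close>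
    at each atom and a quarter of the distortion gap.\<close>
  define \<theta> where "\<theta> = min (\<zeta> / 4) ((D - D') / (4 * (D' + 1)))"
  have \<theta>: "0 < \<theta>" "\<theta> \<le> \<zeta> / 4" using \<zeta> D' by (simp add: \<theta>_def, simp only: \<theta>_def min.cobounded1)
  have \<theta>D: "\<theta> * D' \<le> (D - D') / 4"
  proof -
    have "\<theta> * D' \<le> (D - D') / (4 * (D' + 1)) * (D' + 1)" using D' by (intro mult_mono) (auto simp: \<theta>_def)
    also have "\<dots> = (D - D') / 4" using D' by (intro cancel) auto
    finally show ?thesis .
  qed
  define \<eta>0 where "\<eta>0 = \<theta> / (1 + \<theta>)"
  have \<eta>0: "0 < \<eta>0" "\<eta>0 < 1" "1 / (1 - \<eta>0) = 1 + \<theta>"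
    using \<theta> by (auto simp: \<eta>0_def field_simps)
  have \<Delta>y: "(\<lambda>x. \<Delta> x y0) \<in> borel_measurable M"
    using measurable_compose[OF measurable_Pair2' \<Delta>, of y0] by (subst measurable_cong_sets[OF sM refl]) simp
  define \<kappa> where "\<kappa> = enn2real (\<integral>\<^sup>+x. ennreal (\<Delta> x y0) \<partial>M)"
  have \<kappa>: "(\<integral>\<^sup>+x. ennreal (\<Delta> x y0) \<partial>M) = ennreal \<kappa>" "0 \<le> \<kappa>"
    using \<Delta>S[OF y0] by (auto simp: \<kappa>_def)
  have DD: "0 < (D - D') / 8" using D' by simp
  obtain \<tau> where \<tau>: "0 \<le> \<tau>" "(\<integral>\<^sup>+x. ennreal (if \<Delta> x y0 \<le> \<tau> then 0 else \<Delta> x y0) \<partial>M) \<le> ennreal ((D - D') / 8)"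
    using ex_tail_nn_integral_le[OF \<Delta>y \<Delta>S[OF y0] \<Delta>0 DD] by blast
  \<comment> \<open>Admissible probability of exhausting a codebook; \<open>\<kappa>\<close> is the
    mean distortion of always writing \<open>y0\<close>. One eighth of either budget.\<close>
  define e1 where "e1 = min (\<zeta> / 8) ((D - D') / (8 * (\<kappa> + 1)))"
  have e1: "0 < e1" "e1 \<le> \<zeta> / 8" using \<zeta> D' \<kappa>(2) by (simp add: e1_def, simp only: e1_def min.cobounded1)
  have e1D: "e1 * \<kappa> \<le> (D - D') / 8"
  proof -
    have "e1 * \<kappa> \<le> (D - D') / (8 * (\<kappa> + 1)) * (\<kappa> + 1)" using D' \<kappa>(2) by (intro mult_mono) (auto simp: e1_def)
    also have "\<dots> = (D - D') / 8" using \<kappa>(2) by (intro cancel) auto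
    finally show ?thesis .
  qed
  \<comment> \<open>Admissible probability of the inputs sent to failure. On them the distortion up
    to \<open>\<tau>\<close> costs \<open>\<tau> * \<beta>\<close>; what exceeds
    \<open>\<tau>\<close> is paid by the tail.\<close>
  define \<beta> where "\<beta> = min (\<zeta> / 8) ((D - D') / (8 * (\<tau> + 1)))"
  have \<beta>: "0 < \<beta>" "\<beta> \<le> \<zeta> / 8" using \<zeta> D' \<tau>(1) by (simp add: \<beta>_def, simp only: \<beta>_def min.cobounded1)
  have \<beta>D: "\<tau> * \<beta> \<le> (D - D') / 8"
  proof -
    have "\<beta> * \<tau> \<le> (D - D') / (8 * (\<tau> + 1)) * (\<tau> + 1)" using D' \<tau>(1) \<beta>(1) by (intro mult_mono) (auto simp: \<beta>_def)
    also have "\<dots> = (D - D') / 8" using \<tau>(1) by (intro cancel) auto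
    finally show ?thesis by (simp only: mult.commute)
  qed
  \<comment> \<open>A quarter of the gap for inflation and an eighth each for exhausted codebooks,
    tail and exceptional inputs make 5/8; the remaining 3/8 is left to the derandomization.\<close>
  define D2 where "D2 = D' + 5 / 8 * (D - D')"
  have D2: "0 \<le> D2" "D2 < D" "D - D2 = 3 / 8 * (D - D')" using D' unfolding D2_def by argo+
  \<comment> \<open>Total weight of the distortion in the combined bound, spread later as
    \<open>c = T / n\<close>. It is small enough that \<open>T * D2\<close> does not spoil the
    marginals, and independent of \<open>n\<close>, so that the vanishing deviation term eventually
    drops below \<open>T * (D - D2)\<close>.\<close>
  define T where "T = \<zeta>\<^sup>2 / (8 * (D2 + 1))"
  have T: "0 < T" "T * D2 \<le> \<zeta>\<^sup>2 / 8"
  proof -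
    show "0 < T" using \<zeta> D2 by (simp add: T_def)
    have "T * D2 \<le> T * (D2 + 1)" using \<open>0 < T\<close> by simp
    also have "\<dots> = \<zeta>\<^sup>2 / 8" using D2 by (simp add: T_def field_simps)
    finally show "T * D2 \<le> \<zeta>\<^sup>2 / 8" .
  qed
  have ev: "\<forall>\<^sub>F n in sequentially. 0 < n \<and> exp (- (1 - \<eta>0) * real n) \<le> e1 \<and> exp (- (s * \<delta>') * real n) \<le> \<beta> * \<eta>0
      \<and> real n * card S * p ^ nat \<lfloor>\<delta> * real n\<rfloor> \<le> min (\<zeta>\<^sup>2 / 8) (T * (D - D2)) \<and> log 2 (3 * real n) \<le> \<delta> * real n"
    using \<eta>0 e1 s \<delta>' \<beta> p \<delta> \<zeta> T D2
    by (intro eventually_conj eventually_gt_at_top eventually_exp_minus_le eventually_mult_power_floor_le eventually_log_le) auto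
  have "nr_code M \<Delta> d D P R n" if n: "0 < n" and A1: "exp (- (1 - \<eta>0) * real n) \<le> e1"
    and A2: "exp (- (s * \<delta>') * real n) \<le> \<beta> * \<eta>0"
    and A3: "real n * card S * p ^ nat \<lfloor>\<delta> * real n\<rfloor> \<le> min (\<zeta>\<^sup>2 / 8) (T * (D - D2))"
    and A4: "log 2 (3 * real n) \<le> \<delta> * real n" for n
  proof -
    define k where "k = nat \<lfloor>\<delta> * real n\<rfloor>"
    have k: "k \<le> n" "real k \<le> \<delta> * n"
    proof -
      have "0 \<le> \<delta> * real n" using \<delta> by simp
      then show "real k \<le> \<delta> * n" by (simp add: k_def)
      also have "\<dots> \<le> 1 * real n" using \<delta> by (intro mult_right_mono) auto
      finally show "k \<le> n" by simp
    qed
    define a where "a = I * ln 2 + 2 * \<delta>'"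
    have a0: "0 \<le> a" using I \<delta>' by (simp add: a_def)
    define L where "L = exp (real n * a)"
    have L: "1 \<le> L" using a0 by (simp add: L_def)
    \<comment> \<open>The factor \<open>n\<close> beyond \<open>L\<close> makes the failure
      probability at most \<open>exp (- (1 - \<eta>0) * n)\<close> and costs only a logarithm in the
      rate.\<close>
    define N where "N = nat \<lceil>real n * L\<rceil>"
    have N: "real n * L \<le> N" "N \<le> real n * L + 1"
    proof -
      have "0 \<le> real n * L" using L by simp
      then show "real n * L \<le> N" "N \<le> real n * L + 1" unfolding N_def by linarith+
    qed
    interpret C: split_rejection_code M q n N L \<eta>0 r y0 E k p
      by standard (use M q r \<eta>0 L E k in \<open>auto simp: p_def\<close>)
    have e0: "C.e\<^sub>0 \<le> e1"
    proof -
      have "real n \<le> N / L" using N(1) L by (simp add: field_simps)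
      then have "(1 - \<eta>0) * n \<le> (1 - \<eta>0) * (N / L)" using \<eta>0 by (intro mult_left_mono) auto
      moreover have m1: "- x / L * y = - (x * (y / L))" and m2: "- x * y = - (x * y)" for x y :: real by simp_all
      ultimately have "- (1 - \<eta>0) / L * N \<le> - (1 - \<eta>0) * n" unfolding m1 m2 by linarith
      then show ?thesis using A1 by (meson exp_le_cancel_iff order_trans)
    qed
    have bad: "emeasure C.PM {x \<in> space C.PM. \<not> C.\<eta> x \<le> ennreal \<eta>0} \<le> ennreal \<beta>"
    proof -
      have "(\<integral>\<^sup>+x. C.\<eta> x \<partial>C.PM) \<le> ennreal (L powr (- s)) * (\<integral>\<^sup>+x. \<integral>\<^sup>+y. ennreal (r x y powr (1 + s)) \<partial>q \<partial>M) ^ n"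
        by (rule C.nn_integral_\<eta>_le[OF s])
      also have "\<dots> \<le> ennreal (L powr (- s)) * ennreal (exp (s * (I * ln 2 + \<delta>'))) ^ n"
        by (intro mult_left_mono power_mono X) auto
      also have "\<dots> = ennreal (L powr (- s) * exp (s * (I * ln 2 + \<delta>')) ^ n)"
        by (simp add: ennreal_mult ennreal_power)
      also have "L powr (- s) * exp (s * (I * ln 2 + \<delta>')) ^ n = exp (- (s * \<delta>') * n)"
        by (simp add: L_def powr_def a_def exp_of_nat_mult[symmetric] exp_add[symmetric] algebra_simps)
      also have "ennreal (exp (- (s * \<delta>') * n)) \<le> ennreal (\<beta> * \<eta>0)" by (rule ennreal_leI[OF A2])
      finally have le: "(\<integral>\<^sup>+x. C.\<eta> x \<partial>C.PM) \<le> ennreal (\<beta> * \<eta>0)" .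
      have "emeasure C.PM {x \<in> space C.PM. \<not> C.\<eta> x \<le> ennreal \<eta>0} \<le> ennreal (1 / \<eta>0) * (\<integral>\<^sup>+x. C.\<eta> x \<partial>C.PM)"
        by (rule C.emeasure_bad_le[OF \<eta>0(1)])
      also have "\<dots> \<le> ennreal (1 / \<eta>0) * ennreal (\<beta> * \<eta>0)" by (intro mult_left_mono le) simp
      also have "\<dots> = ennreal (1 / \<eta>0 * (\<beta> * \<eta>0))" using \<eta>0 \<beta> by (intro ennreal_mult[symmetric]) auto
      also have "1 / \<eta>0 * (\<beta> * \<eta>0) = \<beta>" using \<eta>0 by simp
      finally show ?thesis .
    qed
    have \<pi>y0: "\<pi> y0 = y0" by (simp add: \<pi>_def)
    have bD: "C.bound t (\<lambda>(x, y). ennreal (\<Delta> x (\<pi> y))) \<le> ennreal D2" if t: "t < n" for t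
    proof -
      have "C.bound t (\<lambda>z. ennreal ((\<lambda>(x, y). \<Delta> x (\<pi> y)) z)) \<le> ennreal (1 / (1 - \<eta>0) * D' + e1 * \<kappa> + ((D - D') / 8 + \<tau> * \<beta>))"
        by (rule C.bound_le[OF t _ _ _ _ _ _ _ _ _ bad _ e0])
           (use \<Delta>0 JD D' \<kappa> \<tau> \<beta> DD \<pi>y0 in \<open>auto simp: less_imp_le cong: if_cong\<close>)
      also have "1 / (1 - \<eta>0) * D' + e1 * \<kappa> + ((D - D') / 8 + \<tau> * \<beta>) \<le> D2"
      proof -
        have "(1 + \<theta>) * D' = D' + \<theta> * D'" by (simp add: algebra_simps)
        then show ?thesis unfolding \<eta>0(3) D2_def using \<theta>D e1D \<beta>D by argo
      qed
      finally show ?thesis by (simp add: case_prod_beta' ennreal_leI)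
    qed
    \<comment> \<open>The excess at an atom is a quarter of \<open>\<zeta>\<close> from inflation
      and an eighth each from exhausted codebooks and exceptional inputs. An indicator is at most 1,
      so with cutoff \<open>\<tau> = 1\<close> the tail is 0.\<close>
    have bS: "C.bound t (\<lambda>(x, y). indicator (\<pi> -` {s}) y) \<le> ennreal (measure q {s} + \<zeta> / 2)" if t: "t < n" for t s
    proof -
      have A: "\<pi> -` {s} \<in> sets borel" using measurable_sets[OF \<pi>m, of "{s}"] by simp
      have i1: "(indicator (\<pi> -` {s}) y0 :: real) \<le> 1" by simp
      have "(\<integral>\<^sup>+x. ennreal (indicator (\<pi> -` {s}) y0) \<partial>M) \<le> (\<integral>\<^sup>+x. 1 \<partial>M)"
        by (intro nn_integral_mono) (auto split: split_indicator)
      then have i2: "(\<integral>\<^sup>+x. ennreal (indicator (\<pi> -` {s}) y0) \<partial>M) \<le> ennreal 1" by (simp add: M.emeasure_space_1)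
      have "C.bound t (\<lambda>z. ennreal ((\<lambda>(x, y). indicator (\<pi> -` {s}) y) z)) \<le> ennreal (1 / (1 - \<eta>0) * measure q {s} + e1 * 1 + (0 + 1 * \<beta>))"
        by (rule C.bound_le[OF t _ _ _ _ _ _ _ _ _ bad _ e0])
           (use JS[of s] i1 i2 A \<beta> in \<open>auto simp: less_imp_le\<close>)
      also have "1 / (1 - \<eta>0) * measure q {s} + e1 * 1 + (0 + 1 * \<beta>) \<le> measure q {s} + \<zeta> / 2"
      proof -
        have "\<theta> * measure q {s} \<le> \<zeta> / 4 * 1" using \<theta> \<zeta> by (intro mult_mono) auto
        moreover have "(1 + \<theta>) * measure q {s} = measure q {s} + \<theta> * measure q {s}" by (simp add: algebra_simps)
        ultimately show ?thesis unfolding \<eta>0(3) using e1 \<beta> by argo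
      qed
      finally show ?thesis by (simp add: case_prod_beta' ennreal_leI ennreal_indicator)
    qed
    define v where "v = real n * card S * p ^ k"
    have v: "0 \<le> v" "v \<le> \<zeta>\<^sup>2 / 8" "v \<le> T * (D - D2)" using A3 p by (auto simp: v_def k_def)
    define c where "c = T / n"
    have c: "0 < c" "c * (n * D2) = T * D2" using T n by (auto simp: c_def)
    show ?thesis
    proof (rule C.nr_code_of_rejection[OF n S(1) y0 \<pi>_def \<Delta> c(1) D2(1) bD bS])
      show "0 \<le> measure q {s} + \<zeta> / 2" for s using \<zeta> by simp
      show "log 2 (2 ^ k * (N + 1)) \<le> n * R"
      proof -
        have n1: "1 \<le> real n" using n by simp
        have nL: "1 \<le> real n * L" using mult_mono[OF n1 L] n1 by simp
        have "real N + 1 \<le> 3 * real n * L" using N nL by simp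
        then have "2 ^ k * (real N + 1) \<le> 2 ^ k * (3 * real n * L)" by (intro mult_left_mono) auto
        then have "log 2 (2 ^ k * (real N + 1)) \<le> log 2 (2 ^ k * (3 * real n * L))" by (intro log_mono) (auto intro!: mult_pos_pos)
        also have "\<dots> = k + log 2 (3 * real n) + log 2 L"
          using n L by (simp add: log_mult log_nat_power)
        also have "log 2 L = n * (I + \<delta>)" by (simp add: L_def a_def \<delta>'_def log_def field_simps)
        also have "k + log 2 (3 * real n) + n * (I + \<delta>) \<le> \<delta> * n + \<delta> * n + n * (I + \<delta>)" using k A4 by simp
        also have "\<dots> = n * (I + 3 * \<delta>)" by (simp add: algebra_simps)
        also have "\<dots> \<le> n * R" using \<delta> by (intro mult_left_mono) auto
        finally show ?thesis by (simp add: add.commute distrib_left)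
      qed
      show "(real n * card S * p ^ k + c * (n * D2)) / c \<le> n * D"
      proof -
        have "v + T * D2 \<le> T * D" using v(3) by (simp add: algebra_simps)
        then have "(v + T * D2) / c \<le> T * D / c" using c(1) by (intro divide_right_mono) auto
        also have "\<dots> = n * D" using T n by (simp add: c_def)
        finally show ?thesis unfolding c(2) v_def .
      qed
      show "0 \<le> P" using P' by simp
      fix \<gamma> assume \<gamma>: "prob_meas \<gamma>" "emeasure \<gamma> S = 1" and
        le: "\<And>s. s \<in> S \<Longrightarrow> measure \<gamma> {s} \<le> measure q {s} + \<zeta> / 2 + sqrt (real n * card S * p ^ k + c * (n * D2))"
      \<comment> \<open>\<open>v\<close> and \<open>T * D2\<close> are each at most an eighth of
        \<open>\<zeta>\<^sup>2\<close>, so the root adds the second half of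
        \<open>\<zeta>\<close>.\<close>
      have "sqrt (real n * card S * p ^ k + c * (n * D2)) \<le> \<zeta> / 2"
      proof (rule real_le_lsqrt)
        show "real n * card S * p ^ k + c * (n * D2) \<le> (\<zeta> / 2)\<^sup>2"
          unfolding c(2) using v(2) T(2) by (simp add: v_def power_divide)
      qed (use \<zeta> in auto)
      then show "d M \<gamma> \<le> ennreal P"
        using le by (intro near[OF \<gamma>]) force
    qed
  qed
  then have "\<forall>\<^sub>F n in sequentially. nr_code M \<Delta> d D P R n"
    by (rule eventually_mono[OF ev]) auto
  then show ?thesis
    unfolding achievable_nr_def eventually_sequentially by blast
qed

section \<open>Sources under which every event has probability 0 or 1\<close>

lemma zero_one_measure_eq_return:
  fixes M :: "'a::polish_space measure"
  assumes M: "prob_meas M" and zo: "\<And>E. E \<in> sets borel \<Longrightarrow> measure M E = 0 \<or> measure M E = 1"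
  obtains a where "M = return borel a"
proof -
  interpret prob_space M by (rule prob_measD[OF M])
  have sM: "sets M = sets borel" and sp: "space M = UNIV" using prob_measD[OF M] by auto
  obtain \<B> :: "'a set set" where \<B>: "countable \<B>" "topological_basis \<B>" using ex_countable_basis by auto
  have op: "B \<in> sets M" if "B \<in> \<B>" for B
    using topological_basis_open[OF \<B>(2) that] sM by auto
  \<comment> \<open>The union of the null sets of a countable basis is null, and its complement is
    the support of \<open>M\<close>. Two distinct points of the support would have disjoint
    neighbourhoods of probability 1 each.\<close>
  define U where "U = (\<Union>B\<in>{B\<in>\<B>. emeasure M B = 0}. B)"
  have "U \<in> null_sets M"
    unfolding U_def using \<B>(1) op by (intro null_sets_UN') (auto intro: countable_subset[of _ \<B>] null_setsI)
  then have U: "U \<in> sets M" "emeasure M U = 0" by auto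
  have UC: "measure M (- U) = 1"
    using prob_compl[OF U(1)] U(2) by (simp add: sp Compl_eq_Diff_UNIV measure_def)
  have "- U \<noteq> {}" using UC by (metis measure_empty zero_neq_one)
  then obtain a where a: "a \<notin> U" by auto
  have uniq: "b = a" if b: "b \<notin> U" for b
  proof (rule ccontr)
    assume "b \<noteq> a"
    then obtain V W where VW: "open V" "open W" "b \<in> V" "a \<in> W" "V \<inter> W = {}"
      using hausdorff[of b a] by blast
    obtain V' where V': "V' \<in> \<B>" "b \<in> V'" "V' \<subseteq> V" using topological_basisE[OF \<B>(2) VW(1,3)] by blast
    obtain W' where W': "W' \<in> \<B>" "a \<in> W'" "W' \<subseteq> W" using topological_basisE[OF \<B>(2) VW(2,4)] by blast
    have "emeasure M V' \<noteq> 0" "emeasure M W' \<noteq> 0" using V' W' a b by (auto simp: U_def)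
    then have "measure M V' = 1" "measure M W' = 1"
      using zo[of V'] zo[of W'] op[OF V'(1)] op[OF W'(1)] sM by (auto simp: emeasure_eq_measure)
    moreover have "measure M (V' \<union> W') = measure M V' + measure M W'"
    proof -
      have "V' \<inter> W' = {}" using V'(3) W'(3) VW(5) by blast
      then show ?thesis by (rule finite_measure_Union[OF op[OF V'(1)] op[OF W'(1)]])
    qed
    ultimately have "measure M (V' \<union> W') = 2" by (simp only: one_add_one)
    then show False using prob_le_1[of "V' \<union> W'"] by linarith
  qed
  have "- U = {a}" using a uniq by blast
  then have M1: "emeasure M {a} = 1" using UC by (simp add: emeasure_eq_measure)
  have "M = return borel a"
  proof (rule prob_meas_eqI[OF M prob_meas_return])
    fix A :: "'a set" assume "A \<in> sets borel"
    then show "emeasure M A = emeasure (return borel a) A"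
      using emeasure_finite_support[OF M, of "{a}" A] M1 by (simp add: emeasure_eq_measure)
  qed
  then show thesis by (rule that)
qed

text \<open>A constant source is reproduced by a constant decoder, with entropy, distortion and
  divergence all equal to 0.\<close>

lemma achievable_return:
  fixes \<Delta> :: "'a::polish_space \<Rightarrow> 'a \<Rightarrow> real"
  assumes \<Delta>: "case_prod \<Delta> \<in> borel_measurable (borel \<Otimes>\<^sub>M borel)" and \<Delta>0: "\<Delta> a a = 0"
    and d0: "d (return borel a) (return borel a) = 0" and D: "0 \<le> D" and P: "0 \<le> P"
  shows "achievable_nr (return borel a) \<Delta> d D P 0"
proof -
  let ?M = "return borel a :: 'a measure"
  interpret M: prob_space ?M by (rule prob_measD[OF prob_meas_return])
  have "nr_code ?M \<Delta> d D P 0 n" for n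
  proof -
    let ?PM = "\<Pi>\<^sub>M i\<in>{..<n}. ?M"
    interpret PM: product_prob_space "\<lambda>_. ?M" "{..<n}" ..
    have e: "measure ?PM ((\<lambda>_. 0) -` {z} \<inter> space ?PM) * log 2 (measure ?PM ((\<lambda>_. 0) -` {z} \<inter> space ?PM)) = 0" for z :: nat
      by (cases "z = 0") (simp_all add: PM.P.prob_space vimage_def)
    have "entropy_disc ?PM (\<lambda>_. 0) = 0"
      unfolding entropy_disc_def e by simp
    moreover have "(\<integral>\<^sup>+x. ennreal (\<Delta> (x t) a) \<partial>?PM) = 0" if t: "t < n" for t
    proof -
      have \<Delta>a: "(\<lambda>x. ennreal (\<Delta> x a)) \<in> borel_measurable borel"
        using measurable_compose[OF measurable_Pair2' \<Delta>, of a] by simp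
      have "distr ?PM ?M (\<lambda>x. x t) = ?M" using t by (intro PM.PiM_component) auto
      then have "(\<integral>\<^sup>+x. ennreal (\<Delta> x a) \<partial>?M) = (\<integral>\<^sup>+x. ennreal (\<Delta> x a) \<partial>distr ?PM ?M (\<lambda>x. x t))" by simp
      also have "\<dots> = (\<integral>\<^sup>+x. ennreal (\<Delta> (x t) a) \<partial>?PM)"
        using t \<Delta>a by (intro nn_integral_distr measurable_component_singleton) auto
      finally show ?thesis using \<Delta>a \<Delta>0 by (simp add: nn_integral_return)
    qed
    moreover have "distr ?PM borel (\<lambda>_. a) = ?M"
      by (rule PM.P.distr_const) simp
    ultimately show ?thesis
      unfolding nr_code_def using D P d0
      by (intro exI[of _ "\<lambda>_. 0"] exI[of _ "\<lambda>_ _. a"]) (auto simp: enn2ereal_le_ereal_iff)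
  qed
  then show ?thesis by (auto simp: achievable_nr_def)
qed

lemma RDP_nonneg: "0 \<le> RDP M \<Delta> d D P"
  unfolding RDP_def by (intro Inf_greatest) auto

text \<open>(A2) makes the divergence finite for the laws on each of two finite supports, hence at
  all point masses of their union; convexity extends this to every law on the union.\<close>

lemma mix_convex_finite_on_finite_support:
  fixes \<gamma> :: "'a::polish_space measure"
  assumes \<phi>: "mix_convex \<phi>" and S: "finite S" and fin: "\<And>s. s \<in> S \<Longrightarrow> \<phi> (return borel s) < \<infinity>"
    and \<gamma>: "prob_meas \<gamma>" "emeasure \<gamma> S = 1"
  shows "\<phi> \<gamma> < \<infinity>"
proof -
  have "\<phi> \<gamma> \<le> (\<Sum>s\<in>S. \<phi> (return borel s))"
  proof (rule mix_convex_finite_mixture_le[OF \<phi> S, of "return borel" _ "\<lambda>s. measure \<gamma> {s}"])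
    show "\<phi> (return borel s) \<le> (\<Sum>s\<in>S. \<phi> (return borel s))" if "s \<in> S" for s
      using that S by (intro member_le_sum) auto
    show "(\<Sum>s\<in>S. measure \<gamma> {s}) = 1" by (rule sum_measure_singletons[OF \<gamma>(1) S \<gamma>(2)])
    show "emeasure \<gamma> A = (\<Sum>s\<in>S. ennreal (measure \<gamma> {s}) * emeasure (return borel s) A)" if "A \<in> sets borel" for A
      using emeasure_finite_support[OF \<gamma>(1) S \<gamma>(2) that] that by simp
  qed (auto simp: prob_meas_return \<gamma>)
  also have "\<dots> < \<infinity>" using fin S by simp
  finally show ?thesis .
qed

lemma ennreal_convex_comb_bound:
  assumes "x \<le> ennreal a" "y \<le> ennreal b" "0 \<le> a" "0 \<le> b" "0 \<le> l" "l \<le> 1"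
  shows "ennreal l * x + ennreal (1 - l) * y \<le> ennreal (l * a + (1 - l) * b)"
proof -
  have "ennreal l * x + ennreal (1 - l) * y \<le> ennreal l * ennreal a + ennreal (1 - l) * ennreal b"
    using assms by (intro add_mono mult_left_mono) auto
  also have "\<dots> = ennreal (l * a + (1 - l) * b)" using assms by (simp add: ennreal_mult)
  finally show ?thesis .
qed

theorem theorem2:
  fixes M :: "'a::polish_space measure"
    and \<Delta> :: "'a \<Rightarrow> 'a \<Rightarrow> real"
    and d :: "'a measure \<Rightarrow> 'a measure \<Rightarrow> ennreal"
  assumes pX: "prob_meas M"
    and \<Delta>_meas: "case_prod \<Delta> \<in> borel_measurable (borel \<Otimes>\<^sub>M borel)"
    and \<Delta>_nonneg: "\<And>x y. \<Delta> x y \<ge> 0"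
    and \<Delta>_zero: "\<And>x y. \<Delta> x y = 0 \<longleftrightarrow> x = y"
    and d_zero: "\<And>\<mu> \<nu>. prob_meas \<mu> \<Longrightarrow> prob_meas \<nu> \<Longrightarrow> d \<mu> \<nu> = 0 \<longleftrightarrow> \<mu> = \<nu>"
    and A1: "\<And>\<mu> \<nu>1 \<nu>2 l. prob_meas \<mu> \<Longrightarrow> prob_meas \<nu>1 \<Longrightarrow> prob_meas \<nu>2 \<Longrightarrow>
               0 \<le> l \<Longrightarrow> l \<le> 1 \<Longrightarrow>
               d \<mu> (mix l \<nu>1 \<nu>2) \<le> ennreal l * d \<mu> \<nu>1 + ennreal (1 - l) * d \<mu> \<nu>2"
    and A2a: "\<And>D P. D > 0 \<Longrightarrow> P > 0 \<Longrightarrow> RDP M \<Delta> d D P < \<infinity>"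
    and A2b: "\<And>D P \<epsilon>. D > 0 \<Longrightarrow> P > 0 \<Longrightarrow> \<epsilon> > 0 \<Longrightarrow>
               \<exists>K S. markov_kernel K \<and> finite S
                 \<and> emeasure (outlaw M K) S = 1
                 \<and> (\<forall>s\<in>S. emeasure (outlaw M K) {s} > 0)
                 \<and> enn2ereal (mutual_info M K) \<le> RDP M \<Delta> d D P + ereal \<epsilon>
                 \<and> enn2ereal (exp_dist M \<Delta> K) \<le> ereal (D + \<epsilon>)
                 \<and> (\<integral>\<^sup>+ x. ennreal (Max ((\<Delta> x) ` S)) \<partial>M) < \<infinity>
                 \<and> enn2ereal (d M (outlaw M K)) \<le> ereal (P + \<epsilon>)
                 \<and> (\<forall>\<gamma>. prob_meas \<gamma> \<and> emeasure \<gamma> S = 1 \<longrightarrow> d M \<gamma> < \<infinity>)"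
    and D_pos: "D > 0" and P_pos: "P > 0"
  shows "R_nr M \<Delta> d D P = RDP M \<Delta> d D P"
proof (rule antisym)
  have \<phi>: "mix_convex (d M)" unfolding mix_convex_def using A1[OF pX] by blast
  show "RDP M \<Delta> d D P \<le> R_nr M \<Delta> d D P"
    unfolding R_nr_def
  proof (rule Inf_greatest)
    fix x assume "x \<in> ereal ` {R. achievable_nr M \<Delta> d D P R}"
    then obtain R N where R: "x = ereal R" "\<And>n. n \<ge> N \<Longrightarrow> n > 0 \<Longrightarrow> nr_code M \<Delta> d D P R n"
      by (auto simp: achievable_nr_def)
    \<comment> \<open>\<open>Suc N\<close> is a positive block length beyond the threshold.\<close>
    have "RDP M \<Delta> d D P \<le> ereal R"
      using R(2)[of "Suc N"] by (intro RDP_le_of_nr_code[where d = d and n = "Suc N"] pX \<Delta>_meas \<phi>) auto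
    then show "RDP M \<Delta> d D P \<le> x" by (simp add: R(1))
  qed
  show "R_nr M \<Delta> d D P \<le> RDP M \<Delta> d D P"
  proof (cases "\<forall>E\<in>sets borel. measure M E = 0 \<or> measure M E = 1")
    case True
    then obtain a where a: "M = return borel a" using zero_one_measure_eq_return[OF pX] by blast
    have "achievable_nr M \<Delta> d D P 0"
      unfolding a using D_pos P_pos \<Delta>_zero[of a a] d_zero[OF prob_meas_return prob_meas_return, of a a]
      by (intro achievable_return \<Delta>_meas) auto
    then have "R_nr M \<Delta> d D P \<le> ereal 0" unfolding R_nr_def by (intro Inf_lower) blast
    also have "\<dots> \<le> RDP M \<Delta> d D P" using RDP_nonneg[of M \<Delta> d D P] by (simp add: zero_ereal_def)
    finally show ?thesis .
  next
    case False
    interpret M: prob_space M by (rule prob_measD[OF pX])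
    from False obtain E where E: "E \<in> sets borel" "measure M E \<noteq> 0" "measure M E \<noteq> 1" by blast
    then have E': "0 < measure M E" "measure M E < 1"
      using M.prob_le_1[of E] by (auto simp: less_le)
    have RDPr: "\<exists>\<rho>\<ge>0. RDP M \<Delta> d D P = ereal \<rho>" if "0 < D" "0 < P" for D P
      using RDP_nonneg[of M \<Delta> d D P] A2a[OF that] by (cases "RDP M \<Delta> d D P") auto
    obtain \<rho> where \<rho>: "0 \<le> \<rho>" "RDP M \<Delta> d D P = ereal \<rho>" using RDPr[OF D_pos P_pos] by blast
    obtain \<rho>0 where \<rho>0: "0 \<le> \<rho>0" "RDP M \<Delta> d (D / 4) (P / 4) = ereal \<rho>0" using RDPr[of "D / 4" "P / 4"] D_pos P_pos by auto
    \<comment> \<open>The auxiliary kernel is taken for the levels \<open>D / 4\<close> and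
      \<open>P / 4\<close>, with overshoot at most another quarter, and so meets both constraints at
      one half.\<close>
    define \<epsilon>0 where "\<epsilon>0 = min (D / 4) (P / 4)"
    have \<epsilon>0: "0 < \<epsilon>0" "\<epsilon>0 \<le> D / 4" "\<epsilon>0 \<le> P / 4" using D_pos P_pos by (auto simp: \<epsilon>0_def min_def)
    obtain K0 S0 where K0: "markov_kernel K0" and S0: "finite S0" "emeasure (outlaw M K0) S0 = 1"
        "\<And>s. s \<in> S0 \<Longrightarrow> emeasure (outlaw M K0) {s} > 0"
      and I0: "enn2ereal (mutual_info M K0) \<le> RDP M \<Delta> d (D / 4) (P / 4) + ereal \<epsilon>0"
      and D0: "enn2ereal (exp_dist M \<Delta> K0) \<le> ereal (D / 4 + \<epsilon>0)"
      and \<Delta>0: "(\<integral>\<^sup>+ x. ennreal (Max ((\<Delta> x) ` S0)) \<partial>M) < \<infinity>"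
      and P0: "enn2ereal (d M (outlaw M K0)) \<le> ereal (P / 4 + \<epsilon>0)"
      and fin0: "\<And>\<gamma>. prob_meas \<gamma> \<Longrightarrow> emeasure \<gamma> S0 = 1 \<Longrightarrow> d M \<gamma> < \<infinity>"
      using A2b[of "D / 4" "P / 4" \<epsilon>0] D_pos P_pos \<epsilon>0 by auto
    have I0': "mutual_info M K0 \<le> ennreal (\<rho>0 + \<epsilon>0)" using I0 by (simp add: \<rho>0 enn2ereal_le_ereal_iff)
    have D0': "exp_dist M \<Delta> K0 \<le> ennreal (D / 2)"
      by (rule order_trans[OF conjunct2[OF D0[unfolded enn2ereal_le_ereal_iff]] ennreal_leI]) (use \<epsilon>0 in linarith)
    have P0': "d M (outlaw M K0) \<le> ennreal (P / 2)"
      by (rule order_trans[OF conjunct2[OF P0[unfolded enn2ereal_le_ereal_iff]] ennreal_leI]) (use \<epsilon>0 in linarith)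
    have "R_nr M \<Delta> d D P \<le> RDP M \<Delta> d D P + ereal \<epsilon>" if \<epsilon>: "0 < \<epsilon>" for \<epsilon>
    proof -
      \<comment> \<open>Weight of the auxiliary kernel: its information, however large, adds at most
        \<open>\<epsilon> / 4\<close>.\<close>
      define w where "w = min (1 / 2) (\<epsilon> / (4 * (\<rho>0 + \<epsilon>0)))"
      have w: "0 < w" "w < 1" "w * (\<rho>0 + \<epsilon>0) \<le> \<epsilon> / 4"
      proof -
        have pos: "0 < \<rho>0 + \<epsilon>0" using \<rho>0 \<epsilon>0 by simp
        show "0 < w" "w < 1" using \<epsilon> pos by (auto simp: w_def)
        have "w * (\<rho>0 + \<epsilon>0) \<le> \<epsilon> / (4 * (\<rho>0 + \<epsilon>0)) * (\<rho>0 + \<epsilon>0)" using pos by (intro mult_right_mono) (auto simp: w_def)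
        also have "\<dots> = \<epsilon> / 4" using pos by (simp add: field_simps)
        finally show "w * (\<rho>0 + \<epsilon>0) \<le> \<epsilon> / 4" .
      qed
      \<comment> \<open>The auxiliary kernel saves \<open>w * D / 2\<close> of distortion and
        \<open>w * P / 2\<close> of divergence, and the overshoot of the near-optimal kernel may
        consume half of the saving; hence it is chosen after \<open>w\<close>.\<close>
      define \<epsilon>1 where "\<epsilon>1 = Min {\<epsilon> / 4, w * D / 4, w * P / 4}"
      have \<epsilon>1: "0 < \<epsilon>1" "\<epsilon>1 \<le> \<epsilon> / 4" "\<epsilon>1 \<le> w * D / 4" "\<epsilon>1 \<le> w * P / 4"
        using \<epsilon> w D_pos P_pos by (auto simp: \<epsilon>1_def)
      obtain K1 S1 where K1: "markov_kernel K1" and S1: "finite S1" "emeasure (outlaw M K1) S1 = 1"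
          "\<And>s. s \<in> S1 \<Longrightarrow> emeasure (outlaw M K1) {s} > 0"
        and I1: "enn2ereal (mutual_info M K1) \<le> RDP M \<Delta> d D P + ereal \<epsilon>1"
        and D1: "enn2ereal (exp_dist M \<Delta> K1) \<le> ereal (D + \<epsilon>1)"
        and \<Delta>1: "(\<integral>\<^sup>+ x. ennreal (Max ((\<Delta> x) ` S1)) \<partial>M) < \<infinity>"
        and P1: "enn2ereal (d M (outlaw M K1)) \<le> ereal (P + \<epsilon>1)"
        and fin1: "\<And>\<gamma>. prob_meas \<gamma> \<Longrightarrow> emeasure \<gamma> S1 = 1 \<Longrightarrow> d M \<gamma> < \<infinity>"
        using A2b[OF D_pos P_pos \<epsilon>1(1)] by auto
      have I1': "mutual_info M K1 \<le> ennreal (\<rho> + \<epsilon>1)" using I1 by (simp add: \<rho> enn2ereal_le_ereal_iff)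
      have D1': "exp_dist M \<Delta> K1 \<le> ennreal (D + \<epsilon>1)" using D1 by (simp add: enn2ereal_le_ereal_iff)
      have P1': "d M (outlaw M K1) \<le> ennreal (P + \<epsilon>1)" using P1 by (simp add: enn2ereal_le_ereal_iff)
      let ?K = "\<lambda>x. mix w (K0 x) (K1 x)"
      let ?S = "S0 \<union> S1"
      have l: "0 \<le> w" "w \<le> 1" using w by auto
      note q0 = prob_meas_outlaw[OF pX K0] and q1 = prob_meas_outlaw[OF pX K1]
      have out: "outlaw M ?K = mix w (outlaw M K0) (outlaw M K1)" by (rule outlaw_mix[OF pX K0 K1 l])
      have fS: "finite ?S" using S0 S1 by simp
      have Sb: "T \<in> sets borel" if "finite T" for T :: "'a set" using that by (auto intro: borel_closed finite_imp_closed)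
      have sup: "emeasure \<nu> ?S = 1" if \<nu>: "prob_meas \<nu>" and T: "T \<subseteq> ?S" "emeasure \<nu> T = 1" for \<nu> T
      proof (rule antisym)
        interpret prob_space \<nu> by (rule prob_measD[OF \<nu>])
        show "emeasure \<nu> ?S \<le> 1" by (rule emeasure_le_1)
        have "emeasure \<nu> T \<le> emeasure \<nu> ?S"
          using T Sb[OF fS] prob_measD(2)[OF \<nu>] by (intro emeasure_mono) auto
        then show "1 \<le> emeasure \<nu> ?S" using T by simp
      qed
      have AE: "AE y in \<nu>. y \<in> ?S" if \<nu>: "prob_meas \<nu>" "emeasure \<nu> ?S = 1" for \<nu>
      proof -
        interpret prob_space \<nu> by (rule prob_measD[OF \<nu>(1)])
        show ?thesis using \<nu>(2) Sb[OF fS] prob_measD(2)[OF \<nu>(1)]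
          by (subst prob_eq_1[symmetric]) (auto simp: emeasure_eq_measure)
      qed
      have e0: "emeasure (outlaw M K0) ?S = 1" and e1: "emeasure (outlaw M K1) ?S = 1"
        using sup[OF q0 _ S0(2)] sup[OF q1 _ S1(2)] by auto
      have "achievable_nr M \<Delta> d D P (\<rho> + \<epsilon>)"
      proof (rule achievable_of_kernel[where d = d and K = ?K and S = ?S and E = E and I = "\<rho> + \<epsilon> / 2" and D' = "D - w * D / 4" and P' = "P - w * P / 4"])
        show "markov_kernel ?K" by (rule markov_kernel_mix[OF K0 K1 l])
        have "prob_meas (outlaw M ?K)" by (intro prob_meas_outlaw pX markov_kernel_mix K0 K1 l)
        show "emeasure (outlaw M ?K) ?S = 1"
          unfolding out using e0 e1 l Sb[OF fS] by (simp add: emeasure_mix[OF q0 q1] flip: ennreal_plus)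
        show "0 < emeasure (outlaw M ?K) {s}" if "s \<in> ?S" for s
          unfolding out using that S0(3)[of s] S1(3)[of s] w
          by (auto simp: emeasure_mix[OF q0 q1] add_pos_nonneg add_nonneg_pos ennreal_zero_less_mult_iff)
        have "mutual_info M ?K \<le> ennreal w * mutual_info M K0 + ennreal (1 - w) * mutual_info M K1"
          using fS by (intro mutual_info_mix_le[OF pX K0 K1 l, of ?S] AE q0 q1 e0 e1) (auto intro: countable_finite)
        also have "\<dots> \<le> ennreal (w * (\<rho>0 + \<epsilon>0) + (1 - w) * (\<rho> + \<epsilon>1))"
          using \<rho> \<rho>0 \<epsilon>0 \<epsilon>1 by (intro ennreal_convex_comb_bound I0' I1' l) auto
        also have "\<dots> \<le> ennreal (\<rho> + \<epsilon> / 2)"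
        proof (rule ennreal_leI)
          have "(1 - w) * (\<rho> + \<epsilon>1) \<le> 1 * (\<rho> + \<epsilon>1)" using l \<rho> \<epsilon>1 by (intro mult_right_mono) auto
          from add_mono[OF w(3) this] show "w * (\<rho>0 + \<epsilon>0) + (1 - w) * (\<rho> + \<epsilon>1) \<le> \<rho> + \<epsilon> / 2"
            by (rule order_trans) (use \<epsilon>1(2) in simp)
        qed
        finally show "mutual_info M ?K \<le> ennreal (\<rho> + \<epsilon> / 2)" .
        have conv: "w * (x / 2) + (1 - w) * (x + \<epsilon>1) \<le> x - w * x / 4" if "0 < x" "\<epsilon>1 \<le> w * x / 4" for x
        proof -
          have "(1 - w) * \<epsilon>1 \<le> 1 * \<epsilon>1" using l \<epsilon>1 by (intro mult_right_mono) auto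
          moreover have "w * (x / 2) + (1 - w) * (x + \<epsilon>1) = x - w * x / 2 + (1 - w) * \<epsilon>1" by (simp add: algebra_simps)
          ultimately show ?thesis using that by argo
        qed
        have "exp_dist M \<Delta> ?K = ennreal w * exp_dist M \<Delta> K0 + ennreal (1 - w) * exp_dist M \<Delta> K1"
          by (rule exp_dist_mix[OF pX K0 K1 l \<Delta>_meas])
        also have "\<dots> \<le> ennreal (w * (D / 2) + (1 - w) * (D + \<epsilon>1))"
          using D_pos \<epsilon>1 by (intro ennreal_convex_comb_bound D0' D1' l) auto
        also have "\<dots> \<le> ennreal (D - w * D / 4)" by (intro ennreal_leI conv D_pos \<epsilon>1)
        finally show "exp_dist M \<Delta> ?K \<le> ennreal (D - w * D / 4)" .
        have "d M (outlaw M ?K) \<le> ennreal w * d M (outlaw M K0) + ennreal (1 - w) * d M (outlaw M K1)"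
          unfolding out by (intro A1 pX q0 q1 l)
        also have "\<dots> \<le> ennreal (w * (P / 2) + (1 - w) * (P + \<epsilon>1))"
          using P_pos \<epsilon>1 by (intro ennreal_convex_comb_bound P0' P1' l) auto
        also have "\<dots> \<le> ennreal (P - w * P / 4)" by (intro ennreal_leI conv P_pos \<epsilon>1)
        finally show "d M (outlaw M ?K) \<le> ennreal (P - w * P / 4)" .
        have "w * x / 4 \<le> x \<and> 0 < w * x / 4" if "0 < x" for x
        proof -
          have "w * x \<le> 1 * x" "0 < w * x" using l w that by (auto intro: mult_right_mono)
          then show ?thesis using that by linarith
        qed
        from this[OF D_pos] this[OF P_pos]
        show "0 \<le> D - w * D / 4" "D - w * D / 4 < D" "0 \<le> P - w * P / 4" "P - w * P / 4 < P" by auto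
        show "(\<integral>\<^sup>+x. ennreal (\<Delta> x s) \<partial>M) < \<infinity>" if "s \<in> ?S" for s
        proof -
          have *: "(\<integral>\<^sup>+x. ennreal (\<Delta> x s) \<partial>M) \<le> (\<integral>\<^sup>+x. ennreal (Max ((\<Delta> x) ` T)) \<partial>M)" if "finite T" "s \<in> T" for T
            using that by (intro nn_integral_mono ennreal_leI Max_ge) auto
          show ?thesis using \<open>s \<in> ?S\<close> *[OF S0(1)] *[OF S1(1)] \<Delta>0 \<Delta>1 by (auto intro: order.strict_trans1)
        qed
        show "d M \<gamma> < \<infinity>" if "prob_meas \<gamma>" "emeasure \<gamma> ?S = 1" for \<gamma>
        proof (rule mix_convex_finite_on_finite_support[OF \<phi> fS _ that])
          fix s assume "s \<in> ?S"
          then show "d M (return borel s) < \<infinity>"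
            using fin0[OF prob_meas_return, of s] fin1[OF prob_meas_return, of s] Sb[OF S0(1)] Sb[OF S1(1)] by auto
        qed
      qed (use pX \<Delta>_meas \<Delta>_nonneg fS E E' \<rho> \<epsilon> \<phi> in auto)
      then have "R_nr M \<Delta> d D P \<le> ereal (\<rho> + \<epsilon>)" unfolding R_nr_def by (intro Inf_lower) blast
      then show ?thesis by (simp add: \<rho>)
    qed
    then show ?thesis by (rule ereal_le_epsilon2)
  qed
qed

end
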